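(* Let $k\geq 1$ and $r\geq 2$ be fixed integers. There is a function $\phi$ such that the following holds. Let $H_1,\ldots,H_{k+1}$ be pairwise vertex-disjoint edge-critical graphs with $\chi(H_i)=r$ for every $i\in[k+1]$, let $\mathcal{H}_{k+1}=\{H_1,\ldots,H_{k+1}\}+v$, and for $j\in[k+1]$ let $\mathcal{H}_k^j=\{H_i: i\in[k+1]\setminus\{j\}\}+v$. If $n\geq \phi\bigl(r,|V(H_1)|,\ldots,|V(H_{k+1})|\bigr)$, then for every $j\in[k+1]$, $$\operatorname{ar}(n,\mathcal{H}_{k+1})=\operatorname{ex}(n,\mathcal{H}_{k}^{j})+1=t_r(n)+1+\begin{cases} k^2-k & \text{if } k \text{ is odd},\\ k^2-\frac{3}{2}k & \text{if } k \text{ is even}.\end{cases}$$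
   Context: All graphs are finite and simple; $[m]=\{1,\ldots,m\}$; $\chi$ denotes the chromatic number. A graph $H$ is edge-critical if it contains an edge $e$ with $\chi(H-e)<\chi(H)$. The graphs $H_1,\ldots,H_{k+1}$ need not be pairwise non-isomorphic, nor isomorphic. For a vertex $v$ and a multiset $\mathcal{H}$ of pairwise vertex-disjoint graphs (none containing $v$), the suspension $\mathcal{H}+v$ is the graph obtained from the disjoint union of the graphs in $\mathcal{H}$ by adding the vertex $v$ and joining $v$ to all vertices of every $H\in\mathcal{H}$. For a graph $F$ and a positive integer $n$: the Turán number $\operatorname{ex}(n,F)$ is the maximum number of edges in an $n$-vertex graph that does not contain $F$ as a (not necessarily induced) subgraph. An edge-colored graph is rainbow if all its edges have distinct colors. The anti-Ramsey number $\operatorname{ar}(n,F)$ is the maximum number of colors used in an edge-coloring (not necessarily proper) of the complete graph $K_n$ that contains no rainbow copy of $F$. The number $t_r(n)$ is the number of edges of the Turán graph $T_r(n)$, the $n$-vertex complete $r$-partite graph whose parts differ in size by at most one. *)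

theory Defs
  imports Complex_Main "HOL-Library.Ramsey" "HOL-Library.Disjoint_Sets"
begin

record 'a sgraph =
  verts :: "'a set"
  edges :: "'a set set"

text \<open>The set \<open>[V]\<^bsup>2\<^esup>\<close> of the two-element subsets of \<open>V\<close> comes from HOL-Library.Ramsey.\<close>

definition simple_graph :: "'a sgraph \<Rightarrow> bool" where
  "simple_graph G \<longleftrightarrow> finite (verts G) \<and> edges G \<subseteq> [verts G]\<^bsup>2\<^esup>"

definition delete_edge :: "'a sgraph \<Rightarrow> 'a set \<Rightarrow> 'a sgraph" where
  "delete_edge G e = G\<lparr>edges := edges G - {e}\<rparr>"

definition proper_coloring :: "'a sgraph \<Rightarrow> nat \<Rightarrow> ('a \<Rightarrow> nat) \<Rightarrow> bool" where
  "proper_coloring G m f \<longleftrightarrow>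
     f ` verts G \<subseteq> {..<m} \<and> (\<forall>x y. {x, y} \<in> edges G \<longrightarrow> f x \<noteq> f y)"

definition chromatic_number :: "'a sgraph \<Rightarrow> nat" where
  "chromatic_number G = (LEAST m. \<exists>f. proper_coloring G m f)"

definition edge_critical :: "'a sgraph \<Rightarrow> bool" where
  "edge_critical G \<longleftrightarrow>
     (\<exists>e\<in>edges G. chromatic_number (delete_edge G e) < chromatic_number G)"

text \<open>The multiset of graphs is given as an indexed family, so isomorphic members are allowed.
  The family is meant to have pairwise disjoint vertex sets avoiding \<open>v\<close>; then the plain union
  below is the disjoint union.\<close>

definition suspension :: "('i \<Rightarrow> 'a sgraph) \<Rightarrow> 'i set \<Rightarrow> 'a \<Rightarrow> 'a sgraph" where
  "suspension H I v =
     \<lparr>verts = insert v (\<Union>i\<in>I. verts (H i)),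
      edges = (\<Union>i\<in>I. edges (H i)) \<union> {{v, x} | x. x \<in> (\<Union>i\<in>I. verts (H i))}\<rparr>"

definition embedding :: "('a \<Rightarrow> 'b) \<Rightarrow> 'a sgraph \<Rightarrow> 'b sgraph \<Rightarrow> bool" where
  "embedding f F G \<longleftrightarrow>
     inj_on f (verts F) \<and> f ` verts F \<subseteq> verts G \<and> (\<forall>e\<in>edges F. f ` e \<in> edges G)"

definition contains_copy :: "'b sgraph \<Rightarrow> 'a sgraph \<Rightarrow> bool" where
  "contains_copy G F \<longleftrightarrow> (\<exists>f. embedding f F G)"

definition complete_graph :: "nat \<Rightarrow> nat sgraph" where
  "complete_graph n = \<lparr>verts = {..<n}, edges = [{..<n}]\<^bsup>2\<^esup>\<rparr>"

text \<open>The maximum defining \<open>ex_number n F\<close> is over a nonempty set as soon as \<open>F\<close> has an edge, and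
  the one defining \<open>ar_number n F\<close> as soon as \<open>F\<close> has two edges.\<close>

definition ex_number :: "nat \<Rightarrow> 'a sgraph \<Rightarrow> nat" where
  "ex_number n F = Max {card (edges G) | G :: nat sgraph.
     simple_graph G \<and> verts G = {..<n} \<and> \<not> contains_copy G F}"

definition rainbow :: "('b set \<Rightarrow> nat) \<Rightarrow> 'b set set \<Rightarrow> bool" where
  "rainbow c E \<longleftrightarrow> inj_on c E"

definition has_rainbow_copy :: "('b set \<Rightarrow> nat) \<Rightarrow> 'b sgraph \<Rightarrow> 'a sgraph \<Rightarrow> bool" where
  "has_rainbow_copy c G F \<longleftrightarrow> (\<exists>f. embedding f F G \<and> rainbow c ((`) f ` edges F))"

definition ar_number :: "nat \<Rightarrow> 'a sgraph \<Rightarrow> nat" where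
  "ar_number n F = Max {card (c ` edges (complete_graph n)) | c.
     \<not> has_rainbow_copy c (complete_graph n) F}"

text \<open>For \<open>r > 0\<close>, the residue classes modulo \<open>r\<close> split \<open>{..<n}\<close> into \<open>r\<close> parts whose sizes differ
  by at most one.\<close>

definition turan_graph :: "nat \<Rightarrow> nat \<Rightarrow> nat sgraph" where
  "turan_graph r n =
     \<lparr>verts = {..<n}, edges = {{x, y} | x y. x < n \<and> y < n \<and> x mod r \<noteq> y mod r}\<rparr>"

definition turan_number :: "nat \<Rightarrow> nat \<Rightarrow> nat" where
  "turan_number r n = card (edges (turan_graph r n))"

lemma card_residue_class:
  fixes n r i :: nat
  assumes "i < r"
  shows "card {x. x < n \<and> x mod r = i} = n div r + (if i < n mod r then 1 else 0)"
proof (induction n)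
  case 0
  then show ?case by simp
next
  case (Suc n)
  have "{x. x < Suc n \<and> x mod r = i} =
        (if n mod r = i then insert n {x. x < n \<and> x mod r = i} else {x. x < n \<and> x mod r = i})"
    by (auto simp: less_Suc_eq)
  with Suc assms show ?case
    by (auto simp: mod_Suc div_Suc)
qed

lemma turan_parts_balanced:
  fixes n r i j :: nat
  assumes "i < r" "j < r"
  shows "card {x \<in> verts (turan_graph r n). x mod r = i}
           \<le> card {x \<in> verts (turan_graph r n). x mod r = j} + 1"
  using card_residue_class[OF assms(1)] card_residue_class[OF assms(2)]
  by (simp add: turan_graph_def)

end

theory Submission
  imports Defs
begin

text \<open>Both lower bounds come from a Turan graph with an extremal graph for degree and matching
  number less than \<open>k\<close> placed in one part. For the upper bounds, deleting vertices of small
  degree one may assume minimum degree at least that of the Turan graph. Such a graph contains a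
  large complete \<open>r\<close>-partite graph, and if it has no suspension then every vertex has few
  neighbours in one of its parts. This splits the vertices into \<open>r\<close> classes such that only
  boundedly many edges lie inside classes or are missing between them; all other vertices are
  generic, that is, adjacent to exactly the vertices of the other classes. As \<open>H\<^sub>i\<close> minus a
  critical edge is \<open>(r - 1)\<close>-colourable, a suspension of \<open>k\<close> graphs is found as soon as some
  vertex \<open>x\<close> has \<open>d\<close> neighbours in its class and \<open>k - d\<close> disjoint edges inside other classes in
  its neighbourhood. Excluding this, the number of edges inside classes minus the number of
  missing edges is at most the claimed constant: with the Tutte-Berge formula this follows by
  charging each missing edge half to either end.

  For colourings, take a rainbow graph with one edge of each colour. Pairs of generic vertices in
  two classes can replace the edges of their colours \<open>\<alpha>\<close> and \<open>\<beta>\<close>. Without these two edges, either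
  \<open>k\<close> blades remain and one of the pairs supplies another one, or the counting bound is attained;
  in the latter case some class contains \<open>k - 1\<close> disjoint edges, and with both pairs they
  yield \<open>k + 1\<close> blades around an end of one of the pairs.\<close>

section \<open>Degrees, missing edges and Turan numbers\<close>

text \<open>The critical edges are used up in embedding a fan, a notion that forgets the graphs
  \<open>H i\<close> except for a bound \<open>s\<close> on their total number of vertices; this is
  why the thresholds depend on the sizes alone. The constant is the largest number of edges of a
  graph whose degrees and matching number are below \<open>k\<close>. The obstacle in the counting
  is that missing edges between classes may destroy fans and thus permit more inner edges, so the
  quantity to bound is inner minus missing edges. For colourings the difficulty is that only
  \<open>k + 1\<close> blades are excluded, while the number of colours is calibrated for
  \<open>k\<close>. The partition is therefore built for \<open>k + 1\<close> blades, and the sharp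
  count is applied after two colours have been given up. A surplus of \<open>excess k + 2\<close>
  over the Turan number then still leaves \<open>excess k\<close>, where the bound itself is no
  contradiction; its equality case is needed. The two exchanged pairs lie in different classes so
  that, whatever the class of a centre, one of them lies outside it and can serve as the critical
  edge of a further blade.\<close>

definition nbrs :: "'v set set \<Rightarrow> 'v \<Rightarrow> 'v set" where
  "nbrs E x = {y. {x, y} \<in> E}"

lemma nbrs_iff [simp]: "y \<in> nbrs E x \<longleftrightarrow> {x, y} \<in> E"
  by (simp add: nbrs_def)

lemma edgeD:
  assumes "E \<subseteq> [V]\<^bsup>2\<^esup>" "{x, y} \<in> E"
  shows "x \<in> V" "y \<in> V" "x \<noteq> y"
  using subsetD[OF assms] unfolding doubleton_in_nsets_2 by blast+

lemma nbrs_subset: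
  assumes "E \<subseteq> [V]\<^bsup>2\<^esup>"
  shows "nbrs E x \<subseteq> V - {x}"
proof
  fix y assume "y \<in> nbrs E x"
  then have "{x, y} \<in> E" by simp
  from edgeD[OF assms this] show "y \<in> V - {x}" by blast
qed

lemma finite_nbrs: "finite V \<Longrightarrow> E \<subseteq> [V]\<^bsup>2\<^esup> \<Longrightarrow> finite (nbrs E x)"
  by (meson nbrs_subset finite_Diff finite_subset)

lemma finite_edges: "finite V \<Longrightarrow> E \<subseteq> [V]\<^bsup>2\<^esup> \<Longrightarrow> finite E"
  by (meson finite_imp_finite_nsets finite_subset)

lemma card_nbrs:
  assumes "E \<subseteq> [V]\<^bsup>2\<^esup>"
  shows "card (nbrs E x) = card {e \<in> E. x \<in> e}"
proof -
  have "bij_betw (\<lambda>y. {x, y}) (nbrs E x) {e \<in> E. x \<in> e}"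
    unfolding bij_betw_def
  proof
    show "inj_on (\<lambda>y. {x, y}) (nbrs E x)"
      by (auto simp: inj_on_def doubleton_eq_iff)
    show "(\<lambda>y. {x, y}) ` nbrs E x = {e \<in> E. x \<in> e}"
    proof (intro equalityI subsetI)
      fix e assume e: "e \<in> {e \<in> E. x \<in> e}"
      then have "e \<in> [V]\<^bsup>2\<^esup>" using assms by auto
      then obtain a b where "e = {a, b}" by (elim nsets2_E)
      with e show "e \<in> (\<lambda>y. {x, y}) ` nbrs E x"
        by (auto simp: nbrs_def insert_commute)
    qed (auto simp: nbrs_def)
  qed
  then show ?thesis by (rule bij_betw_same_card)
qed

lemma handshake:
  assumes "finite V" "E \<subseteq> [V]\<^bsup>2\<^esup>"
  shows "(\<Sum>x\<in>V. card (nbrs E x)) = 2 * card E"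
proof -
  have "(\<Sum>x\<in>V. card (nbrs E x)) = (\<Sum>x\<in>V. card {e \<in> E. x \<in> e})"
    using card_nbrs[OF assms(2)] by simp
  also have "\<dots> = 2 * card E"
  proof (rule sum_multicount)
    show "\<forall>e\<in>E. card {x \<in> V. x \<in> e} = 2"
    proof
      fix e assume "e \<in> E"
      then have "e \<subseteq> V" "card e = 2" using assms by (auto simp: nsets_def)
      then have "{x \<in> V. x \<in> e} = e" by auto
      with \<open>card e = 2\<close> show "card {x \<in> V. x \<in> e} = 2" by simp
    qed
  qed (use assms finite_edges in auto)
  finally show ?thesis .
qed

section \<open>Edges inside the classes of a partition and missing edges between them\<close>

definition inner :: "('v \<Rightarrow> nat) \<Rightarrow> 'v set set \<Rightarrow> 'v set set" where
  "inner part E = {e \<in> E. \<exists>i. part ` e \<subseteq> {i}}"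

definition missing :: "'v set \<Rightarrow> ('v \<Rightarrow> nat) \<Rightarrow> 'v set set \<Rightarrow> 'v set set" where
  "missing V part E = {e \<in> [V]\<^bsup>2\<^esup>. e \<notin> E \<and> (\<nexists>i. part ` e \<subseteq> {i})}"

lemma doubleton_inner [simp]: "{x, y} \<in> inner part E \<longleftrightarrow> {x, y} \<in> E \<and> part x = part y"
  by (auto simp: inner_def)

lemma doubleton_missing [simp]:
  "{x, y} \<in> missing V part E \<longleftrightarrow> x \<in> V \<and> y \<in> V \<and> part x \<noteq> part y \<and> {x, y} \<notin> E"
  by (auto simp: missing_def)

lemma inner_subset: "inner part E \<subseteq> E"
  by (auto simp: inner_def)

lemma missing_subset: "missing V part E \<subseteq> [V]\<^bsup>2\<^esup>"
  by (auto simp: missing_def)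

text \<open>\<open>missing V part {}\<close> is the edge set of the complete multipartite graph on
  the classes. It splits into the edges of \<open>E\<close> between classes and the missing ones, so
  a surplus of \<open>E\<close> over this graph turns into inner minus missing edges.\<close>

lemma card_inner_missing:
  assumes "finite V" "E \<subseteq> [V]\<^bsup>2\<^esup>"
  shows "card E + card (missing V part E) = card (inner part E) + card (missing V part {})"
proof -
  have fin: "finite E" "finite ([V]\<^bsup>2\<^esup>)"
    using assms finite_edges finite_imp_finite_nsets by auto
  have "missing V part {} = (E - inner part E) \<union> missing V part E"
    using assms by (auto simp: missing_def inner_def)
  moreover have "(E - inner part E) \<inter> missing V part E = {}"
    by (auto simp: missing_def)
  moreover have "finite (missing V part E)"
    by (rule finite_subset[OF missing_subset fin(2)])
  ultimately have "card (missing V part {}) = card (E - inner part E) + card (missing V part E)"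
    using fin by (simp add: card_Un_disjoint)
  moreover have "card E = card (E - inner part E) + card (inner part E)"
    using fin inner_subset[of part E]
    by (metis card_Diff_subset card_mono finite_subset le_add_diff_inverse2)
  ultimately show ?thesis by simp
qed

section \<open>Turan numbers and complete multipartite graphs\<close>

lemma turan_number_0 [simp]: "turan_number r 0 = 0"
  by (simp add: turan_number_def turan_graph_def)

lemma turan_edges_Suc:
  "edges (turan_graph r (Suc n)) = edges (turan_graph r n) \<union> (\<lambda>y. {n, y}) ` {y. y < n \<and> y mod r \<noteq> n mod r}"
  (is "?L = ?R")
proof (intro equalityI subsetI)
  fix e assume "e \<in> ?L"
  then obtain x y where e: "e = {x, y}" "x < Suc n" "y < Suc n" "x mod r \<noteq> y mod r"
    by (auto simp: turan_graph_def)
  then consider "x < n" "y < n" | "x = n" "y < n" | "y = n" "x < n"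
    by (metis less_Suc_eq)
  then show "e \<in> ?R"
  proof cases
    case 1
    then show ?thesis using e by (auto simp: turan_graph_def)
  next
    case 2
    then show ?thesis using e by auto
  next
    case 3
    then have "e = {n, x}" using e by auto
    then show ?thesis using e 3 by auto
  qed
next
  fix e assume "e \<in> ?R"
  then show "e \<in> ?L"
    by (force simp: turan_graph_def)
qed

lemma turan_edges_subset: "edges (turan_graph r n) \<subseteq> [{..<n}]\<^bsup>2\<^esup>"
  by (auto simp: turan_graph_def)

lemma turan_number_Suc:
  assumes "r > 0"
  shows "turan_number r (Suc n) = turan_number r n + (n - n div r)"
proof -
  let ?A = "{y. y < n \<and> y mod r \<noteq> n mod r}"
  have fin: "finite (edges (turan_graph r n))"
    by (rule finite_edges[OF _ turan_edges_subset]) simp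
  have "card ((\<lambda>y. {n, y}) ` ?A) = card ?A"
    by (rule card_image) (auto simp: inj_on_def doubleton_eq_iff)
  \<comment> \<open>The residue class of \<open>n\<close> itself contains exactly
    \<open>n div r\<close> numbers below \<open>n\<close>: the extra element in
    \<open>card_residue_class\<close> occurs only for residues below \<open>n mod r\<close>.\<close>
  moreover have "card ?A = n - n div r"
  proof -
    have "?A = {..<n} - {y. y < n \<and> y mod r = n mod r}" by auto
    then have "card ?A = n - card {y. y < n \<and> y mod r = n mod r}"
      by (simp add: card_Diff_subset subset_eq)
    then show ?thesis
      using card_residue_class[of "n mod r" r n] assms by simp
  qed
  moreover have "edges (turan_graph r n) \<inter> (\<lambda>y. {n, y}) ` ?A = {}"
    using turan_edges_subset[of r n] by (auto simp: nsets_def)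
  ultimately show ?thesis
    unfolding turan_number_def turan_edges_Suc by (subst card_Un_disjoint) (use fin in auto)
qed

text \<open>With \<open>n + 1\<close> vertices some class has more than \<open>n div r\<close> of
  them. Deleting a vertex of that class loses at most \<open>n - n div r\<close> cross pairs, which
  is the increment in \<open>turan_number_Suc\<close>.\<close>

lemma cross_pairs_le_turan:
  assumes "r > 0" "finite V" "part ` V \<subseteq> {..<r}"
  shows "card (missing V part {}) \<le> turan_number r (card V)"
  using assms(2,3)
proof (induction "card V" arbitrary: V)
  case 0
  then have "V = {}" by simp
  then have "missing V part {} = {}" by (auto simp: missing_def nsets_2_eq)
  then show ?case by simp
next
  case (Suc n)
  let ?c = "\<lambda>i. card {x \<in> V. part x = i}"
  have total: "card V = (\<Sum>i<r. ?c i)"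
  proof -
    have "V = (\<Union>i<r. {x \<in> V. part x = i})" using Suc.prems by auto
    then have "card V = card (\<Union>i<r. {x \<in> V. part x = i})" by simp
    also have "\<dots> = (\<Sum>i<r. ?c i)"
      by (rule card_UN_disjoint) (use Suc.prems in auto)
    finally show ?thesis .
  qed
  have "\<exists>i<r. ?c i > n div r"
  proof (rule ccontr)
    assume "\<not> (\<exists>i<r. ?c i > n div r)"
    then have "(\<Sum>i<r. ?c i) \<le> (\<Sum>i<r. n div r)"
      by (intro sum_mono) auto
    also have "\<dots> \<le> n" by simp
    finally show False using total Suc(2) by simp
  qed
  then obtain i where i: "i < r" "?c i > n div r" by blast
  then obtain x where x: "x \<in> V" "part x = i"
    by (metis (mono_tags, lifting) Collect_empty_eq card.empty not_less_zero)
  let ?N = "{y \<in> V. part y \<noteq> i}"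
  have "missing V part {} = missing (V - {x}) part {} \<union> (\<lambda>y. {x, y}) ` ?N" (is "?L = ?R")
  proof (intro equalityI subsetI)
    fix e assume e: "e \<in> ?L"
    then have "e \<in> [V]\<^bsup>2\<^esup>" by (simp add: missing_def)
    then obtain a b where ab: "e = {a, b}" by (elim nsets2_E)
    show "e \<in> ?R"
    proof (cases "x \<in> e")
      case True
      then show ?thesis using e x ab by (auto simp: insert_commute)
    next
      case False
      then show ?thesis using e x ab by auto
    qed
  next
    fix e assume "e \<in> ?R"
    then show "e \<in> ?L"
    proof
      assume e: "e \<in> missing (V - {x}) part {}"
      then have "e \<in> [V]\<^bsup>2\<^esup>"
        using nsets_mono[of "V - {x}" V 2] by (auto simp: missing_def)
      with e show ?thesis by (simp add: missing_def)
    qed (use x in auto)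
  qed
  then have "card ?L \<le> card (missing (V - {x}) part {}) + card ((\<lambda>y. {x, y}) ` ?N)"
    by (simp add: card_Un_le)
  also have "card ((\<lambda>y. {x, y}) ` ?N) \<le> card ?N"
    by (rule card_image_le) (use Suc.prems in auto)
  also have "card (missing (V - {x}) part {}) \<le> turan_number r (card (V - {x}))"
    by (rule Suc.hyps(1)) (use Suc x in auto)
  also have "card (V - {x}) = n" using Suc x by simp
  also have "card ?N \<le> n - n div r"
  proof -
    have "?N = V - {y \<in> V. part y = i}" by auto
    then have "card ?N = card V - ?c i"
      by (simp add: card_Diff_subset Suc.prems)
    then show ?thesis using i Suc(2) by simp
  qed
  also have "turan_number r n + (n - n div r) = turan_number r (card V)"
    using turan_number_Suc[OF assms(1), of n] Suc(2) by simp
  finally show ?case by simp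
qed

section \<open>The Tutte-Berge formula\<close>

text \<open>A matching is a set of edges satisfying \<open>disjoint\<close>; the empty one is always
  admissible, so for finite \<open>E\<close> the maximum is attained.\<close>

definition matching_number :: "'v set set \<Rightarrow> nat" where
  "matching_number E = Max (card ` {M. M \<subseteq> E \<and> disjoint M})"

lemma matching_number_ge:
  assumes "finite E" "M \<subseteq> E" "disjoint M"
  shows "card M \<le> matching_number E"
proof -
  have "{M. M \<subseteq> E \<and> disjoint M} \<subseteq> Pow E" by auto
  then have "finite {M. M \<subseteq> E \<and> disjoint M}"
    using assms(1) by (meson finite_Pow_iff finite_subset)
  then show ?thesis
    unfolding matching_number_def using assms by (intro Max_ge) auto
qed

lemma maximum_matching:
  assumes "finite E"
  obtains M where "M \<subseteq> E" "disjoint M" "card M = matching_number E"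
proof -
  have "{M. M \<subseteq> E \<and> disjoint M} \<subseteq> Pow E" by auto
  then have "finite {M. M \<subseteq> E \<and> disjoint M}"
    using assms by (meson finite_Pow_iff finite_subset)
  moreover have "{} \<in> {M. M \<subseteq> E \<and> disjoint M}" by auto
  ultimately have "matching_number E \<in> card ` {M. M \<subseteq> E \<and> disjoint M}"
    unfolding matching_number_def by (intro Max_in) auto
  then show ?thesis using that by auto
qed

lemma matching_number_mono:
  assumes "finite E" "D \<subseteq> E"
  shows "matching_number D \<le> matching_number E"
  by (metis assms finite_subset matching_number_ge maximum_matching subset_trans)

lemma card_Union_matching:
  assumes "finite V" "M \<subseteq> [V]\<^bsup>2\<^esup>" "disjoint M"
  shows "card (\<Union>M) = 2 * card M"
proof -
  have "card (\<Union>M) = sum card M"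
    by (rule card_Union_disjoint) (use assms in \<open>auto simp: nsets_def\<close>)
  also have "\<dots> = sum (\<lambda>_. 2) M"
    by (rule sum.cong) (use assms in \<open>auto simp: nsets_def\<close>)
  finally show ?thesis by simp
qed

text \<open>The bound on a connected graph by its edges: a set \<open>X\<close> grows from
  \<open>{v}\<close> one vertex at a time, and each new vertex brings an edge that was not inside
  the previous \<open>X\<close>.\<close>

lemma reachable_card_le:
  fixes D :: "'v set set" and v :: 'v
  defines "C \<equiv> {y. (v, y) \<in> {(a, b). {a, b} \<in> D}\<^sup>*}"
  assumes "finite C" "finite D"
  shows "card C \<le> card {e \<in> D. e \<subseteq> C} + 1"
proof -
  have v: "v \<in> C" by (simp add: C_def)
  have "\<exists>X\<subseteq>C. v \<in> X \<and> card X = Suc n \<and> n \<le> card {e \<in> D. e \<subseteq> X}" if "Suc n \<le> card C" for n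
    using that
  proof (induction n)
    case 0
    then show ?case using v by (intro exI[of _ "{v}"]) auto
  next
    case (Suc n)
    then obtain X where X: "X \<subseteq> C" "v \<in> X" "card X = Suc n" "n \<le> card {e \<in> D. e \<subseteq> X}"
      by auto
    \<comment> \<open>Without an edge leaving it, \<open>X\<close> would be closed under
      reachability and hence all of \<open>C\<close>.\<close>
    have "\<exists>a\<in>X. \<exists>b\<in>C - X. {a, b} \<in> D"
    proof (rule ccontr)
      assume no: "\<not> ?thesis"
      have "y \<in> X" if "(v, y) \<in> {(a, b). {a, b} \<in> D}\<^sup>*" for y
        using that
      proof (induction rule: rtrancl_induct)
        case base
        then show ?case by (rule X(2))
      next
        case (step y z)
        then have "z \<in> C" unfolding C_def
          by (auto intro: rtrancl_into_rtrancl)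
        then show ?case using step no by auto
      qed
      then have "C \<subseteq> X" unfolding C_def by auto
      then show False using X Suc.prems by auto
    qed
    then obtain a b where ab: "a \<in> X" "b \<in> C" "b \<notin> X" "{a, b} \<in> D" by blast
    have finX: "finite X" using X(1) assms(2) finite_subset by blast
    have "card (insert {a, b} {e \<in> D. e \<subseteq> X}) \<le> card {e \<in> D. e \<subseteq> insert b X}"
      by (rule card_mono) (use ab assms(3) in auto)
    moreover have "card (insert {a, b} {e \<in> D. e \<subseteq> X}) = Suc (card {e \<in> D. e \<subseteq> X})"
      using ab assms(3) by (subst card_insert_disjoint) auto
    ultimately show ?case
      using X ab finX by (intro exI[of _ "insert b X"]) auto
  qed
  from this[of "card C - 1"] obtain X where
    "X \<subseteq> C" "card X = Suc (card C - 1)" "card C - 1 \<le> card {e \<in> D. e \<subseteq> X}"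
    using v assms(2) by (metis Suc_diff_1 card_gt_0_iff empty_iff order_refl)
  moreover have "card {e \<in> D. e \<subseteq> X} \<le> card {e \<in> D. e \<subseteq> C}"
    using \<open>X \<subseteq> C\<close> assms(3) by (intro card_mono) auto
  ultimately show ?thesis by linarith
qed

text \<open>Exchanging two maximum matchings on a component of their union is the alternating-path
  argument behind Gallai's lemma; a component containing all three vertices would have too few
  edges to be connected.\<close>

lemma maximum_matchings_missing_trans:
  assumes V: "finite V" "E \<subseteq> [V]\<^bsup>2\<^esup>"
    and M1: "M1 \<subseteq> E" "disjoint M1" "card M1 = matching_number E" "u \<notin> \<Union>M1" "w \<notin> \<Union>M1"
    and M2: "M2 \<subseteq> E" "disjoint M2" "card M2 = matching_number E" "v \<notin> \<Union>M2"
    and uw: "u \<noteq> w" and uvw: "v \<in> V"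
  shows "\<exists>M\<subseteq>E. disjoint M \<and> card M = matching_number E \<and> v \<notin> \<Union>M \<and> (u \<notin> \<Union>M \<or> w \<notin> \<Union>M)"
proof -
  \<comment> \<open>\<open>C\<close> is the component of \<open>v\<close> in the union of the two
    matchings. An edge of \<open>D\<close> meeting \<open>C\<close> lies inside \<open>C\<close>, so
    the matchings can be exchanged on \<open>C\<close> without regard to the rest.\<close>
  define D where "D = M1 \<union> M2"
  define C where "C = {y. (v, y) \<in> {(a, b). {a, b} \<in> D}\<^sup>*}"
  have fin: "finite E" "finite M1" "finite M2" "finite D"
    using finite_edges[OF V] M1(1) M2(1) finite_subset by (auto simp: D_def)
  have D: "D \<subseteq> [V]\<^bsup>2\<^esup>" using M1(1) M2(1) V(2) by (auto simp: D_def)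
  have closed: "e \<subseteq> C" if e: "e \<in> D" "e \<inter> C \<noteq> {}" for e
  proof -
    have "e \<in> [V]\<^bsup>2\<^esup>" using e D by auto
    then obtain a b where ab: "e = {a, b}" by (elim nsets2_E)
    then have "{a, b} \<in> D" "{b, a} \<in> D" using e by (auto simp: insert_commute)
    then have "a \<in> C \<Longrightarrow> b \<in> C" "b \<in> C \<Longrightarrow> a \<in> C"
      unfolding C_def by (auto intro: rtrancl_into_rtrancl)
    then show ?thesis using e(2) ab by auto
  qed
  have vC: "v \<in> C" by (simp add: C_def)
  have "C \<subseteq> V"
  proof
    fix y assume "y \<in> C"
    then have "(v, y) \<in> {(a, b). {a, b} \<in> D}\<^sup>*" by (simp add: C_def)
    then show "y \<in> V"
    proof (induction rule: rtrancl_induct)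
      case (step y z)
      then show ?case using edgeD[OF D, of y z] by blast
    qed (rule uvw)
  qed
  then have finC: "finite C" using V(1) finite_subset by blast
  define in1 in2 out1 out2 where "in1 = {e \<in> M1. e \<subseteq> C}" and "in2 = {e \<in> M2. e \<subseteq> C}"
    and "out1 = {e \<in> M1. \<not> e \<subseteq> C}" and "out2 = {e \<in> M2. \<not> e \<subseteq> C}"
  note defs = in1_def in2_def out1_def out2_def
  have outC: "e \<inter> C = {}" if "e \<in> out1 \<union> out2" for e
    using closed that by (auto simp: defs D_def)
  have parts: "card M1 = card in1 + card out1" "card M2 = card in2 + card out2"
  proof -
    have "M1 = in1 \<union> out1" "in1 \<inter> out1 = {}" "M2 = in2 \<union> out2" "in2 \<inter> out2 = {}"
      by (auto simp: defs)
    then show "card M1 = card in1 + card out1" "card M2 = card in2 + card out2"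
      using fin by (metis card_Un_disjoint finite_Un)+
  qed
  have dis1: "disjoint (out1 \<union> in2)"
  proof (rule disjoint_union)
    show "disjoint out1" using M1(2) by (rule pairwise_subset) (auto simp: defs)
    show "disjoint in2" using M2(2) by (rule pairwise_subset) (auto simp: defs)
    show "\<Union>out1 \<inter> \<Union>in2 = {}" using outC by (fastforce simp: in2_def)
  qed
  have dis2: "disjoint (out2 \<union> in1)"
  proof (rule disjoint_union)
    show "disjoint out2" using M2(2) by (rule pairwise_subset) (auto simp: defs)
    show "disjoint in1" using M1(2) by (rule pairwise_subset) (auto simp: defs)
    show "\<Union>out2 \<inter> \<Union>in1 = {}" using outC by (fastforce simp: in1_def)
  qed
  have card1: "card (out1 \<union> in2) = card out1 + card in2"
  proof (rule card_Un_disjoint)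
    show "out1 \<inter> in2 = {}" by (auto simp: defs)
  qed (use fin in \<open>auto simp: defs\<close>)
  have card2: "card (out2 \<union> in1) = card out2 + card in1"
  proof (rule card_Un_disjoint)
    show "out2 \<inter> in1 = {}" by (auto simp: defs)
  qed (use fin in \<open>auto simp: defs\<close>)
  have sub: "out1 \<union> in2 \<subseteq> E" "out2 \<union> in1 \<subseteq> E" using M1(1) M2(1) by (auto simp: defs)
  \<comment> \<open>Both exchanged sets are matchings in \<open>E\<close> and neither exceeds the
    maximum, so the two matchings have equally many edges inside \<open>C\<close>.\<close>
  have "card in2 = card in1"
    using matching_number_ge[OF fin(1) sub(1) dis1] matching_number_ge[OF fin(1) sub(2) dis2]
      card1 card2 parts M1(3) M2(3) by linarith
  then have max: "card (out1 \<union> in2) = matching_number E"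
    using card1 parts M1(3) by linarith
  have miss_v: "v \<notin> \<Union>(out1 \<union> in2)"
    using outC vC M2(4) by (fastforce simp: in2_def)
  show ?thesis
  \<comment> \<open>If \<open>u\<close> or \<open>w\<close> lies outside \<open>C\<close>, the
    exchanged matching agrees with \<open>M1\<close> there and still misses it. Otherwise
    \<open>M1\<close> leaves two vertices of \<open>C\<close> uncovered, so \<open>C\<close> has at
    least \<open>2 * card in1 + 2\<close> vertices but only \<open>2 * card in1\<close> edges of
    \<open>D\<close> at most, too few for a connected graph.\<close>
  proof (cases "u \<in> C \<and> w \<in> C")
    case False
    then have "u \<notin> \<Union>(out1 \<union> in2) \<or> w \<notin> \<Union>(out1 \<union> in2)"
      using M1(4,5) by (auto simp: out1_def in2_def)
    then show ?thesis using sub(1) dis1 max miss_v by blast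
  next
    case True
    have "card (\<Union>in1) = 2 * card in1"
      by (rule card_Union_matching[OF V(1)])
        (use M1 V in \<open>auto simp: in1_def intro: pairwise_subset\<close>)
    moreover have "card (\<Union>in1) \<le> card (C - {u, w})"
      by (rule card_mono) (use finC M1(4,5) in \<open>auto simp: in1_def\<close>)
    moreover have "card (C - {u, w}) = card C - 2"
      using True uw finC by (simp add: card_Diff_subset)
    moreover have "2 \<le> card C"
      using True uw finC by (metis card_2_iff card_mono empty_subsetI insert_subset)
    moreover have "card C \<le> card {e \<in> D. e \<subseteq> C} + 1"
      using reachable_card_le[of v D] finC fin(4) unfolding C_def by blast
    moreover have "{e \<in> D. e \<subseteq> C} = in1 \<union> in2" by (auto simp: D_def defs)
    then have "card {e \<in> D. e \<subseteq> C} \<le> card in1 + card in2" by (simp add: card_Un_le)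
    ultimately have False using \<open>card in2 = card in1\<close> by linarith
    then show ?thesis ..
  qed
qed

text \<open>The hard inequality, by Gallai's lemma. A vertex covered by every maximum matching goes
  into \<open>S\<close>. If there is none, \<open>S\<close> is empty, and no maximum matching
  missing two given vertices is an equivalence relation; a maximum matching then leaves at most one
  vertex of each class uncovered. The parts are unions of components, which suffices for
  counting.\<close>

theorem tutte_berge:
  assumes "finite V" "E \<subseteq> [V]\<^bsup>2\<^esup>"
  shows "\<exists>S P. S \<subseteq> V \<and> partition_on (V - S) P \<and> (\<forall>e\<in>E. e \<inter> S = {} \<longrightarrow> (\<exists>c\<in>P. e \<subseteq> c)) \<and>
    card S + (\<Sum>c\<in>P. card c div 2) \<le> matching_number E"
  using assms
proof (induction "card V" arbitrary: V E rule: less_induct)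
  case less
  note V = less.prems
  have finE: "finite E" by (rule finite_edges[OF V])
  show ?case
  \<comment> \<open>The matching number drops on deleting \<open>v\<close> exactly when every
    maximum matching covers \<open>v\<close>.\<close>
  proof (cases "\<exists>v\<in>V. matching_number {e \<in> E. v \<notin> e} < matching_number E")
    case True
    then obtain v where v: "v \<in> V" "matching_number {e \<in> E. v \<notin> e} < matching_number E" by blast
    have "{e \<in> E. v \<notin> e} \<subseteq> [V - {v}]\<^bsup>2\<^esup>" using V(2) by (auto simp: nsets_def)
    moreover have "card (V - {v}) < card V" using v V(1) by (meson card_Diff1_less)
    ultimately obtain S P where SP: "S \<subseteq> V - {v}" "partition_on (V - {v} - S) P"
      "\<forall>e\<in>{e \<in> E. v \<notin> e}. e \<inter> S = {} \<longrightarrow> (\<exists>c\<in>P. e \<subseteq> c)"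
      "card S + (\<Sum>c\<in>P. card c div 2) \<le> matching_number {e \<in> E. v \<notin> e}"
      using less.hyps[of "V - {v}" "{e \<in> E. v \<notin> e}"] V(1) by auto
    have "finite S" using SP(1) V(1) by (meson finite_Diff finite_subset)
    then have "card (insert v S) = Suc (card S)" using SP(1) by (subst card_insert_disjoint) auto
    moreover have "V - insert v S = V - {v} - S" by auto
    ultimately show ?thesis
      using SP v by (intro exI[of _ "insert v S"] exI[of _ P]) auto
  next
    case False
    define mx where "mx M \<longleftrightarrow> M \<subseteq> E \<and> disjoint M \<and> card M = matching_number E" for M
    have ex_miss: "\<exists>M. mx M \<and> v \<notin> \<Union>M" if "v \<in> V" for v
    proof -
      obtain M where M: "M \<subseteq> {e \<in> E. v \<notin> e}" "disjoint M" "card M = matching_number {e \<in> E. v \<notin> e}"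
        using maximum_matching[of "{e \<in> E. v \<notin> e}"] finE by auto
      moreover have "card M \<le> matching_number E"
        by (rule matching_number_ge[OF finE]) (use M in auto)
      ultimately show ?thesis
        unfolding mx_def using False that by (intro exI[of _ M]) force
    qed
    define R where "R = {(u, v). u \<in> V \<and> v \<in> V \<and> (u = v \<or> \<not> (\<exists>M. mx M \<and> u \<notin> \<Union>M \<and> v \<notin> \<Union>M))}"
    have "equiv V R"
    proof (rule equivI)
      show "R \<subseteq> V \<times> V" by (auto simp: R_def)
      show "refl_on V R" by (auto simp: R_def refl_on_def)
      show "sym R" by (auto simp: R_def sym_def)
      show "trans R"
      proof (rule transI)
        fix u v w assume uv: "(u, v) \<in> R" and vw: "(v, w) \<in> R"
        show "(u, w) \<in> R"
        proof (rule ccontr)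
          assume "(u, w) \<notin> R"
          then obtain M1 where M1: "mx M1" "u \<notin> \<Union>M1" "w \<notin> \<Union>M1" and "u \<noteq> w"
            using uv vw by (auto simp: R_def)
          have "v \<in> V" using uv by (auto simp: R_def)
          obtain M2 where M2: "mx M2" "v \<notin> \<Union>M2"
            using ex_miss[OF \<open>v \<in> V\<close>] by blast
          have "\<exists>M\<subseteq>E. disjoint M \<and> card M = matching_number E \<and> v \<notin> \<Union>M \<and>
              (u \<notin> \<Union>M \<or> w \<notin> \<Union>M)"
          proof (rule maximum_matchings_missing_trans[OF V])
            show "M1 \<subseteq> E" "disjoint M1" "card M1 = matching_number E"
              "M2 \<subseteq> E" "disjoint M2" "card M2 = matching_number E"
              using M1(1) M2(1) by (simp_all add: mx_def)
          qed (fact M1 M2 \<open>u \<noteq> w\<close> \<open>v \<in> V\<close>)+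
          then obtain M where M: "mx M" "v \<notin> \<Union>M" "u \<notin> \<Union>M \<or> w \<notin> \<Union>M"
            unfolding mx_def by blast
          have "\<not> (u \<notin> \<Union>M)" "\<not> (w \<notin> \<Union>M)" if "u \<noteq> v" "v \<noteq> w"
            using uv vw M that unfolding R_def by blast+
          moreover have "u \<noteq> v" "v \<noteq> w" using uv vw \<open>(u, w) \<notin> R\<close> by blast+
          ultimately show False using M(3) by blast
        qed
      qed
    qed
    define P where "P = V // R"
    have part: "partition_on V P" unfolding P_def by (rule partition_on_quotient[OF \<open>equiv V R\<close>])
    have edge: "\<exists>c\<in>P. e \<subseteq> c" if e: "e \<in> E" for e
    proof -
      have "e \<in> [V]\<^bsup>2\<^esup>" using e V(2) by auto
      then obtain a b where ab: "e = {a, b}" "a \<in> V" "b \<in> V" "a \<noteq> b" by (elim nsets2_E)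
      \<comment> \<open>A maximum matching missing both ends of an edge could be enlarged by it, so
        adjacent vertices are related and every edge lies inside a class.\<close>
      have "(a, b) \<in> R"
      proof (rule ccontr)
        assume "(a, b) \<notin> R"
        then obtain M where M: "mx M" "a \<notin> \<Union>M" "b \<notin> \<Union>M" using ab by (auto simp: R_def)
        then have "card (insert e M) = Suc (card M)"
          using ab finE by (subst card_insert_disjoint) (auto simp: mx_def intro: finite_subset)
        moreover have "disjoint (insert e M)"
          using M ab by (auto simp: mx_def pairwise_insert disjnt_def)
        then have "card (insert e M) \<le> matching_number E"
          by (intro matching_number_ge[OF finE]) (use M e in \<open>auto simp: mx_def\<close>)
        ultimately show False using M by (auto simp: mx_def)
      qed
      then have "e \<subseteq> R `` {a}" using ab by (auto simp: R_def)
      moreover have "R `` {a} \<in> P" unfolding P_def using ab by (auto intro: quotientI)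
      ultimately show ?thesis by blast
    qed
    obtain M where M: "M \<subseteq> E" "disjoint M" "card M = matching_number E"
      using maximum_matching[OF finE] .
    have finM: "finite M" using M(1) finE finite_subset by blast
    have le: "card c div 2 \<le> card {e \<in> M. e \<subseteq> c}" if c: "c \<in> P" for c
    proof -
      have "c \<subseteq> V" using partition_onD1[OF part] c by auto
      then have finc: "finite c" using V(1) by (rule finite_subset)
      \<comment> \<open>Two vertices of \<open>c\<close> missed by the maximum matching
        \<open>M\<close> would not be related.\<close>
      have "card (c - \<Union>M) \<le> 1"
      proof (rule ccontr)
        assume "\<not> card (c - \<Union>M) \<le> 1"
        then obtain u w where "u \<in> c - \<Union>M" "w \<in> c - \<Union>M" "u \<noteq> w"
          by (metis One_nat_def card_le_Suc0_iff_eq finc finite_Diff)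
        moreover from this have "(u, w) \<in> R"
          using c quotient_eq_iff[OF \<open>equiv V R\<close>, of c c u w] unfolding P_def by auto
        ultimately show False using M by (auto simp: R_def mx_def)
      qed
      moreover have "c \<inter> \<Union>M \<subseteq> \<Union>{e \<in> M. e \<subseteq> c}"
      proof
        fix x assume "x \<in> c \<inter> \<Union>M"
        then obtain e where e: "e \<in> M" "x \<in> e" "x \<in> c" by auto
        then obtain c' where "c' \<in> P" "e \<subseteq> c'" using edge M(1) by blast
        then have "c' = c" using partition_onD2[OF part] c e by (auto simp: disjoint_def)
        then show "x \<in> \<Union>{e \<in> M. e \<subseteq> c}" using e \<open>e \<subseteq> c'\<close> by auto
      qed
      then have "card (c \<inter> \<Union>M) \<le> card (\<Union>{e \<in> M. e \<subseteq> c})"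
        by (rule card_mono[rotated]) (rule finite_subset[of _ c], use finc in auto)
      moreover have "card (\<Union>{e \<in> M. e \<subseteq> c}) = 2 * card {e \<in> M. e \<subseteq> c}"
        by (rule card_Union_matching[OF V(1)])
          (use M V in \<open>auto intro: pairwise_subset\<close>)
      moreover have "card c = card (c \<inter> \<Union>M) + card (c - \<Union>M)"
        using finc by (metis card_Int_Diff)
      ultimately show ?thesis by linarith
    qed
    have "(\<Sum>c\<in>P. card c div 2) \<le> (\<Sum>c\<in>P. card {e \<in> M. e \<subseteq> c})"
      by (rule sum_mono) (rule le)
    also have "\<dots> = card (\<Union>c\<in>P. {e \<in> M. e \<subseteq> c})"
    proof (rule card_UN_disjoint[symmetric])
      show "finite P" by (rule finite_elements[OF V(1) part])
      show "\<forall>c\<in>P. finite {e \<in> M. e \<subseteq> c}" using finM by auto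
      show "\<forall>c\<in>P. \<forall>c'\<in>P. c \<noteq> c' \<longrightarrow> {e \<in> M. e \<subseteq> c} \<inter> {e \<in> M. e \<subseteq> c'} = {}"
      proof (intro ballI impI equals0I)
        fix c c' e assume "c \<in> P" "c' \<in> P" "c \<noteq> c'" "e \<in> {e \<in> M. e \<subseteq> c} \<inter> {e \<in> M. e \<subseteq> c'}"
        moreover from this have "c \<inter> c' = {}" using partition_onD2[OF part] by (auto simp: disjoint_def)
        moreover have "e \<noteq> {}" using calculation(4) M(1) V(2) by (auto simp: nsets_def)
        ultimately show False by blast
      qed
    qed
    also have "\<dots> \<le> card M" by (rule card_mono[OF finM]) auto
    finally have "(\<Sum>c\<in>P. card c div 2) \<le> matching_number E" using M(3) by simp
    then show ?thesis
      using part edge by (intro exI[of _ "{}"] exI[of _ P]) auto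
  qed
qed

section \<open>Graphs of bounded degree and matching number\<close>

text \<open>The Abbott-Hanson-Sauer number: for \<open>k \<ge> 1\<close> the largest number of edges
  with all degrees and the matching number at most \<open>k - 1\<close>.\<close>

definition excess :: "nat \<Rightarrow> nat" where
  "excess k = (if odd k then k * (k - 1) else (k div 2) * (2 * k - 3))"

lemma real_excess:
  assumes "k \<ge> 1"
  shows "real (excess k) = (if odd k then (real k)\<^sup>2 - real k else (real k)\<^sup>2 - 3 / 2 * real k)"
proof (cases "odd k")
  case True
  then show ?thesis using assms by (simp add: excess_def of_nat_diff power2_eq_square algebra_simps)
next
  case False
  then obtain j where j: "k = 2 * j" by auto
  then have "j \<ge> 1" using assms by simp
  then show ?thesis using j by (simp add: excess_def of_nat_diff power2_eq_square algebra_simps)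
qed

text \<open>An edge either meets \<open>S\<close>, where it is counted by a degree, or lies inside a
  single part.\<close>

lemma edge_decomposition:
  assumes "finite V" "E \<subseteq> [V]\<^bsup>2\<^esup>"
  shows "\<exists>S P. S \<subseteq> V \<and> partition_on (V - S) P \<and>
    card S + (\<Sum>c\<in>P. card c div 2) \<le> matching_number E \<and>
    card E \<le> (\<Sum>x\<in>S. card (nbrs E x)) + (\<Sum>c\<in>P. card {e \<in> E. e \<subseteq> c})"
proof -
  obtain S P where SP: "S \<subseteq> V" "partition_on (V - S) P"
    "\<forall>e\<in>E. e \<inter> S = {} \<longrightarrow> (\<exists>c\<in>P. e \<subseteq> c)"
    "card S + (\<Sum>c\<in>P. card c div 2) \<le> matching_number E"
    using tutte_berge[OF assms] by blast
  have finE: "finite E" by (rule finite_edges[OF assms])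
  have finS: "finite S" using SP(1) assms(1) finite_subset by blast
  have finP: "finite P" by (rule finite_elements[OF _ SP(2)]) (use assms(1) in simp)
  have "E \<subseteq> (\<Union>x\<in>S. {e \<in> E. x \<in> e}) \<union> (\<Union>c\<in>P. {e \<in> E. e \<subseteq> c})"
  proof
    fix e assume "e \<in> E"
    then show "e \<in> (\<Union>x\<in>S. {e \<in> E. x \<in> e}) \<union> (\<Union>c\<in>P. {e \<in> E. e \<subseteq> c})"
      using SP(3) by (cases "e \<inter> S = {}") auto
  qed
  then have "card E \<le> card ((\<Union>x\<in>S. {e \<in> E. x \<in> e}) \<union> (\<Union>c\<in>P. {e \<in> E. e \<subseteq> c}))"
    by (rule card_mono[rotated]) (use finE finS finP in auto)
  also have "\<dots> \<le> card (\<Union>x\<in>S. {e \<in> E. x \<in> e}) + card (\<Union>c\<in>P. {e \<in> E. e \<subseteq> c})"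
    by (rule card_Un_le)
  also have "\<dots> \<le> (\<Sum>x\<in>S. card {e \<in> E. x \<in> e}) + (\<Sum>c\<in>P. card {e \<in> E. e \<subseteq> c})"
    by (intro add_mono card_UN_le finS finP)
  also have "(\<Sum>x\<in>S. card {e \<in> E. x \<in> e}) = (\<Sum>x\<in>S. card (nbrs E x))"
    using card_nbrs[OF assms(2)] by simp
  finally show ?thesis using SP by blast
qed

lemma induced_edges_bounds:
  assumes "finite V" "E \<subseteq> [V]\<^bsup>2\<^esup>" "c \<subseteq> V"
  shows "2 * card {e \<in> E. e \<subseteq> c} \<le> (\<Sum>x\<in>c. card (nbrs E x))"
    and "2 * card {e \<in> E. e \<subseteq> c} \<le> card c * (card c - 1)"
proof -
  let ?F = "{e \<in> E. e \<subseteq> c}"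
  have finc: "finite c" using assms finite_subset by blast
  have F: "?F \<subseteq> [c]\<^bsup>2\<^esup>" using assms by (auto simp: nsets_def)
  note hs = handshake[OF finc F, symmetric]
  have "(\<Sum>x\<in>c. card (nbrs ?F x)) \<le> (\<Sum>x\<in>c. card (nbrs E x))"
    by (intro sum_mono card_mono finite_nbrs[OF assms(1,2)]) auto
  then show "2 * card ?F \<le> (\<Sum>x\<in>c. card (nbrs E x))" using hs by simp
  have "(\<Sum>x\<in>c. card (nbrs ?F x)) \<le> (\<Sum>x\<in>c. card c - 1)"
  proof (rule sum_mono)
    fix x assume "x \<in> c"
    then have "card (nbrs ?F x) \<le> card (c - {x})"
      by (intro card_mono nbrs_subset[OF F]) (use finc in auto)
    then show "card (nbrs ?F x) \<le> card c - 1" using \<open>x \<in> c\<close> finc by simp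
  qed
  then show "2 * card ?F \<le> card c * (card c - 1)" using hs by simp
qed

text \<open>Every vertex returns half of its allowance \<open>m x\<close>. A vertex of the
  separating set then contributes at most \<open>(K + D) / 2\<close> and a part at most
  \<open>D + 1\<close> per unit of its share in the matching number; \<open>s\<close> is the size of
  the separating set. Later \<open>m x\<close> is the number of missing edges at
  \<open>x\<close>.\<close>

lemma weighted_edge_bound:
  fixes m :: "'v \<Rightarrow> real" and D K :: real
  assumes V: "finite V" "E \<subseteq> [V]\<^bsup>2\<^esup>" and D: "D \<ge> 0"
    and K: "\<And>x. x \<in> V \<Longrightarrow> card (nbrs E x) \<le> K"
    and m: "\<And>x. x \<in> V \<Longrightarrow> card (nbrs E x) \<le> D + m x" "\<And>x. x \<in> V \<Longrightarrow> m x \<ge> 0"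
  shows "\<exists>s. s \<le> matching_number E \<and> card E - (\<Sum>x\<in>V. m x) / 2
      \<le> s * ((K + D) / 2) + (real (matching_number E) - s) * (D + 1)"
proof -
  obtain S P where SP: "S \<subseteq> V" "partition_on (V - S) P"
    "card S + (\<Sum>c\<in>P. card c div 2) \<le> matching_number E"
    "card E \<le> (\<Sum>x\<in>S. card (nbrs E x)) + (\<Sum>c\<in>P. card {e \<in> E. e \<subseteq> c})"
    using edge_decomposition[OF V] by blast
  have cV: "c \<subseteq> V" "finite c" if "c \<in> P" for c
    using partition_onD1[OF SP(2)] that V(1) by (auto intro: finite_subset)
  \<comment> \<open>The average of the bounds \<open>K\<close> on the degree and \<open>D\<close> on
    the degree minus \<open>m x\<close>.\<close>
  have S: "real (card (nbrs E x)) - m x / 2 \<le> (K + D) / 2" if "x \<in> S" for x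
    using K[of x] m(1)[of x] SP(1) that by auto
  have C: "card {e \<in> E. e \<subseteq> c} - (\<Sum>x\<in>c. m x) / 2 \<le> (D + 1) * real (card c div 2)" if c: "c \<in> P" for c
  proof -
    let ?e = "card {e \<in> E. e \<subseteq> c}" and ?q = "card c div 2" and ?M = "\<Sum>x\<in>c. m x"
    have M0: "?M \<ge> 0" by (rule sum_nonneg) (use m(2) cV[OF c] in auto)
    have "real (2 * ?e) \<le> (\<Sum>x\<in>c. real (card (nbrs E x)))"
      using of_nat_mono[OF induced_edges_bounds(1)[OF V cV(1)[OF c]], where 'a = real] by simp
    also have "\<dots> \<le> (\<Sum>x\<in>c. D + m x)" by (rule sum_mono) (use m(1) cV[OF c] in auto)
    also have "\<dots> = card c * D + ?M" by (simp add: sum.distrib)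
    finally have b1: "2 * real ?e - ?M \<le> card c * D" by simp
    have "real (2 * ?e) \<le> real (card c * (card c - 1))"
      by (rule of_nat_mono) (rule induced_edges_bounds(2)[OF V cV(1)[OF c]])
    then have b2: "2 * real ?e - ?M \<le> real (card c) * real (card c - 1)" using M0 by simp
    have "2 * real ?e - ?M \<le> 2 * ((D + 1) * real ?q)"
    \<comment> \<open>An even part is covered by the degree sum. For \<open>2 * q + 1\<close>
      vertices the complete graph bound suffices if \<open>D\<close> is at least
      \<open>2 * q\<close>; otherwise \<open>(2 * q + 1) * D\<close> is below
      \<open>2 * q * (D + 1)\<close>.\<close>
    proof (cases "even (card c)")
      case True
      then obtain q where q: "card c = 2 * q" by (elim evenE)
      then show ?thesis using b1 by (simp add: algebra_simps)
    next
      case False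
      then obtain q where q: "card c = 2 * q + 1" by (elim oddE)
      show ?thesis
      proof (cases "D \<ge> 2 * real q")
        case True
        have "2 * real ?e - ?M \<le> (2 * real q + 1) * (2 * real q)"
          using b2 by (simp add: q add.commute)
        also have "\<dots> \<le> (D + 1) * (2 * real q)"
          by (rule mult_right_mono) (use True in auto)
        finally show ?thesis by (simp add: q algebra_simps)
      next
        case False
        have "2 * real ?e - ?M \<le> (2 * real q + 1) * D"
          using b1 by (simp add: q add.commute)
        then show ?thesis using False by (simp add: q algebra_simps)
      qed
    qed
    then show ?thesis by simp
  qed
  have split: "(\<Sum>x\<in>V. m x) = (\<Sum>x\<in>S. m x) + (\<Sum>c\<in>P. \<Sum>x\<in>c. m x)"
  proof -
    have "(\<Sum>x\<in>V. m x) = (\<Sum>x\<in>V - S. m x) + (\<Sum>x\<in>S. m x)"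
      by (rule sum.subset_diff[OF SP(1) V(1)])
    also have "(\<Sum>x\<in>V - S. m x) = (\<Sum>c\<in>P. \<Sum>x\<in>c. m x)"
      by (rule sum.partition[OF _ SP(2)]) (use V(1) in simp)
    finally show ?thesis by simp
  qed
  have "real (card E) \<le> (\<Sum>x\<in>S. real (card (nbrs E x))) + (\<Sum>c\<in>P. real (card {e \<in> E. e \<subseteq> c}))"
    using of_nat_mono[OF SP(4), where 'a = real] by simp
  then have "card E - (\<Sum>x\<in>V. m x) / 2
      \<le> (\<Sum>x\<in>S. real (card (nbrs E x)) - m x / 2) + (\<Sum>c\<in>P. card {e \<in> E. e \<subseteq> c} - (\<Sum>x\<in>c. m x) / 2)"
    unfolding split by (simp add: sum_subtractf sum_divide_distrib add_divide_distrib)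
  also have "\<dots> \<le> (\<Sum>x\<in>S. (K + D) / 2) + (\<Sum>c\<in>P. (D + 1) * real (card c div 2))"
    by (intro add_mono sum_mono S C)
  also have "\<dots> = card S * ((K + D) / 2) + (D + 1) * real (\<Sum>c\<in>P. card c div 2)"
    by (simp add: sum_distrib_left)
  also have "\<dots> \<le> card S * ((K + D) / 2) + (D + 1) * (real (matching_number E) - card S)"
  proof -
    have "real (\<Sum>c\<in>P. card c div 2) \<le> real (matching_number E) - card S"
      using of_nat_mono[OF SP(3), where 'a = real] by simp
    then show ?thesis using D by (intro add_left_mono mult_left_mono) auto
  qed
  finally show ?thesis using SP(3) by (intro exI[of _ "card S"]) (simp add: mult.commute)
qed

text \<open>For odd \<open>k\<close> each unit of the matching number carries at most
  \<open>k\<close> edges. For even \<open>k = 2 * j\<close> it carries \<open>k - 1\<close>, except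
  that a large part may hold \<open>j - 1\<close> more, and there is room for only one such part.
  The equality case is what later supplies \<open>k - 1\<close> disjoint edges in one class.\<close>

lemma degree_matching_edge_bound:
  assumes V: "finite V" "E \<subseteq> [V]\<^bsup>2\<^esup>" and k: "k \<ge> 1"
    and deg: "\<And>x. x \<in> V \<Longrightarrow> card (nbrs E x) \<le> k - 1"
    and mat: "matching_number E \<le> k - 1"
  shows "card E \<le> excess k" and "card E = excess k \<Longrightarrow> matching_number E = k - 1"
proof -
  obtain S P where SP: "S \<subseteq> V" "partition_on (V - S) P"
    "card S + (\<Sum>c\<in>P. card c div 2) \<le> matching_number E"
    "card E \<le> (\<Sum>x\<in>S. card (nbrs E x)) + (\<Sum>c\<in>P. card {e \<in> E. e \<subseteq> c})"
    using edge_decomposition[OF V] by blast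
  let ?q = "\<lambda>c. card c div 2" and ?e = "\<lambda>c. card {e \<in> E. e \<subseteq> c}" and ?\<nu> = "matching_number E"
  have finP: "finite P" by (rule finite_elements[OF _ SP(2)]) (use V(1) in simp)
  have cV: "c \<subseteq> V" if "c \<in> P" for c
    using partition_onD1[OF SP(2)] that by auto
  have S: "(\<Sum>x\<in>S. card (nbrs E x)) \<le> card S * (k - 1)"
    using sum_mono[of S "\<lambda>x. card (nbrs E x)" "\<lambda>_. k - 1"] deg SP(1) by auto
  have e1: "2 * ?e c \<le> card c * (k - 1)" if "c \<in> P" for c
  proof -
    have "(\<Sum>x\<in>c. card (nbrs E x)) \<le> card c * (k - 1)"
      using sum_mono[of c "\<lambda>x. card (nbrs E x)" "\<lambda>_. k - 1"] deg cV[OF that] by auto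
    then show ?thesis using induced_edges_bounds(1)[OF V cV[OF that]] by linarith
  qed
  note e2 = induced_edges_bounds(2)[OF V cV]
  have "card E \<le> excess k \<and> (card E = excess k \<longrightarrow> ?\<nu> = k - 1)"
  proof (cases "odd k")
    case True
    have "?e c \<le> k * ?q c" if c: "c \<in> P" for c
    proof (cases "even (card c)")
      case True
      then obtain q where q: "card c = 2 * q" by (elim evenE)
      have "?e c \<le> q * (k - 1)" using e1[OF c] by (simp add: q)
      also have "\<dots> \<le> q * k" by simp
      finally show ?thesis by (simp add: q mult.commute)
    next
      case False
      then obtain q where q: "card c = 2 * q + 1" by (elim oddE)
      show ?thesis
      proof (cases "2 * q + 1 \<le> k")
        case True
        have "2 * ?e c \<le> (2 * q + 1) * (2 * q)" using e2[OF c] by (simp add: q)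
        also have "\<dots> \<le> k * (2 * q)" by (rule mult_right_mono) (use True in auto)
        finally show ?thesis by (simp add: q)
      next
        case False
        have "2 * ?e c \<le> (2 * q + 1) * (k - 1)" using e1[OF c] by (simp add: q)
        also have "\<dots> = 2 * q * (k - 1) + (k - 1)" by (simp add: algebra_simps)
        also have "\<dots> \<le> 2 * q * (k - 1) + 2 * q" using False by simp
        also have "\<dots> = 2 * (k * q)" using k by (cases k) (simp_all add: algebra_simps)
        finally show ?thesis by (simp add: q)
      qed
    qed
    then have "(\<Sum>c\<in>P. ?e c) \<le> k * (\<Sum>c\<in>P. ?q c)"
      by (simp add: sum_distrib_left sum_mono)
    moreover have "card S * (k - 1) \<le> k * card S" by (simp add: mult.commute)
    ultimately have "card E \<le> k * (card S + (\<Sum>c\<in>P. ?q c))"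
      using SP(4) S by (simp add: algebra_simps)
    also have "\<dots> \<le> k * ?\<nu>" using SP(3) by simp
    finally have *: "card E \<le> k * ?\<nu>" .
    also have "\<dots> \<le> k * (k - 1)" using mat by simp
    finally have "card E \<le> excess k" using True by (simp add: excess_def)
    moreover have "?\<nu> = k - 1" if "card E = excess k"
    proof -
      have "k * (k - 1) \<le> k * ?\<nu>" using * that True by (simp add: excess_def)
      then show ?thesis using mat k by simp
    qed
    ultimately show ?thesis by blast
  next
    case False
    then obtain j where j: "k = 2 * j" by auto
    then have j1: "j \<ge> 1" using k by simp
    \<comment> \<open>Only an odd part with more than \<open>k\<close> vertices can exceed
      \<open>k - 1\<close> edges per unit: there \<open>(2 * q + 1) * (2 * j - 1)\<close> is odd,
      and halving it gives \<open>q * (k - 1) + (j - 1)\<close> after rounding down.\<close>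
    have e: "?e c \<le> ?q c * (k - 1) + (if ?q c \<ge> j then j - 1 else 0)" if c: "c \<in> P" for c
    proof (cases "even (card c)")
      case True
      then obtain q where q: "card c = 2 * q" by (elim evenE)
      have "?e c \<le> q * (k - 1)" using e1[OF c] by (simp add: q)
      then show ?thesis by (simp add: q)
    next
      case odd: False
      then obtain q where q: "card c = 2 * q + 1" by (elim oddE)
      show ?thesis
      proof (cases "q \<ge> j")
        case True
        have "2 * ?e c \<le> (2 * q + 1) * (2 * j - 1)" using e1[OF c] by (simp add: q j)
        also have "\<dots> = 2 * (q * (2 * j - 1) + (j - 1)) + 1" using j1 by (cases j) (simp_all add: algebra_simps)
        finally show ?thesis using True j by (simp add: q)
      next
        case False
        have "2 * ?e c \<le> (2 * q + 1) * (2 * q)" using e2[OF c] by (simp add: q)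
        also have "\<dots> \<le> (k - 1) * (2 * q)" by (rule mult_right_mono) (use False j in auto)
        finally show ?thesis using False by (simp add: q mult.commute)
      qed
    qed
    \<comment> \<open>Two large parts would already use \<open>2 * j = k\<close> units, but the
      matching number is at most \<open>k - 1\<close>.\<close>
    have big: "(\<Sum>c\<in>P. if ?q c \<ge> j then j - 1 else 0) \<le> j - 1"
    proof -
      let ?B = "{c \<in> P. ?q c \<ge> j}"
      have "j * card ?B \<le> (\<Sum>c\<in>?B. ?q c)"
        using sum_mono[of ?B "\<lambda>_. j" ?q] by (simp add: mult.commute)
      also have "\<dots> \<le> (\<Sum>c\<in>P. ?q c)" by (rule sum_mono2) (use finP in auto)
      also have "\<dots> \<le> 2 * j - 1" using SP(3) mat j by linarith
      also have "\<dots> < j * 2" using j1 by simp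
      finally have "card ?B < 2" by simp
      have "(\<Sum>c\<in>P. if ?q c \<ge> j then j - 1 else 0) = card ?B * (j - 1)"
        using finP by (simp add: sum.If_cases Int_def)
      also have "\<dots> \<le> 1 * (j - 1)" by (rule mult_right_mono) (use \<open>card ?B < 2\<close> in auto)
      finally show ?thesis by simp
    qed
    have "(\<Sum>c\<in>P. ?e c) \<le> (\<Sum>c\<in>P. ?q c * (k - 1) + (if ?q c \<ge> j then j - 1 else 0))"
      by (rule sum_mono) (rule e)
    also have "\<dots> \<le> (\<Sum>c\<in>P. ?q c) * (k - 1) + (j - 1)"
      using big by (simp add: sum.distrib sum_distrib_right)
    finally have "card E \<le> (card S + (\<Sum>c\<in>P. ?q c)) * (k - 1) + (j - 1)"
      using SP(4) S by (simp add: algebra_simps)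
    also have "\<dots> \<le> ?\<nu> * (k - 1) + (j - 1)" using SP(3) by (intro add_right_mono mult_right_mono) auto
    finally have *: "card E \<le> ?\<nu> * (k - 1) + (j - 1)" .
    have ex: "excess k = (k - 1) * (k - 1) + (j - 1)"
    proof -
      obtain i where "j = Suc i" using j1 by (cases j) auto
      then show ?thesis using j by (simp add: excess_def algebra_simps)
    qed
    have "?\<nu> * (k - 1) + (j - 1) \<le> (k - 1) * (k - 1) + (j - 1)"
      using mat by (intro add_right_mono mult_right_mono) auto
    then have "card E \<le> excess k" using * ex by linarith
    moreover have "?\<nu> = k - 1" if "card E = excess k"
    proof -
      have "(k - 1) * (k - 1) \<le> ?\<nu> * (k - 1)" using * that ex by linarith
      then show ?thesis using mat j j1 by (simp add: mult_le_cancel2)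
    qed
    ultimately show ?thesis by blast
  qed
  then show "card E \<le> excess k" "card E = excess k \<Longrightarrow> ?\<nu> = k - 1" by auto
qed

section \<open>Edges inside the classes of a partition\<close>

text \<open>Each neighbour of \<open>x\<close> in its own class and each disjoint inner edge of
  another class within its neighbourhood can start one blade centred at \<open>x\<close>; the
  condition says that fewer than \<open>k\<close> blades arise in this way.\<close>

definition fan_bounded :: "'v set \<Rightarrow> ('v \<Rightarrow> nat) \<Rightarrow> 'v set set \<Rightarrow> nat \<Rightarrow> bool" where
  "fan_bounded V part E k \<longleftrightarrow>
     (\<forall>x\<in>V. \<forall>Y Q. Y \<subseteq> nbrs (inner part E) x \<longrightarrow>
        Q \<subseteq> {e \<in> inner part E. part x \<notin> part ` e \<and> e \<subseteq> nbrs E x} \<longrightarrow> disjoint Q \<longrightarrow>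
        card Y + card Q < k)"

text \<open>Nothing is asked inside the class. Such a vertex sees the maximum matchings of all other
  classes in full, which bounds the sum of their sizes.\<close>

definition has_generic :: "'v set \<Rightarrow> ('v \<Rightarrow> nat) \<Rightarrow> 'v set set \<Rightarrow> nat \<Rightarrow> bool" where
  "has_generic V part E r \<longleftrightarrow>
     (\<forall>i<r. \<exists>x\<in>V. part x = i \<and> (\<forall>y\<in>V. part y \<noteq> i \<longrightarrow> {x, y} \<in> E))"

definition class_edges :: "('v \<Rightarrow> nat) \<Rightarrow> 'v set set \<Rightarrow> nat \<Rightarrow> 'v set set" where
  "class_edges part E i = {e \<in> E. part ` e \<subseteq> {i}}"

lemma doubleton_class_edges [simp]:
  "{x, y} \<in> class_edges part E i \<longleftrightarrow> {x, y} \<in> E \<and> part x = i \<and> part y = i"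
  by (auto simp: class_edges_def)

lemma fan_boundedD:
  assumes "fan_bounded V part E k" "x \<in> V" "Y \<subseteq> nbrs (inner part E) x" "disjoint Q"
    "\<And>e. e \<in> Q \<Longrightarrow> e \<in> inner part E \<and> part x \<notin> part ` e \<and> e \<subseteq> nbrs E x"
  shows "card Y + card Q < k"
proof -
  have "Q \<subseteq> {e \<in> inner part E. part x \<notin> part ` e \<and> e \<subseteq> nbrs E x}"
    using assms(5) by auto
  from assms(1)[unfolded fan_bounded_def, rule_format, OF assms(2,3) this assms(4)]
  show ?thesis .
qed

text \<open>Each member of \<open>Q\<close> chooses a point of \<open>B\<close>, and disjointness
  makes the choice injective. This bounds how many matching edges can be spoiled by the missing
  edges at a vertex.\<close>

lemma card_disjoint_meeting:
  assumes "finite B" "disjoint Q" "\<And>e. e \<in> Q \<Longrightarrow> e \<inter> B \<noteq> {}"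
  shows "card Q \<le> card B"
proof -
  have "\<exists>f. \<forall>e\<in>Q. f e \<in> e \<inter> B" using assms(3) by (intro bchoice) auto
  then obtain f where f: "\<And>e. e \<in> Q \<Longrightarrow> f e \<in> e \<and> f e \<in> B" by auto
  have "inj_on f Q"
  proof (rule inj_onI)
    fix d e assume "d \<in> Q" "e \<in> Q" "f d = f e"
    then have "f d \<in> d \<inter> e" using f by force
    then show "d = e" using assms(2) \<open>d \<in> Q\<close> \<open>e \<in> Q\<close> by (auto simp: disjoint_def)
  qed
  then show ?thesis
    by (rule card_inj_on_le) (use f assms(1) in auto)
qed

text \<open>Bounds the edges of a class, less the missing edges charged to it, per unit of its matching
  number, if the other classes have matching number \<open>t\<close>. The two terms belong to the odd
  components and to the separating set of the Tutte-Berge formula.\<close>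

definition gain :: "real \<Rightarrow> real \<Rightarrow> real" where
  "gain k t = max (k - t) (k - 1 - t / 2)"

lemma gain_antimono: "s \<le> t \<Longrightarrow> gain k t \<le> gain k s"
  by (auto simp: gain_def)

text \<open>Here \<open>a\<close> is the matching number of one class and \<open>b\<close> that of
  all others together. The right-hand side is the smaller of the two forms of the constant, so inner
  edges in two classes never reach it, whatever the parity of \<open>k\<close>. The cases
  \<open>one\<close>, \<open>two\<close> and \<open>three\<close> are the choices of the maximum in
  the two gains.\<close>

lemma gain_bound:
  fixes a b k :: nat
  assumes "1 \<le> a" "a \<le> k - 2" "1 \<le> b" "b \<le> k - 2"
  shows "a * gain k b + b * gain k a < (real k)\<^sup>2 - 3 / 2 * real k"
proof -
  define x y z :: real where "x = a" and "y = b" and "z = k"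
  have "real a \<le> real (k - 2)" "real b \<le> real (k - 2)" using assms by linarith+
  then have x: "1 \<le> x" "x \<le> z - 2" and y: "1 \<le> y" "y \<le> z - 2" and z: "z \<ge> 3"
    using assms by (auto simp: x_def y_def z_def of_nat_diff)
  \<comment> \<open>The linear estimates below need \<open>z - 4\<close> to be nonnegative; the only
    remaining value \<open>k = 3\<close> forces \<open>a = b = 1\<close>.\<close>
  have z4: "z = 3 \<and> x = 1 \<and> y = 1 \<or> z \<ge> 4"
  proof (cases "k = 3")
    case True
    then have "a = 1" "b = 1" using assms by auto
    then show ?thesis using True by (simp add: x_def y_def z_def)
  next
    case False
    then have "k \<ge> 4" using assms by linarith
    then show ?thesis by (simp add: z_def)
  qed
  \<comment> \<open>The left side is linear in \<open>x\<close>, so \<open>x\<close> is moved to the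
    end of its range dictated by the sign of its coefficient; likewise in
    \<open>two\<close>.\<close>
  have one: "x * (z - y) + y * (z - x) < z\<^sup>2 - 3 / 2 * z"
    if x: "1 \<le> x" "x \<le> z - 2" and y: "1 \<le> y" "y \<le> z - 2"
      and z4: "z = 3 \<and> x = 1 \<and> y = 1 \<or> z \<ge> 4" for x y z :: real
  proof (cases "z \<ge> 4")
    case True
    have eq: "x * (z - y) + y * (z - x) = x * (z - 2 * y) + y * z" by (simp add: algebra_simps)
    show ?thesis
    proof (cases "z - 2 * y \<ge> 0")
      case pos: True
      have "x * (z - 2 * y) \<le> (z - 2) * (z - 2 * y)" by (rule mult_right_mono) (use x pos in auto)
      moreover have "1 * (z - 4) \<le> y * (z - 4)" by (rule mult_right_mono) (use y True in auto)
      ultimately show ?thesis using eq True by (simp add: algebra_simps power2_eq_square)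
    next
      case False
      have "x * (z - 2 * y) \<le> 1 * (z - 2 * y)" by (rule mult_right_mono_neg) (use x False in auto)
      moreover have "y * (z - 2) \<le> (z - 2) * (z - 2)" by (rule mult_right_mono) (use y True in auto)
      ultimately show ?thesis using eq True by (simp add: algebra_simps power2_eq_square)
    qed
  qed (use z4 in \<open>auto simp: power2_eq_square\<close>)
  have two: "x * (z - y) + y * (z - 1 - x / 2) < z\<^sup>2 - 3 / 2 * z"
    if x: "1 \<le> x" "x \<le> z - 2" and y: "1 \<le> y" "y \<le> z - 2"
      and z4: "z = 3 \<and> x = 1 \<and> y = 1 \<or> z \<ge> 4" for x y z :: real
  proof (cases "z \<ge> 4")
    case True
    have eq: "x * (z - y) + y * (z - 1 - x / 2) = x * (z - 3 / 2 * y) + y * (z - 1)"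
      by (simp add: algebra_simps)
    show ?thesis
    proof (cases "z - 3 / 2 * y \<ge> 0")
      case pos: True
      have "x * (z - 3 / 2 * y) \<le> (z - 2) * (z - 3 / 2 * y)"
        by (rule mult_right_mono) (use x pos in auto)
      moreover have "1 * (z / 2 - 2) \<le> y * (z / 2 - 2)" by (rule mult_right_mono) (use y True in auto)
      ultimately show ?thesis using eq True by (simp add: field_simps power2_eq_square)
    next
      case False
      have "x * (z - 3 / 2 * y) \<le> 1 * (z - 3 / 2 * y)"
        by (rule mult_right_mono_neg) (use x False in auto)
      moreover have "y * (z - 5 / 2) \<le> (z - 2) * (z - 5 / 2)"
        by (rule mult_right_mono) (use y True in auto)
      ultimately show ?thesis using eq True by (simp add: field_simps power2_eq_square)
    qed
  qed (use z4 in \<open>auto simp: power2_eq_square\<close>)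
  \<comment> \<open>The left side equals
    \<open>(z - 1)\<^sup>2 - (z - 1 - x) * (z - 1 - y)\<close>.\<close>
  have three: "x * (z - 1 - y / 2) + y * (z - 1 - x / 2) < z\<^sup>2 - 3 / 2 * z"
  proof -
    have "1 * 1 \<le> (z - 1 - x) * (z - 1 - y)" by (rule mult_mono) (use x y in auto)
    then show ?thesis using z by (simp add: algebra_simps power2_eq_square)
  qed
  have "x * gain z y + y * gain z x < z\<^sup>2 - 3 / 2 * z"
    using one[OF x y z4] two[OF x y z4] two[OF y x] z4 three unfolding gain_def max_def
    by (auto simp: add.commute)
  then show ?thesis by (simp add: x_def y_def z_def)
qed

text \<open>Every missing cross edge is charged half to each
  end. A vertex of class \<open>i\<close> with \<open>m\<close> missing edges has at most \<open>k - 1 - \<beta> + m\<close>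
  neighbours in its class, where \<open>\<beta>\<close> is the matching number of the other classes together.\<close>

lemma inner_edges_bound_irreducible:
  assumes fV: "finite V" and E: "E \<subseteq> [V]\<^bsup>2\<^esup>" and k: "k \<ge> 1" and r: "r \<ge> 2"
    and pr: "part ` V \<subseteq> {..<r}" and gen: "has_generic V part E r" and fb: "fan_bounded V part E k"
    and irr: "\<And>x. x \<in> V \<Longrightarrow> nbrs (missing V part E) x \<noteq> {} \<Longrightarrow>
      card (nbrs (missing V part E) x) < card (nbrs (inner part E) x)"
  shows "card (inner part E) \<le> excess k + card (missing V part E) \<and>
    (card (inner part E) = excess k + card (missing V part E) \<longrightarrow>
      (\<exists>i<r. matching_number (class_edges part E i) \<ge> k - 1))"
proof -
  let ?I = "inner part E" and ?M = "missing V part E" and ?E = "class_edges part E"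
  let ?V = "\<lambda>i. {x \<in> V. part x = i}"
  define d where "d x = card (nbrs ?I x)" for x
  define m where "m x = card (nbrs ?M x)" for x
  define \<nu> where "\<nu> i = matching_number (?E i)" for i
  define N where "N = (\<Sum>i<r. \<nu> i)"
  have finE: "finite E" by (rule finite_edges[OF fV E])
  have I2: "?I \<subseteq> [V]\<^bsup>2\<^esup>" using E inner_subset by blast
  have Esub: "?E i \<subseteq> ?I" for i by (auto simp: class_edges_def inner_def)
  have EE: "?E i \<subseteq> E" for i by (auto simp: class_edges_def)
  have EV: "?E i \<subseteq> [?V i]\<^bsup>2\<^esup>" for i
    using E by (auto simp: class_edges_def nsets_def)
  have fEi: "finite (?E i)" for i using EE finE by (rule finite_subset)
  have nbr_eq: "nbrs (?E (part x)) x = nbrs ?I x" for x by (auto simp: nbrs_def)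
  have ne: "e \<noteq> {}" if "e \<in> E" for e using that E by (auto simp: nsets_def)
  have Idec: "?I = (\<Union>i<r. ?E i)"
  proof (intro equalityI subsetI)
    fix e assume e: "e \<in> ?I"
    then obtain i where i: "part ` e \<subseteq> {i}" "e \<in> E" by (auto simp: inner_def)
    then obtain x where "x \<in> e" "x \<in> V" using ne E by (fastforce simp: nsets_def)
    then have "i < r" using i pr by blast
    then show "e \<in> (\<Union>i<r. ?E i)" using i by (auto simp: class_edges_def)
  qed (use Esub in auto)
  have Edis: "?E i \<inter> ?E j = {}" if "i \<noteq> j" for i j
    using that ne by (auto simp: class_edges_def) blast
  have cardI: "card ?I = (\<Sum>i<r. card (?E i))"
    unfolding Idec by (rule card_UN_disjoint) (use fEi Edis in auto)
  obtain Q where Q: "\<And>i. Q i \<subseteq> ?E i" "\<And>i. disjoint (Q i)" "\<And>i. card (Q i) = \<nu> i"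
  proof -
    have "\<forall>i. \<exists>M. M \<subseteq> ?E i \<and> disjoint M \<and> card M = \<nu> i"
      using maximum_matching[OF fEi] unfolding \<nu>_def by metis
    then show ?thesis using that by metis
  qed
  \<comment> \<open>Of the maximum matchings of the other classes, at most \<open>m x\<close> edges
    have an end not adjacent to \<open>x\<close>. The rest together with the inner neighbours of
    \<open>x\<close> is limited by \<open>fan_bounded\<close>.\<close>
  have F1: "d x + (N - \<nu> (part x)) < k + m x" if x: "x \<in> V" for x
  proof -
    let ?J = "{..<r} - {part x}"
    define R where "R = (\<Union>j\<in>?J. Q j)"
    define G where "G = {e \<in> R. e \<subseteq> nbrs E x}"
    have px: "part x < r" using x pr by auto
    have RE: "e \<in> ?I \<and> part x \<notin> part ` e \<and> e \<in> E" if "e \<in> R" for e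
      using that Q(1) Esub EE unfolding R_def class_edges_def by fastforce
    have finR: "finite R" using RE finE by (meson finite_subset subsetI)
    have disR: "disjoint R"
    proof (rule disjointI)
      fix a b assume ab: "a \<in> R" "b \<in> R" "a \<noteq> b"
      then obtain i j where ij: "a \<in> Q i" "b \<in> Q j" by (auto simp: R_def)
      show "a \<inter> b = {}"
      proof (cases "i = j")
        case True
        then show ?thesis using ij ab Q(2)[of j] by (auto simp: disjoint_def)
      next
        case False
          have "a \<in> ?E i" "b \<in> ?E j" using ij Q(1) by blast+
          then have "part ` a \<subseteq> {i}" "part ` b \<subseteq> {j}" by (simp_all add: class_edges_def)
          then show ?thesis using False by auto
      qed
    qed
    have "card R = (\<Sum>j\<in>?J. card (Q j))"
      unfolding R_def
    proof (rule card_UN_disjoint)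
      show "\<forall>i\<in>?J. finite (Q i)" using Q(1) fEi finite_subset by blast
      show "\<forall>i\<in>?J. \<forall>j\<in>?J. i \<noteq> j \<longrightarrow> Q i \<inter> Q j = {}" using Q(1) Edis by blast
    qed simp
    also have "\<dots> = N - \<nu> (part x)"
      unfolding N_def Q(3) by (subst sum_diff1_nat) (use px in auto)
    finally have cR: "card R = N - \<nu> (part x)" .
    have "card (R - G) \<le> m x"
      unfolding m_def
    proof (rule card_disjoint_meeting)
      show "finite (nbrs ?M x)" by (rule finite_nbrs[OF fV missing_subset])
      show "disjoint (R - G)" using disR by (rule pairwise_subset) auto
      fix e assume e: "e \<in> R - G"
      then have "\<not> e \<subseteq> nbrs E x" by (auto simp: G_def)
      then obtain y where y: "y \<in> e" "y \<notin> nbrs E x" by blast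
      have eR: "e \<in> R" using e by simp
      have "part y \<noteq> part x" using RE[OF eR] imageI[OF y(1), of part] by metis
      moreover have "e \<in> [V]\<^bsup>2\<^esup>" using RE[OF eR] E by blast
      then have "y \<in> V" using y(1) by (auto simp: nsets_def)
      ultimately have "y \<in> nbrs ?M x" using x y(2) by auto
      then show "e \<inter> nbrs ?M x \<noteq> {}" using y(1) by blast
    qed
    moreover have "card G + card (R - G) = card R"
    proof -
      have "R = G \<union> (R - G)" by (auto simp: G_def)
      then show ?thesis using finR by (metis Diff_disjoint card_Un_disjoint finite_Un)
    qed
    moreover have "card (nbrs ?I x) + card G < k"
    proof (rule fan_boundedD[OF fb x])
      show "disjoint G" using disR by (rule pairwise_subset) (auto simp: G_def)
    qed (use RE in \<open>auto simp: G_def\<close>)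
    ultimately show ?thesis using cR unfolding d_def by linarith
  qed
  have F2: "d x \<le> k - 1" if "x \<in> V" for x
    using fan_boundedD[OF fb that, of "nbrs ?I x" "{}"] unfolding d_def by auto
  \<comment> \<open>A generic vertex of class \<open>i\<close> has no missing edge, so
    \<open>F1\<close> applies to it with \<open>m x = 0\<close>.\<close>
  have F3: "N - \<nu> i \<le> k - 1" if i: "i < r" for i
  proof -
    obtain x where x: "x \<in> V" "part x = i" "\<forall>y\<in>V. part y \<noteq> i \<longrightarrow> {x, y} \<in> E"
      using gen i unfolding has_generic_def by blast
    then have "nbrs ?M x = {}" by auto
    then show ?thesis using F1[OF x(1)] x(2) by (simp add: m_def)
  qed
  have nu_pos: "\<nu> i \<ge> 1" if Ei: "?E i \<noteq> {}" for i
  proof -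
    obtain e where "e \<in> ?E i" using Ei by blast
    then have "card {e} \<le> \<nu> i" unfolding \<nu>_def
      by (intro matching_number_ge[OF fEi]) auto
    then show ?thesis by simp
  qed
  \<comment> \<open>An end \<open>x\<close> of an inner edge has \<open>d x \<ge> 1\<close>, and by
    irreducibility \<open>m x\<close> is zero or less than \<open>d x\<close>. Either way
    \<open>F1\<close> improves by one over \<open>F3\<close>, giving the range required in
    \<open>gain_bound\<close>.\<close>
  have F4: "N - \<nu> i + 2 \<le> k" if Ei: "?E i \<noteq> {}" and i: "i < r" for i
  proof -
    obtain e where e: "e \<in> ?E i" using Ei by blast
    then have "e \<in> [?V i]\<^bsup>2\<^esup>" using EV by blast
    then obtain x y where xy: "e = {x, y}" "x \<in> V" "part x = i" by (elim nsets2_E) auto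
    then have "y \<in> nbrs ?I x" using e by auto
    then have "d x \<ge> 1"
      unfolding d_def using finite_nbrs[OF fV I2, of x] by (metis One_nat_def Suc_leI card_gt_0_iff empty_iff)
    moreover have "m x = 0 \<or> m x < d x"
      using irr[OF xy(2)] finite_nbrs[OF fV missing_subset, of part E x] unfolding m_def d_def by auto
    ultimately show ?thesis using F1[OF xy(2)] xy(3) by auto
  qed
  show ?thesis
  proof (cases "\<exists>i<r. \<exists>j<r. i \<noteq> j \<and> ?E i \<noteq> {} \<and> ?E j \<noteq> {}")
    case True
    then obtain i j where ij: "i < r" "j < r" "i \<noteq> j" "?E i \<noteq> {}" "?E j \<noteq> {}" by blast
    let ?b = "\<lambda>l. N - \<nu> l"
    have class_bound: "real (card (?E l)) - (\<Sum>x\<in>?V l. real (m x)) / 2 \<le> \<nu> l * gain k (?b l)"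
      if l: "l < r" for l
    proof -
      \<comment> \<open>By \<open>F1\<close> the inner degree is at most \<open>D + m x\<close>; by
        \<open>F2\<close> it is at most \<open>k - 1\<close>, which plays the part of
        \<open>K\<close> in \<open>weighted_edge_bound\<close>.\<close>
      define D where "D = real k - 1 - real (?b l)"
      have D0: "D \<ge> 0" using F3[OF l] k unfolding D_def by linarith
      have "\<exists>s. s \<le> matching_number (?E l) \<and> card (?E l) - (\<Sum>x\<in>?V l. real (m x)) / 2
        \<le> s * ((real (k - 1) + D) / 2) + (real (matching_number (?E l)) - s) * (D + 1)"
      proof (rule weighted_edge_bound[OF _ EV D0])
        show "finite (?V l)" using fV by simp
        fix x assume x: "x \<in> ?V l"
        then have eq: "card (nbrs (?E l) x) = d x" using nbr_eq[of x] by (simp add: d_def)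
        show "real (card (nbrs (?E l) x)) \<le> real (k - 1)" using F2[of x] x eq by simp
        have "real (d x + ?b l + 1) \<le> real (k + m x)"
          using F1[of x] x by (intro of_nat_mono) auto
        then show "real (card (nbrs (?E l) x)) \<le> D + real (m x)" unfolding D_def eq by simp
      qed simp
      then obtain s where s: "s \<le> \<nu> l" "card (?E l) - (\<Sum>x\<in>?V l. real (m x)) / 2
        \<le> s * ((real (k - 1) + D) / 2) + (real (\<nu> l) - s) * (D + 1)"
        unfolding \<nu>_def by blast
      have "(real (k - 1) + D) / 2 \<le> gain k (?b l)" "D + 1 \<le> gain k (?b l)"
        using k unfolding D_def gain_def by (auto simp: of_nat_diff max_def field_simps)
      then have "s * ((real (k - 1) + D) / 2) + (real (\<nu> l) - s) * (D + 1)
        \<le> s * gain k (?b l) + (real (\<nu> l) - s) * gain k (?b l)"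
        using s(1) by (intro add_mono mult_left_mono) auto
      then show ?thesis using s(2) by (simp add: algebra_simps)
    qed
    have V_sum: "(\<Sum>x\<in>V. real (m x)) = (\<Sum>l<r. \<Sum>x\<in>?V l. real (m x))"
    proof -
      have "(\<Sum>x\<in>V. real (m x)) = (\<Sum>l\<in>{..<r}. sum (\<lambda>x. real (m x)) {x \<in> V. part x = l})"
        by (rule sum.group[symmetric]) (use fV pr in auto)
      then show ?thesis by simp
    qed
    have M_sum: "(\<Sum>x\<in>V. real (m x)) = 2 * real (card ?M)"
      using handshake[OF fV missing_subset[of V part E]] unfolding m_def
      by (metis of_nat_mult of_nat_numeral of_nat_sum)
    \<comment> \<open>Each missing edge has two ends, so the half charges add up to the number of
      missing edges.\<close>
    have "real (card ?I) - real (card ?M) = (\<Sum>l<r. real (card (?E l)) - (\<Sum>x\<in>?V l. real (m x)) / 2)"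
      using M_sum V_sum unfolding cardI by (simp add: sum_subtractf flip: sum_divide_distrib)
    also have "\<dots> \<le> (\<Sum>l<r. \<nu> l * gain k (?b l))"
      by (rule sum_mono) (use class_bound in auto)
    also have "\<dots> = \<nu> i * gain k (?b i) + (\<Sum>l\<in>{..<r} - {i}. \<nu> l * gain k (?b l))"
      by (rule sum.remove) (use ij in auto)
    \<comment> \<open>For every class \<open>l\<close> other than \<open>i\<close> the remaining
      classes include \<open>i\<close>, so its gain is at most \<open>gain k (\<nu> i)\<close>. This
      merges all of them into one with matching number \<open>N - \<nu> i\<close>, leaving two
      variables.\<close>
    also have "(\<Sum>l\<in>{..<r} - {i}. \<nu> l * gain k (?b l)) \<le> (\<Sum>l\<in>{..<r} - {i}. \<nu> l * gain k (\<nu> i))"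
    proof (rule sum_mono)
      fix l assume l: "l \<in> {..<r} - {i}"
      have "\<nu> i + \<nu> l = (\<Sum>x\<in>{i, l}. \<nu> x)" using l by auto
      also have "\<dots> \<le> N" unfolding N_def by (rule sum_mono2) (use l ij in auto)
      finally show "\<nu> l * gain k (?b l) \<le> \<nu> l * gain k (\<nu> i)"
        by (intro mult_left_mono gain_antimono) auto
    qed
    also have "\<dots> = ?b i * gain k (\<nu> i)"
    proof -
      have "(\<Sum>l\<in>{..<r} - {i}. \<nu> l) = ?b i"
        unfolding N_def by (subst sum_diff1_nat) (use ij in auto)
      then have "real (?b i) = (\<Sum>l\<in>{..<r} - {i}. real (\<nu> l))" by (metis of_nat_sum)
      then show ?thesis by (simp only: sum_distrib_right)
    qed
    finally have le: "real (card ?I) - real (card ?M) \<le> \<nu> i * gain k (?b i) + ?b i * gain k (\<nu> i)"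
      by simp
    have "\<nu> i + \<nu> j = (\<Sum>x\<in>{i, j}. \<nu> x)" using ij by auto
    also have "\<dots> \<le> N" unfolding N_def by (rule sum_mono2) (use ij in auto)
    finally have "\<nu> i \<le> ?b j" "\<nu> j \<le> ?b i" by auto
    then have "\<nu> i * gain k (?b i) + ?b i * gain k (\<nu> i) < (real k)\<^sup>2 - 3 / 2 * real k"
      using F4[OF ij(4,1)] F4[OF ij(5,2)] nu_pos[OF ij(4)] nu_pos[OF ij(5)]
      by (intro gain_bound) auto
    also have "\<dots> \<le> excess k" using real_excess[OF k] by auto
    finally have "real (card ?I) < real (excess k + card ?M)" using le by simp
    then have "card ?I < excess k + card ?M" by (simp only: of_nat_less_iff)
    then show ?thesis by simp
  next
    case False
    have "\<exists>i<r. \<forall>j<r. j \<noteq> i \<longrightarrow> ?E j = {}"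
    proof (cases "\<exists>i<r. ?E i \<noteq> {}")
      case True
      then show ?thesis using False by blast
    next
      case False
      then show ?thesis using r by (intro exI[of _ 0]) auto
    qed
    then obtain i where i: "i < r" "\<And>j. j < r \<Longrightarrow> j \<noteq> i \<Longrightarrow> ?E j = {}" by blast
    \<comment> \<open>A vertex with a missing edge has an inner edge by irreducibility and hence
      lies in the only class with inner edges. A missing edge would thus have both ends in class
      \<open>i\<close>, so there is none.\<close>
    have pi: "part x = i" if x: "x \<in> V" "nbrs ?M x \<noteq> {}" for x
    proof -
      have "nbrs ?I x \<noteq> {}" using irr[OF x] by force
      then have "nbrs (?E (part x)) x \<noteq> {}" unfolding nbr_eq .
      then have "?E (part x) \<noteq> {}" unfolding nbrs_def by blast
      then show ?thesis using i(2)[of "part x"] x pr by auto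
    qed
    have "?M = {}"
    proof (rule ccontr)
      assume "?M \<noteq> {}"
      then obtain e where e: "e \<in> ?M" by blast
      then have "e \<in> [V]\<^bsup>2\<^esup>" using missing_subset by blast
      then obtain x y where xy: "e = {x, y}" "x \<in> V" "y \<in> V" by (elim nsets2_E)
      then have "y \<in> nbrs ?M x" "x \<in> nbrs ?M y" using e by (auto simp: insert_commute)
      then have "part x = i" "part y = i" using pi xy by blast+
      then show False using e xy by simp
    qed
    moreover have "card ?I = card (?E i)"
      using i unfolding cardI by (subst sum.remove[of _ i]) auto
    \<comment> \<open>A generic vertex of any other class, available since \<open>r \<ge> 2\<close>,
      sees the whole matching of class \<open>i\<close>.\<close>
    moreover have "\<nu> i \<le> k - 1"
    proof -
      define j where "j = (if i = 0 then 1 else 0 :: nat)"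
      have j: "j < r" "j \<noteq> i" using r by (auto simp: j_def)
      have "\<nu> i + \<nu> j = (\<Sum>x\<in>{i, j}. \<nu> x)" using j by auto
      also have "\<dots> \<le> N" unfolding N_def by (rule sum_mono2) (use j i in auto)
      finally show ?thesis using F3[OF j(1)] by linarith
    qed
    moreover have "card (nbrs (?E i) x) \<le> k - 1" if "x \<in> ?V i" for x
      using F2[of x] that nbr_eq[of x] by (simp add: d_def)
    moreover have "finite (?V i)" using fV by simp
    ultimately show ?thesis
      using degree_matching_edge_bound[OF _ EV k, of i] i(1) unfolding \<nu>_def by fastforce
  qed
qed

text \<open>A vertex with no more neighbours in its class than missing edges can be made generic, which
  does not decrease the number of inner edges minus the number of missing edges.\<close>

theorem inner_edges_bound:
  assumes fV: "finite V" and k: "k \<ge> 1" and r: "r \<ge> 2" and pr: "part ` V \<subseteq> {..<r}"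
    and "E \<subseteq> [V]\<^bsup>2\<^esup>" "has_generic V part E r" "fan_bounded V part E k"
  shows "card (inner part E) \<le> excess k + card (missing V part E) \<and>
    (card (inner part E) = excess k + card (missing V part E) \<longrightarrow>
      (\<exists>i<r. matching_number (class_edges part E i) \<ge> k - 1))"
  using assms(5-7)
proof (induction "card (missing V part E)" arbitrary: E rule: less_induct)
  case less
  note E = less.prems(1) and gen = less.prems(2) and fb = less.prems(3)
  let ?I = "inner part E" and ?M = "missing V part E"
  have finE: "finite E" by (rule finite_edges[OF fV E])
  have finM: "finite ?M" by (rule finite_edges[OF fV missing_subset])
  have I2: "?I \<subseteq> [V]\<^bsup>2\<^esup>" using E inner_subset by blast
  show ?case
  proof (cases "\<exists>x\<in>V. nbrs ?M x \<noteq> {} \<and> card (nbrs ?I x) \<le> card (nbrs ?M x)")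
    case False
    then show ?thesis
      by (intro inner_edges_bound_irreducible[OF fV E k r pr gen fb]) auto
  next
    case True
    then obtain x where x: "x \<in> V" "nbrs ?M x \<noteq> {}" "card (nbrs ?I x) \<le> card (nbrs ?M x)" by blast
    \<comment> \<open>All inner edges at \<open>x\<close> are deleted and all missing edges at
      \<open>x\<close> inserted.\<close>
    define F where "F = (E - {e \<in> ?I. x \<in> e}) \<union> {e \<in> ?M. x \<in> e}"
    have F_edge: "{a, b} \<in> F \<longleftrightarrow> (if x = a \<or> x = b then a \<in> V \<and> b \<in> V \<and> part a \<noteq> part b else {a, b} \<in> E)"
      for a b
      using edgeD[OF E, of a b] by (auto simp: F_def)
    have F2: "F \<subseteq> [V]\<^bsup>2\<^esup>" using E missing_subset unfolding F_def by blast
    have in_F: "inner part F = ?I - {e \<in> ?I. x \<in> e}"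
      by (auto simp: F_def inner_def missing_def)
    have mi_F: "missing V part F = ?M - {e \<in> ?M. x \<in> e}"
      by (auto simp: F_def inner_def missing_def)
    have cI: "card (inner part F) + card (nbrs ?I x) = card ?I"
    proof -
      have "card (inner part F) = card ?I - card {e \<in> ?I. x \<in> e}"
        unfolding in_F by (rule card_Diff_subset) (use finE in \<open>auto simp: inner_def\<close>)
      moreover have "card {e \<in> ?I. x \<in> e} \<le> card ?I"
        by (rule card_mono) (use finE in \<open>auto simp: inner_def\<close>)
      ultimately show ?thesis using card_nbrs[OF I2, of x] by simp
    qed
    have cM: "card (missing V part F) + card (nbrs ?M x) = card ?M"
    proof -
      have "card (missing V part F) = card ?M - card {e \<in> ?M. x \<in> e}"
        unfolding mi_F by (rule card_Diff_subset) (use finM in auto)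
      moreover have "card {e \<in> ?M. x \<in> e} \<le> card ?M"
        by (rule card_mono) (use finM in auto)
      ultimately show ?thesis using card_nbrs[OF missing_subset, of V part E x] by simp
    qed
    have pos: "card (nbrs ?M x) > 0"
      using x(2) finite_nbrs[OF fV missing_subset, of part E x] by (simp add: card_gt_0_iff)
    have genF: "has_generic V part F r"
      unfolding has_generic_def
    proof (intro allI impI)
      fix i assume "i < r"
      then obtain z where z: "z \<in> V" "part z = i" "\<forall>y\<in>V. part y \<noteq> i \<longrightarrow> {z, y} \<in> E"
        using gen unfolding has_generic_def by blast
      then show "\<exists>z\<in>V. part z = i \<and> (\<forall>y\<in>V. part y \<noteq> i \<longrightarrow> {z, y} \<in> F)"
        by (intro bexI[of _ z]) (auto simp: F_edge)
    qed
    have fbF: "fan_bounded V part F k"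
      unfolding fan_bounded_def
    proof (intro ballI allI impI)
      fix z Y Q
      assume z: "z \<in> V" and Y: "Y \<subseteq> nbrs (inner part F) z" and disQ: "disjoint Q"
        and Q: "Q \<subseteq> {e \<in> inner part F. part z \<notin> part ` e \<and> e \<subseteq> nbrs F z}"
      show "card Y + card Q < k"
      \<comment> \<open>At \<open>x\<close> no inner neighbour is left, and a matching seen by
        \<open>x\<close> in \<open>F\<close> is seen in \<open>E\<close> by a generic vertex of the
        same class. For any other \<open>z\<close> the members of \<open>Q\<close> avoid
        \<open>x\<close>, so the adjacencies involved were already present in
        \<open>E\<close>.\<close>
      proof (cases "z = x")
        case True
        then have "Y = {}" using Y by (auto simp: F_edge)
        have "part x < r" using pr x(1) by auto
        then obtain w where w: "w \<in> V" "part w = part x" "\<forall>y\<in>V. part y \<noteq> part x \<longrightarrow> {w, y} \<in> E"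
          using gen unfolding has_generic_def by blast
        have "card ({} :: 'a set) + card Q < k"
        proof (rule fan_boundedD[OF fb w(1) _ disQ])
          fix e assume "e \<in> Q"
          then have e: "e \<in> ?I" "part x \<notin> part ` e" using Q True in_F by auto
          then have "e \<subseteq> V" using I2 by (auto simp: nsets_def)
          have "e \<subseteq> nbrs E w"
          proof
            fix y assume "y \<in> e"
            then have "y \<in> V" using \<open>e \<subseteq> V\<close> by blast
            moreover have "part y \<noteq> part x" using e(2) imageI[OF \<open>y \<in> e\<close>, of part] by metis
            ultimately show "y \<in> nbrs E w" using w(3) by simp
          qed
          then show "e \<in> ?I \<and> part w \<notin> part ` e \<and> e \<subseteq> nbrs E w" using w(2) e by simp
        qed simp
        then show ?thesis using \<open>Y = {}\<close> by simp
      next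
        case False
        show ?thesis
        proof (rule fan_boundedD[OF fb z _ disQ])
          show "Y \<subseteq> nbrs ?I z" using Y in_F by (auto simp: nbrs_def)
          fix e assume "e \<in> Q"
          then have e: "e \<in> ?I" "x \<notin> e" "part z \<notin> part ` e" "e \<subseteq> nbrs F z" using Q in_F by auto
          moreover have "e \<subseteq> nbrs E z"
          proof
            fix y assume "y \<in> e"
            then have "{z, y} \<in> F" "y \<noteq> x" using e by auto
            then show "y \<in> nbrs E z" using F_edge[of z y] False by auto
          qed
          ultimately show "e \<in> ?I \<and> part z \<notin> part ` e \<and> e \<subseteq> nbrs E z" by blast
        qed
      qed
    qed
    have IH: "card (inner part F) \<le> excess k + card (missing V part F)"
      "card (inner part F) = excess k + card (missing V part F) \<Longrightarrow>
        \<exists>i<r. matching_number (class_edges part F i) \<ge> k - 1"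
      using less.hyps[OF _ F2 genF fbF] cM pos by auto
    have le: "card ?I \<le> excess k + card ?M" using IH(1) cI cM x(3) by linarith
    \<comment> \<open>Equality for \<open>E\<close> forces equality for \<open>F\<close>, whose
      inner edges are among those of \<open>E\<close>.\<close>
    moreover have "\<exists>i<r. matching_number (class_edges part E i) \<ge> k - 1"
      if "card ?I = excess k + card ?M"
    proof -
      have "card (inner part F) = excess k + card (missing V part F)"
        using IH(1) cI cM x(3) that by linarith
      then obtain i where i: "i < r" "matching_number (class_edges part F i) \<ge> k - 1"
        using IH(2) by blast
      have "class_edges part F i \<subseteq> inner part F" by (auto simp: class_edges_def inner_def)
      then have "class_edges part F i \<subseteq> class_edges part E i"
        using in_F by (auto simp: class_edges_def inner_def)
      then have "matching_number (class_edges part F i) \<le> matching_number (class_edges part E i)"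
        by (rule matching_number_mono[rotated]) (use finE in \<open>auto simp: class_edges_def\<close>)
      then show ?thesis using i by (meson order_trans)
    qed
    ultimately show ?thesis by blast
  qed
qed

section \<open>Fans and suspensions\<close>

lemma chromatic_number_le: "proper_coloring G m f \<Longrightarrow> chromatic_number G \<le> m"
  unfolding chromatic_number_def by (rule Least_le) blast

lemma proper_coloring_chromatic_number:
  assumes "simple_graph G"
  obtains f where "proper_coloring G (chromatic_number G) f"
proof -
  obtain h where h: "bij_betw h (verts G) {0..<card (verts G)}"
    using assms ex_bij_betw_finite_nat unfolding simple_graph_def by blast
  have "proper_coloring G (card (verts G)) h"
    unfolding proper_coloring_def
  proof (intro conjI allI impI)
    show "h ` verts G \<subseteq> {..<card (verts G)}" using h by (auto simp: bij_betw_def)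
    fix x y assume "{x, y} \<in> edges G"
    then have "x \<in> verts G" "y \<in> verts G" "x \<noteq> y"
      using assms edgeD[of "edges G" "verts G" x y] unfolding simple_graph_def by blast+
    then show "h x \<noteq> h y" using h by (auto simp: bij_betw_def inj_on_def)
  qed
  then have "\<exists>f. proper_coloring G (chromatic_number G) f"
    unfolding chromatic_number_def by (rule LeastI[of "\<lambda>m. \<exists>f. proper_coloring G m f", OF exI])
  then show ?thesis using that by blast
qed

lemma monochromatic_edge:
  assumes G: "simple_graph G" and g: "g ` verts G \<subseteq> S" "finite S" "card S < chromatic_number G"
  shows "\<exists>x y. {x, y} \<in> edges G \<and> g x = g y"
proof (rule ccontr)
  assume no: "\<not> ?thesis"
  obtain h where h: "bij_betw h S {0..<card S}"
    using ex_bij_betw_finite_nat[OF g(2)] by blast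
  have hS: "h x < card S" if "x \<in> S" for x using bij_betwE[OF h] that by auto
  have "proper_coloring G (card S) (h \<circ> g)"
    unfolding proper_coloring_def
  proof (intro conjI allI impI)
    show "(h \<circ> g) ` verts G \<subseteq> {..<card S}" using g(1) hS by auto
    fix x y assume e: "{x, y} \<in> edges G"
    then have "x \<in> verts G" "y \<in> verts G"
      using G edgeD[of "edges G" "verts G" x y] unfolding simple_graph_def by blast+
    then have "g x \<in> S" "g y \<in> S" using g(1) by auto
    then show "(h \<circ> g) x \<noteq> (h \<circ> g) y" using no e h by (auto simp: bij_betw_def inj_on_def)
  qed
  then show False using chromatic_number_le g(3) by fastforce
qed

text \<open>A colouring that saves a colour after deleting the critical edge must give its two ends
  the same colour, since otherwise it would colour the whole graph.\<close>

lemma edge_critical_coloring: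
  assumes G: "simple_graph G" "edge_critical G"
  obtains a b g where "{a, b} \<in> edges G" "a \<noteq> b" "a \<in> verts G" "b \<in> verts G"
    "g ` verts G \<subseteq> {..<chromatic_number G - 1}" "g a = g b"
    "\<And>x y. {x, y} \<in> edges G \<Longrightarrow> {x, y} \<noteq> {a, b} \<Longrightarrow> g x \<noteq> g y"
proof -
  obtain e where e: "e \<in> edges G" "chromatic_number (delete_edge G e) < chromatic_number G"
    using G(2) unfolding edge_critical_def by blast
  have E: "edges G \<subseteq> [verts G]\<^bsup>2\<^esup>" using G(1) unfolding simple_graph_def by blast
  then obtain a b where ab: "e = {a, b}" "a \<in> verts G" "b \<in> verts G" "a \<noteq> b"
    using e(1) by (meson nsets2_E subsetD)
  have "simple_graph (delete_edge G e)"
    using G(1) unfolding simple_graph_def delete_edge_def by auto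
  then obtain g where g: "proper_coloring (delete_edge G e) (chromatic_number (delete_edge G e)) g"
    by (rule proper_coloring_chromatic_number)
  have range: "g ` verts G \<subseteq> {..<chromatic_number (delete_edge G e)}"
    using g unfolding proper_coloring_def delete_edge_def by simp
  have proper: "g x \<noteq> g y" if "{x, y} \<in> edges G" "{x, y} \<noteq> {a, b}" for x y
    using g that ab(1) unfolding proper_coloring_def delete_edge_def by auto
  have "g a = g b"
  proof (rule ccontr)
    assume ne: "g a \<noteq> g b"
    have "g x \<noteq> g y" if "{x, y} \<in> edges G" for x y
      using proper[OF that] ne by (cases "{x, y} = {a, b}") (auto simp: doubleton_eq_iff)
    then have "proper_coloring G (chromatic_number (delete_edge G e)) g"
      using range unfolding proper_coloring_def by blast
    then show False using chromatic_number_le e(2) by fastforce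
  qed
  moreover have "g ` verts G \<subseteq> {..<chromatic_number G - 1}"
    using range e(2) by fastforce
  ultimately show ?thesis using that[of a b g] e(1) ab proper by blast
qed

text \<open>A configuration forcing the suspension of \<open>K\<close> graphs with at most \<open>s\<close> vertices
  altogether: \<open>x\<close> is the centre, each vertex of \<open>Y\<close> and each edge of \<open>Q\<close> is the seed of one of
  the graphs (it receives an end, respectively both ends, of a critical edge), and the sets
  \<open>P j\<close> supply all other vertices.\<close>

definition fan_at :: "nat \<Rightarrow> nat \<Rightarrow> nat \<Rightarrow> 'v set set \<Rightarrow> nat \<Rightarrow> 'v \<Rightarrow> (nat \<Rightarrow> 'v set) \<Rightarrow> 'v set \<Rightarrow> 'v set set \<Rightarrow> bool"
  where
  "fan_at r s K E p x P Y Q \<longleftrightarrow> p < r \<and>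
     (\<forall>j<r. j \<noteq> p \<longrightarrow> finite (P j) \<and> s \<le> card (P j)) \<and>
     (\<forall>j<r. j \<noteq> p \<longrightarrow> (\<forall>a\<in>P j. {x, a} \<in> E)) \<and>
     (\<forall>j<r. j \<noteq> p \<longrightarrow> (\<forall>y\<in>Y. \<forall>a\<in>P j. {y, a} \<in> E)) \<and>
     (\<forall>j<r. j \<noteq> p \<longrightarrow> (\<forall>l<r. l \<noteq> p \<longrightarrow> l \<noteq> j \<longrightarrow> (\<forall>a\<in>P j. \<forall>b\<in>P l. {a, b} \<in> E))) \<and>
     finite Y \<and> (\<forall>y\<in>Y. {x, y} \<in> E) \<and>
     finite Q \<and> Q \<subseteq> E \<and> disjoint Q \<and> Y \<inter> \<Union>Q = {} \<and>
     (\<forall>e\<in>Q. \<exists>l<r. l \<noteq> p \<and> e \<inter> P l = {} \<and>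
        (\<forall>y\<in>e. {x, y} \<in> E \<and> (\<forall>j<r. j \<noteq> p \<longrightarrow> j \<noteq> l \<longrightarrow> (\<forall>a\<in>P j. {y, a} \<in> E)))) \<and>
     K \<le> card Y + card Q"

definition fan_in :: "nat \<Rightarrow> nat \<Rightarrow> nat \<Rightarrow> 'v set set \<Rightarrow> bool" where
  "fan_in r s K E \<longleftrightarrow> (\<exists>p x P Y Q. fan_at r s K E p x P Y Q)"

text \<open>Colours are sent to the classes other than that of the centre, with a prescribed class
  for the colour of the critical edge; a bijection \<open>h\<close> is corrected by a
  transposition.\<close>

lemma color_map:
  assumes "p < (r :: nat)" "l < r" "l \<noteq> p" "c < r - 1"
  obtains \<phi> where "inj_on \<phi> {..<r - 1}" "\<phi> ` {..<r - 1} \<subseteq> {..<r} - {p}" "\<phi> c = l"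
proof -
  have "card {..<r - 1} = card ({..<r} - {p})" using assms(1) by simp
  then obtain h where h: "bij_betw h {..<r - 1} ({..<r} - {p})"
    using finite_same_card_bij[of "{..<r - 1}" "{..<r} - {p}"] by auto
  define \<phi> where "\<phi> x = (if x = c then l else if h x = l then h c else h x)" for x
  have inj: "inj_on h {..<r - 1}" and im: "h ` {..<r - 1} = {..<r} - {p}"
    using h by (auto simp: bij_betw_def)
  show ?thesis
  proof (rule that)
    show "inj_on \<phi> {..<r - 1}"
      using inj assms(4) unfolding inj_on_def \<phi>_def by auto
    show "\<phi> ` {..<r - 1} \<subseteq> {..<r} - {p}"
    proof
      fix z assume "z \<in> \<phi> ` {..<r - 1}"
      then obtain x where x: "x < r - 1" "z = \<phi> x" by auto
      moreover have "h x \<in> {..<r} - {p}" "h c \<in> {..<r} - {p}" using im x(1) assms(4) by auto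
      ultimately show "z \<in> {..<r} - {p}" using assms unfolding \<phi>_def by auto
    qed
    show "\<phi> c = l" by (simp add: \<phi>_def)
  qed
qed

text \<open>Each blade receives its own seed, and all its other vertices are sent to fillers
  according to their colour. For every class a single injection, defined on the vertices of all
  blades, chooses the fillers, so different blades do not collide.\<close>

lemma fan_embedding:
  fixes H :: "'i \<Rightarrow> 'a sgraph" and E :: "'v set set"
  assumes r: "r \<ge> 2" and I: "finite I"
    and H: "\<And>i. i \<in> I \<Longrightarrow> simple_graph (H i) \<and> edge_critical (H i) \<and> chromatic_number (H i) = r"
    and dis: "disjoint_family_on (\<lambda>i. verts (H i)) I" and v: "v \<notin> (\<Union>i\<in>I. verts (H i))"
    and s: "card (\<Union>i\<in>I. verts (H i)) \<le> s"
    and E: "E \<subseteq> [V]\<^bsup>2\<^esup>" and fan: "fan_in r s (card I) E"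
  shows "\<exists>f. inj_on f (verts (suspension H I v)) \<and> (\<forall>e\<in>edges (suspension H I v). f ` e \<in> E)"
proof -
  let ?U = "\<Union>i\<in>I. verts (H i)"
  obtain p x P Y Q where "fan_at r s (card I) E p x P Y Q"
    using fan unfolding fan_in_def by blast
  note F = this[unfolded fan_at_def]
  have p: "p < r" and Y: "finite Y" "\<And>y. y \<in> Y \<Longrightarrow> {x, y} \<in> E"
    and Q: "finite Q" "Q \<subseteq> E" "disjoint Q" "Y \<inter> \<Union>Q = {}" and card: "card I \<le> card Y + card Q"
    using F by simp_all
  have P: "finite (P j) \<and> s \<le> card (P j)" if "j < r" "j \<noteq> p" for j
    using F that by simp
  have xP: "{x, a} \<in> E" if "j < r" "j \<noteq> p" "a \<in> P j" for j a
    using conjunct1[OF conjunct2[OF conjunct2[OF F]]] that by blast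
  have YP: "{y, a} \<in> E" if "j < r" "j \<noteq> p" "y \<in> Y" "a \<in> P j" for j y a
    using conjunct1[OF conjunct2[OF conjunct2[OF conjunct2[OF F]]]] that by blast
  have PP: "{a, b} \<in> E" if "j < r" "j \<noteq> p" "l < r" "l \<noteq> p" "l \<noteq> j" "a \<in> P j" "b \<in> P l" for j l a b
    using conjunct1[OF conjunct2[OF conjunct2[OF conjunct2[OF conjunct2[OF F]]]]] that by blast
  have Qs: "\<exists>l<r. l \<noteq> p \<and> e \<inter> P l = {} \<and>
        (\<forall>y\<in>e. {x, y} \<in> E \<and> (\<forall>j<r. j \<noteq> p \<longrightarrow> j \<noteq> l \<longrightarrow> (\<forall>a\<in>P j. {y, a} \<in> E)))" if "e \<in> Q" for e
    using F that by simp
  have neq: "a \<noteq> b" if "{a, b} \<in> E" for a b using edgeD[OF E that] by blast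
  have finU: "finite ?U" using I H unfolding simple_graph_def by blast
  have "\<forall>j. \<exists>\<psi>. j < r \<and> j \<noteq> p \<longrightarrow> \<psi> ` ?U \<subseteq> P j \<and> inj_on \<psi> ?U"
  proof
    fix j
    show "\<exists>\<psi>. j < r \<and> j \<noteq> p \<longrightarrow> \<psi> ` ?U \<subseteq> P j \<and> inj_on \<psi> ?U"
    proof (cases "j < r \<and> j \<noteq> p")
      case True
      then have "finite (P j)" "card ?U \<le> card (P j)" using P[of j] s by auto
      then show ?thesis using card_le_inj[OF finU] by blast
    qed blast
  qed
  from choice[OF this] obtain \<psi> where "\<forall>j. j < r \<and> j \<noteq> p \<longrightarrow> \<psi> j ` ?U \<subseteq> P j \<and> inj_on (\<psi> j) ?U"
    ..
  then have \<psi>: "\<And>j u. j < r \<Longrightarrow> j \<noteq> p \<Longrightarrow> u \<in> ?U \<Longrightarrow> \<psi> j u \<in> P j"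
    and \<psi>_inj: "\<And>j. j < r \<Longrightarrow> j \<noteq> p \<Longrightarrow> inj_on (\<psi> j) ?U"
    by auto
  \<comment> \<open>Fillers of different classes are adjacent and therefore distinct; within a class
    the injection decides.\<close>
  have \<psi>_eq: "u = w" if "j < r" "j \<noteq> p" "l < r" "l \<noteq> p" "u \<in> ?U" "w \<in> ?U" "\<psi> j u = \<psi> l w" for j l u w
  proof (cases "l = j")
    case True
    then show ?thesis using that \<psi>_inj[of j] by (auto dest: inj_onD)
  next
    case False
    have "{\<psi> j u, \<psi> l w} \<in> E" by (rule PP[OF that(1-4) False \<psi>[OF that(1,2,5)] \<psi>[OF that(3,4,6)]])
    then show ?thesis using neq that(7) by blast
  qed
  \<comment> \<open>The disjoint sum keeps vertex seeds and edge seeds apart; \<open>T\<close> below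
    turns a seed into the set of vertices it occupies.\<close>
  have "\<exists>\<sigma>. \<sigma> ` I \<subseteq> Y <+> Q \<and> inj_on \<sigma> I"
    by (rule card_le_inj) (use I Y Q card in \<open>simp_all add: card_Plus\<close>)
  then obtain \<sigma> where \<sigma>: "\<And>i. i \<in> I \<Longrightarrow> \<sigma> i \<in> Y <+> Q" "inj_on \<sigma> I" by blast
  define T where "T = case_sum (\<lambda>y. {y}) (\<lambda>e :: 'v set. e)"
  have T_dis: "T (\<sigma> i) \<inter> T (\<sigma> j) = {}" if "i \<in> I" "j \<in> I" "i \<noteq> j" for i j
  proof -
    have ne: "\<sigma> i \<noteq> \<sigma> j" using \<sigma>(2) that by (auto dest: inj_onD)
    have QQ: "d \<inter> e = {}" if "d \<in> Q" "e \<in> Q" "d \<noteq> e" for d e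
      using Q(3) that by (simp add: disjoint_def)
    have YQ: "y \<notin> e" if "y \<in> Y" "e \<in> Q" for y e using Q(4) that by blast
    show ?thesis
      using \<sigma>(1)[OF that(1)] \<sigma>(1)[OF that(2)]
      by (elim PlusE) (use ne QQ YQ in \<open>simp_all add: T_def\<close>)
  qed
  have xT: "{x, t} \<in> E" if i: "i \<in> I" "t \<in> T (\<sigma> i)" for i t
    using \<sigma>(1)[OF i(1)]
  proof (rule PlusE)
    fix e assume e: "e \<in> Q" "\<sigma> i = Inr e"
    then show ?thesis using Qs[OF e(1)] i(2) by (auto simp: T_def)
  qed (use Y(2) i(2) in \<open>simp add: T_def\<close>)
  have T_fill: "t \<noteq> a" if i: "i \<in> I" "t \<in> T (\<sigma> i)" and j: "j < r" "j \<noteq> p" "a \<in> P j" for i t j a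
    using \<sigma>(1)[OF i(1)]
  proof (rule PlusE)
    fix y assume "y \<in> Y" "\<sigma> i = Inl y"
    then show ?thesis using YP[OF j(1,2) _ j(3)] i(2) neq by (force simp: T_def)
  next
    fix e assume e: "e \<in> Q" "\<sigma> i = Inr e"
    then have te: "t \<in> e" using i(2) by (simp add: T_def)
    obtain l where l: "e \<inter> P l = {}" "\<forall>j<r. j \<noteq> p \<longrightarrow> j \<noteq> l \<longrightarrow> (\<forall>a\<in>P j. {t, a} \<in> E)"
      using Qs[OF e(1)] te by blast
    show ?thesis
    proof (cases "j = l")
      case True
      then show ?thesis using l(1) te j(3) by blast
    next
      case False
      then show ?thesis using l(2) j neq by blast
    qed
  qed
  have blade: "\<exists>h. (\<forall>u\<in>verts (H i). h u \<in> T (\<sigma> i) \<or> (\<exists>j<r. j \<noteq> p \<and> h u = \<psi> j u)) \<and>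
      inj_on h (verts (H i)) \<and> (\<forall>e\<in>edges (H i). h ` e \<in> E)" if i: "i \<in> I" for i
  proof -
    have Hi: "simple_graph (H i)" "edge_critical (H i)" "chromatic_number (H i) = r" using H[OF i] by auto
    obtain a b g where abg: "{a, b} \<in> edges (H i)" "a \<noteq> b" "a \<in> verts (H i)" "b \<in> verts (H i)"
      "g ` verts (H i) \<subseteq> {..<r - 1}" "g a = g b"
      "\<And>x y. {x, y} \<in> edges (H i) \<Longrightarrow> {x, y} \<noteq> {a, b} \<Longrightarrow> g x \<noteq> g y"
      using edge_critical_coloring[OF Hi(1,2)] Hi(3) by metis
    have ga: "g a < r - 1" using abg(3,5) by auto
    have VU: "verts (H i) \<subseteq> ?U" using i by blast
    have EH: "edges (H i) \<subseteq> [verts (H i)]\<^bsup>2\<^esup>" using Hi(1) unfolding simple_graph_def by blast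
    show ?thesis
      using \<sigma>(1)[OF i]
    proof (rule PlusE)
      fix y assume y: "y \<in> Y" "\<sigma> i = Inl y"
      have "\<exists>l<r. l \<noteq> p" using r p by (intro exI[of _ "if p = 0 then 1 else 0"]) auto
      then obtain l where "l < r" "l \<noteq> p" by blast
      from color_map[OF p this ga] obtain \<phi> where
        \<phi>: "inj_on \<phi> {..<r - 1}" "\<phi> ` {..<r - 1} \<subseteq> {..<r} - {p}" by metis
      have \<phi>r: "\<phi> (g u) < r" "\<phi> (g u) \<noteq> p" if "u \<in> verts (H i)" for u
        using \<phi>(2) abg(5) that by blast+
      \<comment> \<open>Only the end \<open>a\<close> goes to the seed. All edges avoiding
        \<open>a\<close> join different colours, and \<open>y\<close> is joined to every filler, so
        all edges are preserved.\<close>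
      define h where "h u = (if u = a then y else \<psi> (\<phi> (g u)) u)" for u
      have yT: "y \<in> T (\<sigma> i)" using y by (simp add: T_def)
      have hP: "\<psi> (\<phi> (g u)) u \<in> P (\<phi> (g u))" if "u \<in> verts (H i)" for u
        using \<psi>[OF \<phi>r[OF that]] that VU by blast
      have "inj_on h (verts (H i))"
      proof (rule inj_onI)
        fix u w assume uw: "u \<in> verts (H i)" "w \<in> verts (H i)" "h u = h w"
        have "u = w" if "\<psi> (\<phi> (g u)) u = \<psi> (\<phi> (g w)) w"
          using \<psi>_eq[OF \<phi>r[OF uw(1)] \<phi>r[OF uw(2)] _ _ that] uw(1,2) VU by blast
        then show "u = w"
          using uw(3) T_fill[OF i yT \<phi>r[OF uw(1)] hP[OF uw(1)]] T_fill[OF i yT \<phi>r[OF uw(2)] hP[OF uw(2)]]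
          unfolding h_def by (auto split: if_splits)
      qed
      moreover have "h ` e \<in> E" if e: "e \<in> edges (H i)" for e
      proof -
        have adj: "{y, \<psi> (\<phi> (g u)) u} \<in> E" if "u \<in> verts (H i)" for u
          using YP[OF \<phi>r[OF that] y(1) hP[OF that]] .
        obtain u w where uw: "e = {u, w}" "u \<in> verts (H i)" "w \<in> verts (H i)" "u \<noteq> w"
          using e EH by (meson nsets2_E subsetD)
        consider "u = a" | "w = a" | "u \<noteq> a" "w \<noteq> a" by blast
        then show ?thesis
        proof cases
          case 1
          then show ?thesis using adj[OF uw(3)] uw by (auto simp: h_def insert_commute)
        next
          case 2
          then show ?thesis using adj[OF uw(2)] uw by (simp add: h_def insert_commute)
        next
          case 3
          then have "{u, w} \<noteq> {a, b}" by (auto simp: doubleton_eq_iff)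
          then have "g u \<noteq> g w" using abg(7) e uw(1) by blast
          then have "\<phi> (g w) \<noteq> \<phi> (g u)" using \<phi>(1) abg(5) uw by (auto dest!: inj_onD)
          then have "{\<psi> (\<phi> (g u)) u, \<psi> (\<phi> (g w)) w} \<in> E"
            using PP[OF \<phi>r[OF uw(2)] \<phi>r[OF uw(3)]] hP uw by blast
          then show ?thesis using 3 uw(1) by (simp add: h_def)
        qed
      qed
      moreover have "\<forall>u\<in>verts (H i). h u \<in> T (\<sigma> i) \<or> (\<exists>j<r. j \<noteq> p \<and> h u = \<psi> j u)"
        using yT \<phi>r unfolding h_def by auto
      ultimately show ?thesis by blast
    next
      fix q assume q: "q \<in> Q" "\<sigma> i = Inr q"
      obtain l where l: "l < r" "l \<noteq> p"
        "\<forall>y\<in>q. {x, y} \<in> E \<and> (\<forall>j<r. j \<noteq> p \<longrightarrow> j \<noteq> l \<longrightarrow> (\<forall>a\<in>P j. {y, a} \<in> E))"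
        using Qs[OF q(1)] by blast
      from color_map[OF p l(1,2) ga] obtain \<phi> where
        \<phi>: "inj_on \<phi> {..<r - 1}" "\<phi> ` {..<r - 1} \<subseteq> {..<r} - {p}" "\<phi> (g a) = l" by metis
      have \<phi>r: "\<phi> (g u) < r" "\<phi> (g u) \<noteq> p" if "u \<in> verts (H i)" for u
        using \<phi>(2) abg(5) that by blast+
      have qE: "q \<in> E" using q Q(2) by blast
      then obtain c d where cd: "q = {c, d}" "c \<noteq> d" using E by (meson nsets2_E subsetD)
      \<comment> \<open>Both ends of the critical edge go to the seed edge. Their colour is mapped
        to \<open>l\<close>, the one class of fillers to which the seed need not be joined; no edge
        of the graph asks for such an adjacency.\<close>
      define h where "h u = (if u = a then c else if u = b then d else \<psi> (\<phi> (g u)) u)" for u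
      have cT: "c \<in> T (\<sigma> i)" "d \<in> T (\<sigma> i)" using q cd by (simp_all add: T_def)
      have hP: "\<psi> (\<phi> (g u)) u \<in> P (\<phi> (g u))" if "u \<in> verts (H i)" for u
        using \<psi>[OF \<phi>r[OF that]] that VU by blast
      have "inj_on h (verts (H i))"
      proof (rule inj_onI)
        fix u w assume uw: "u \<in> verts (H i)" "w \<in> verts (H i)" "h u = h w"
        have "u = w" if "\<psi> (\<phi> (g u)) u = \<psi> (\<phi> (g w)) w"
          using \<psi>_eq[OF \<phi>r[OF uw(1)] \<phi>r[OF uw(2)] _ _ that] uw(1,2) VU by blast
        then show "u = w"
          using uw(3) T_fill[OF i cT(1) \<phi>r[OF uw(1)] hP[OF uw(1)]] T_fill[OF i cT(1) \<phi>r[OF uw(2)] hP[OF uw(2)]]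
            T_fill[OF i cT(2) \<phi>r[OF uw(1)] hP[OF uw(1)]] T_fill[OF i cT(2) \<phi>r[OF uw(2)] hP[OF uw(2)]]
            cd(2)
          unfolding h_def by (auto split: if_splits)
      qed
      moreover have "h ` e \<in> E" if e: "e \<in> edges (H i)" for e
      proof -
        have adj: "{t, \<psi> (\<phi> (g u)) u} \<in> E" if "u \<in> verts (H i)" "g u \<noteq> g a" "t \<in> q" for u t
        proof -
          have "\<phi> (g u) \<noteq> l" using \<phi>(1,3) abg(5) that ga by (auto dest!: inj_onD)
          then show ?thesis using l(3) that(3) \<phi>r[OF that(1)] hP[OF that(1)] by blast
        qed
        obtain u w where uw: "e = {u, w}" "u \<in> verts (H i)" "w \<in> verts (H i)" "u \<noteq> w"
          using e EH by (meson nsets2_E subsetD)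
        have half: "{h u, h w} \<in> E"
          if "{u, w} \<in> edges (H i)" "u \<in> {a, b}" "w \<notin> {a, b}" "w \<in> verts (H i)" for u w
        proof -
          have "g u \<noteq> g w" using abg(7)[OF that(1)] that(3) by (auto simp: doubleton_eq_iff)
          then have "g w \<noteq> g a" using that(2) abg(6) by auto
          then show ?thesis using adj[OF that(4)] that(2,3) cd(1) unfolding h_def by auto
        qed
        consider "{u, w} = {a, b}" | "u \<in> {a, b}" "w \<notin> {a, b}" | "w \<in> {a, b}" "u \<notin> {a, b}"
          | "u \<notin> {a, b}" "w \<notin> {a, b}" using uw(4) by auto
        then show ?thesis
        proof cases
          case 1
          then have "h ` e = {c, d}" using uw(1) abg(2) by (auto simp: h_def)
          then show ?thesis using qE cd by simp
        next
          case 2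
          then show ?thesis using half[of u w] e uw by simp
        next
          case 3
          then show ?thesis using half[of w u] e uw by (simp add: insert_commute)
        next
          case 4
          then have "{u, w} \<noteq> {a, b}" by (auto simp: doubleton_eq_iff)
          then have "g u \<noteq> g w" using abg(7) e uw(1) by blast
          then have "\<phi> (g w) \<noteq> \<phi> (g u)" using \<phi>(1) abg(5) uw by (auto dest!: inj_onD)
          then have "{\<psi> (\<phi> (g u)) u, \<psi> (\<phi> (g w)) w} \<in> E"
            using PP[OF \<phi>r[OF uw(2)] \<phi>r[OF uw(3)]] hP uw by blast
          then show ?thesis using 4 uw(1) by (simp add: h_def)
        qed
      qed
      moreover have "\<forall>u\<in>verts (H i). h u \<in> T (\<sigma> i) \<or> (\<exists>j<r. j \<noteq> p \<and> h u = \<psi> j u)"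
        using cT \<phi>r unfolding h_def by auto
      ultimately show ?thesis by blast
    qed
  qed
  obtain h where h: "\<And>i u. i \<in> I \<Longrightarrow> u \<in> verts (H i) \<Longrightarrow> h i u \<in> T (\<sigma> i) \<or> (\<exists>j<r. j \<noteq> p \<and> h i u = \<psi> j u)"
    "\<And>i. i \<in> I \<Longrightarrow> inj_on (h i) (verts (H i))"
    "\<And>i e. i \<in> I \<Longrightarrow> e \<in> edges (H i) \<Longrightarrow> h i ` e \<in> E"
  proof -
    have "\<forall>i\<in>I. \<exists>h. (\<forall>u\<in>verts (H i). h u \<in> T (\<sigma> i) \<or> (\<exists>j<r. j \<noteq> p \<and> h u = \<psi> j u)) \<and>
      inj_on h (verts (H i)) \<and> (\<forall>e\<in>edges (H i). h ` e \<in> E)" using blade by blast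
    from bchoice[OF this] show ?thesis using that by blast
  qed
  have "\<forall>u\<in>?U. \<exists>i. i \<in> I \<and> u \<in> verts (H i)" by blast
  from bchoice[OF this] obtain own where "\<forall>u\<in>?U. own u \<in> I \<and> u \<in> verts (H (own u))" ..
  then have own: "own u \<in> I \<and> u \<in> verts (H (own u))" if "u \<in> ?U" for u using that by (rule bspec)
  have own_eq: "own u = i" if "i \<in> I" "u \<in> verts (H i)" for i u
    using own[of u] that dis unfolding disjoint_family_on_def by blast
  define f where "f u = (if u = v then x else h (own u) u)" for u
  have xh: "{x, h i u} \<in> E" if "i \<in> I" "u \<in> verts (H i)" for i u
    using h(1)[OF that]
  proof
    assume "h i u \<in> T (\<sigma> i)"
    then show ?thesis using xT that(1) by blast
  next
    assume "\<exists>j<r. j \<noteq> p \<and> h i u = \<psi> j u"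
    then show ?thesis using xP \<psi> that by fastforce
  qed
  have h_neq: "h i u \<noteq> h j w" if ij: "i \<in> I" "j \<in> I" "i \<noteq> j" and u: "u \<in> verts (H i)" and w: "w \<in> verts (H j)"
    for i j u w
  proof
    assume eq: "h i u = h j w"
    have uw: "u \<in> ?U" "w \<in> ?U" "u \<noteq> w" using ij u w dis unfolding disjoint_family_on_def by blast+
    show False
      using h(1)[OF ij(1) u] h(1)[OF ij(2) w]
    proof (elim disjE exE conjE)
      assume "h i u \<in> T (\<sigma> i)" "h j w \<in> T (\<sigma> j)"
      then show False using T_dis[OF ij] eq by force
    next
      fix l assume "h i u \<in> T (\<sigma> i)" "l < r" "l \<noteq> p" "h j w = \<psi> l w"
      then show False using T_fill[OF ij(1)] \<psi> uw(2) eq by metis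
    next
      fix l assume "h j w \<in> T (\<sigma> j)" "l < r" "l \<noteq> p" "h i u = \<psi> l u"
      then show False using T_fill[OF ij(2)] \<psi> uw(1) eq by metis
    next
      fix l m assume "l < r" "l \<noteq> p" "h i u = \<psi> l u" "m < r" "m \<noteq> p" "h j w = \<psi> m w"
      then show False using \<psi>_eq uw eq by metis
    qed
  qed
  have "inj_on f (verts (suspension H I v))"
  proof (rule inj_onI)
    fix u w assume uw: "u \<in> verts (suspension H I v)" "w \<in> verts (suspension H I v)" "f u = f w"
    have x_ne: "x \<noteq> h (own u) u" if "u \<in> ?U" for u
      using neq[OF xh] own[OF that] by blast
    have inU: "u = v \<or> u \<in> ?U" "w = v \<or> w \<in> ?U" using uw by (auto simp: suspension_def)
    show "u = w"
    proof (cases "u = v \<or> w = v")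
      case True
      then show ?thesis using inU uw(3) x_ne[of u] x_ne[of w] unfolding f_def by (auto split: if_splits)
    next
      case False
      then have U: "u \<in> ?U" "w \<in> ?U" "h (own u) u = h (own w) w" using inU uw(3) by (auto simp: f_def)
      then have "own u = own w" using h_neq own by metis
      then show ?thesis using h(2) own U by (metis inj_onD)
    qed
  qed
  moreover have "f ` e \<in> E" if e: "e \<in> edges (suspension H I v)" for e
  proof -
    consider i where "i \<in> I" "e \<in> edges (H i)" | u where "u \<in> ?U" "e = {v, u}"
      using e by (auto simp: suspension_def)
    then show ?thesis
    proof cases
      case 1
      then have "e \<subseteq> verts (H i)" using H[OF 1(1)] unfolding simple_graph_def nsets_def by blast
      then have "f ` e = h i ` e"
        using own_eq[OF 1(1)] v 1(1) unfolding f_def by (intro image_cong) auto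
      then show ?thesis using h(3) 1 by simp
    next
      case 2
      then have "u \<noteq> v" using v by blast
      then have "f ` e = {x, h (own u) u}" using 2(2) by (auto simp: f_def)
      then show ?thesis using xh own[OF 2(1)] by simp
    qed
  qed
  ultimately show ?thesis by blast
qed

section \<open>The extremal construction\<close>

lemma card_pairs: "finite A \<Longrightarrow> card ([A]\<^bsup>2\<^esup>) = card A * (card A - 1) div 2"
proof -
  assume "finite A"
  then have "{B. B \<subseteq> A \<and> card B = 2} = [A]\<^bsup>2\<^esup>"
    by (auto simp: nsets_def intro: finite_subset)
  then show ?thesis using n_subsets[OF \<open>finite A\<close>, of 2] by (simp add: choose_two)
qed

lemma nbrs_Un: "nbrs (A \<union> B) x = nbrs A x \<union> nbrs B x"
  by (auto simp: nbrs_def)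

text \<open>For odd \<open>k\<close> two disjoint complete graphs on \<open>k\<close> vertices. For
  even \<open>k\<close> a graph on \<open>2 * k - 1\<close> vertices, so that no matching has
  \<open>k\<close> edges: the left side has \<open>k - 1\<close> vertices of degree
  \<open>k - 1\<close>, and a partial matching on the right side fills up degrees.\<close>

lemma extremal_inner_graph:
  assumes k: "k \<ge> 1"
  shows "\<exists>E \<subseteq> [{..<2 * k}]\<^bsup>2\<^esup>. card E = excess k \<and> (\<forall>x. card (nbrs E x) < k) \<and>
    (\<forall>Q\<subseteq>E. disjoint Q \<longrightarrow> card Q < k)"
proof (cases "odd k")
  case True
  let ?A = "{..<k}" and ?B = "{k..<2 * k}"
  let ?E = "[?A]\<^bsup>2\<^esup> \<union> [?B]\<^bsup>2\<^esup>"
  have sub: "?E \<subseteq> [{..<2 * k}]\<^bsup>2\<^esup>"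
    by (intro Un_least nsets_mono) auto
  have "[?A]\<^bsup>2\<^esup> \<inter> [?B]\<^bsup>2\<^esup> = {}"
  proof (rule equals0I)
    fix e assume "e \<in> [?A]\<^bsup>2\<^esup> \<inter> [?B]\<^bsup>2\<^esup>"
    then have "e \<subseteq> ?A \<inter> ?B" "card e = 2" by (auto simp: nsets_def)
    moreover have "?A \<inter> ?B = {}" by auto
    ultimately show False by auto
  qed
  then have "card ?E = card ([?A]\<^bsup>2\<^esup>) + card ([?B]\<^bsup>2\<^esup>)"
    by (intro card_Un_disjoint finite_imp_finite_nsets) auto
  also have "\<dots> = 2 * (k * (k - 1) div 2)" using card_pairs[of ?A] card_pairs[of ?B] by simp
  also have "\<dots> = k * (k - 1)" using True by simp
  finally have cardE: "card ?E = excess k" using True by (simp add: excess_def)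
  have deg: "card (nbrs ?E x) < k" for x
  proof (cases "x < k")
    case True
    then have "nbrs ?E x \<subseteq> ?A - {x}"
      unfolding subset_iff nbrs_iff Un_iff doubleton_in_nsets_2 by auto
    then have "card (nbrs ?E x) \<le> card (?A - {x})" by (rule card_mono[rotated]) simp
    then show ?thesis using True by simp
  next
    case False
    then have nb: "nbrs ?E x \<subseteq> ?B - {x}"
      unfolding subset_iff nbrs_iff Un_iff doubleton_in_nsets_2 by auto
    show ?thesis
    proof (cases "x < 2 * k")
      case True
      have "card (nbrs ?E x) \<le> card (?B - {x})" using nb by (rule card_mono[rotated]) simp
      then show ?thesis using True False k by simp
    next
      case out: False
      then have "nbrs ?E x = {}" using False by auto
      then show ?thesis using k by simp
    qed
  qed
  have "card Q < k" if Q: "Q \<subseteq> ?E" "disjoint Q" for Q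
  proof -
    have half: "card (Q \<inter> [C]\<^bsup>2\<^esup>) \<le> (k - 1) div 2" if C: "finite C" "card C = k" for C :: "nat set"
    proof -
      have "card (\<Union>(Q \<inter> [C]\<^bsup>2\<^esup>)) = 2 * card (Q \<inter> [C]\<^bsup>2\<^esup>)"
        by (rule card_Union_matching[OF C(1)]) (use Q(2) in \<open>auto intro: pairwise_subset\<close>)
      moreover have "card (\<Union>(Q \<inter> [C]\<^bsup>2\<^esup>)) \<le> card C"
        by (rule card_mono[OF C(1)]) (auto simp: nsets_def)
      ultimately show ?thesis using C(2) \<open>odd k\<close> by presburger
    qed
    have "Q = (Q \<inter> [?A]\<^bsup>2\<^esup>) \<union> (Q \<inter> [?B]\<^bsup>2\<^esup>)" using Q(1) by auto
    then have "card Q \<le> card (Q \<inter> [?A]\<^bsup>2\<^esup>) + card (Q \<inter> [?B]\<^bsup>2\<^esup>)" by (metis card_Un_le)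
    also have "\<dots> \<le> (k - 1) div 2 + (k - 1) div 2"
      by (intro add_mono half) auto
    finally show ?thesis using k by linarith
  qed
  then show ?thesis using sub cardE deg by blast
next
  case False
  then obtain j where j: "k = 2 * j" by auto
  then have j1: "j \<ge> 1" using k by simp
  \<comment> \<open>\<open>E1\<close> is complete bipartite between \<open>k - 1\<close> and
    \<open>k\<close> vertices without the pairs of equal index. Thus the right vertices other than
    the last have degree \<open>k - 2\<close> there, and \<open>E2\<close> matches
    \<open>2 * (j - 1)\<close> of them.\<close>
  define S where "S = (SIGMA i:{..<k - 1}. {..<k} - {i})"
  define E1 where "E1 = (\<lambda>(i, t). {i, k - 1 + t}) ` S"
  define E2 where "E2 = (\<lambda>i. {k - 1 + 2 * i, k + 2 * i}) ` {..<j - 1}"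
  have S: "(i, t) \<in> S \<longleftrightarrow> i < k - 1 \<and> t < k \<and> t \<noteq> i" for i t by (auto simp: S_def)
  have sub: "E1 \<union> E2 \<subseteq> [{..<2 * k - 1}]\<^bsup>2\<^esup>"
  proof
    fix e assume "e \<in> E1 \<union> E2"
    then consider i t where "(i, t) \<in> S" "e = {i, k - 1 + t}"
      | i where "i < j - 1" "e = {k - 1 + 2 * i, k + 2 * i}"
      unfolding E1_def E2_def by auto
    then show "e \<in> [{..<2 * k - 1}]\<^bsup>2\<^esup>"
      using j j1 by cases (auto simp: S)
  qed
  have fin: "finite E1" "finite E2" "finite S" unfolding E1_def E2_def S_def by auto
  have "card E1 = card S" unfolding E1_def
    by (rule card_image) (auto simp: inj_on_def S doubleton_eq_iff)
  also have "\<dots> = (\<Sum>i<k - 1. card ({..<k} - {i}))" unfolding S_def by (rule card_SigmaI) auto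
  also have "\<dots> = (\<Sum>i<k - 1. k - 1)" by (rule sum.cong) auto
  finally have "card E1 = (k - 1) * (k - 1)" by simp
  moreover have "card E2 = j - 1"
  proof -
    have "card E2 = card {..<j - 1}" unfolding E2_def
      by (rule card_image) (auto simp: inj_on_def doubleton_eq_iff)
    then show ?thesis by simp
  qed
  moreover have "E1 \<inter> E2 = {}" unfolding E1_def E2_def by (auto simp: S doubleton_eq_iff)
  ultimately have "card (E1 \<union> E2) = (k - 1) * (k - 1) + (j - 1)"
    using fin by (simp add: card_Un_disjoint)
  also have "\<dots> = excess k"
  proof -
    obtain i where "j = Suc i" using j1 by (cases j) auto
    then show ?thesis using j by (simp add: excess_def algebra_simps)
  qed
  finally have cardE: "card (E1 \<union> E2) = excess k" .
  have E1_iff: "{x, y} \<in> E1 \<longleftrightarrow> (x, y + 1 - k) \<in> S \<and> k \<le> y + 1 \<or> (y, x + 1 - k) \<in> S \<and> k \<le> x + 1" for x y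
  proof
    assume "{x, y} \<in> E1"
    then obtain i t where "(i, t) \<in> S" "{x, y} = {i, k - 1 + t}" unfolding E1_def by auto
    then show "(x, y + 1 - k) \<in> S \<and> k \<le> y + 1 \<or> (y, x + 1 - k) \<in> S \<and> k \<le> x + 1"
      using k by (auto simp: doubleton_eq_iff)
  next
    assume "(x, y + 1 - k) \<in> S \<and> k \<le> y + 1 \<or> (y, x + 1 - k) \<in> S \<and> k \<le> x + 1"
    then show "{x, y} \<in> E1"
    proof
      assume h: "(x, y + 1 - k) \<in> S \<and> k \<le> y + 1"
      then have "y = k - 1 + (y + 1 - k)" using k by simp
      then show ?thesis using h unfolding E1_def by (intro image_eqI[of _ _ "(x, y + 1 - k)"]) auto
    next
      assume h: "(y, x + 1 - k) \<in> S \<and> k \<le> x + 1"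
      then have "x = k - 1 + (x + 1 - k)" using k by simp
      then show ?thesis using h unfolding E1_def
        by (intro image_eqI[of _ _ "(y, x + 1 - k)"]) (auto simp: insert_commute)
    qed
  qed
  have deg: "card (nbrs (E1 \<union> E2) x) < k" for x
  proof (cases "x < k - 1")
    case True
    have "nbrs (E1 \<union> E2) x \<subseteq> (\<lambda>t. k - 1 + t) ` ({..<k} - {x})"
    proof
      fix y assume "y \<in> nbrs (E1 \<union> E2) x"
      then have "{x, y} \<in> E1" using True by (auto simp: E2_def doubleton_eq_iff)
      then have "(x, y + 1 - k) \<in> S" "k \<le> y + 1" using True by (auto simp: E1_iff)
      then show "y \<in> (\<lambda>t. k - 1 + t) ` ({..<k} - {x})"
        using k by (intro image_eqI[of _ _ "y + 1 - k"]) (auto simp: S)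
    qed
    then have "card (nbrs (E1 \<union> E2) x) \<le> card ((\<lambda>t. k - 1 + t) ` ({..<k} - {x}))"
      by (rule card_mono[rotated]) simp
    also have "\<dots> \<le> card ({..<k} - {x})" by (rule card_image_le) simp
    finally show ?thesis using True by simp
  next
    case False
    define t where "t = x + 1 - k"
    have x: "x = k - 1 + t" using False k by (simp add: t_def)
    have nb1: "nbrs E1 x \<subseteq> {..<k - 1} - {t}"
      using False by (auto simp: E1_iff S x)
    show ?thesis
    proof (cases "t < k - 1")
      case True
      let ?p = "if even t then t + 1 else t - 1"
      have "nbrs E2 x \<subseteq> {k - 1 + ?p}"
      proof
        fix y assume "y \<in> nbrs E2 x"
        then obtain i where "{k - 1 + t, y} = {k - 1 + 2 * i, k + 2 * i}" by (auto simp: E2_def x)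
        then have "t = 2 * i \<and> y = k + 2 * i \<or> t = 2 * i + 1 \<and> y = k - 1 + 2 * i"
          using k by (auto simp: doubleton_eq_iff)
        then show "y \<in> {k - 1 + ?p}" using k by auto
      qed
      then have "nbrs (E1 \<union> E2) x \<subseteq> insert (k - 1 + ?p) ({..<k - 1} - {t})"
        using nb1 unfolding nbrs_Un by auto
      then have "card (nbrs (E1 \<union> E2) x) \<le> card (insert (k - 1 + ?p) ({..<k - 1} - {t}))"
        by (rule card_mono[rotated]) simp
      also have "\<dots> \<le> Suc (card ({..<k - 1} - {t}))" by (rule card_insert_le_m1) auto
      also have "\<dots> = k - 1" using True by simp
      finally show ?thesis using k by linarith
    next
      case False
      have "nbrs E2 x = {}"
      proof (rule equals0I)
        fix y assume "y \<in> nbrs E2 x"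
        then obtain i where i: "i < j - 1" "{k - 1 + t, y} = {k - 1 + 2 * i, k + 2 * i}"
          by (auto simp: E2_def x)
        then have "k - 1 + t = k - 1 + 2 * i \<or> k - 1 + t = k + 2 * i"
          by (auto simp: doubleton_eq_iff)
        then show False using False i(1) j by auto
      qed
      then have "nbrs (E1 \<union> E2) x \<subseteq> {..<k - 1}" using nb1 unfolding nbrs_Un by auto
      then have "card (nbrs (E1 \<union> E2) x) \<le> card {..<k - 1}" by (rule card_mono[rotated]) simp
      then show ?thesis using k by simp
    qed
  qed
  have "card Q < k" if Q: "Q \<subseteq> E1 \<union> E2" "disjoint Q" for Q
  proof -
    have Q2: "Q \<subseteq> [{..<2 * k - 1}]\<^bsup>2\<^esup>" using Q(1) sub by (rule subset_trans)
    have "card (\<Union>Q) = 2 * card Q"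
      by (rule card_Union_matching[OF _ Q2 Q(2)]) simp
    moreover have "card (\<Union>Q) \<le> card {..<2 * k - 1}"
      by (rule card_mono) (use Q2 in \<open>auto simp: nsets_def\<close>)
    ultimately show ?thesis using k by simp
  qed
  moreover have "[{..<2 * k - 1}]\<^bsup>2\<^esup> \<subseteq> [{..<2 * k}]\<^bsup>2\<^esup>" by (rule nsets_mono) auto
  ultimately show ?thesis using sub cardE deg by (intro exI[of _ "E1 \<union> E2"]) auto
qed

text \<open>If the centre lies in class 0, every blade meets that class, because
  \<open>r - 1\<close> independent classes cannot hold it; this gives \<open>k\<close> neighbours of
  the centre in \<open>D\<close>. Otherwise the independent class of the centre is closed to the
  blades, so each blade contains an edge of \<open>D\<close>, and these \<open>k\<close> edges are
  disjoint.\<close>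

lemma turan_plus_no_copy:
  fixes H :: "'i \<Rightarrow> 'a sgraph"
  assumes r: "r \<ge> 2" and D: "D \<subseteq> [{x. x < n \<and> x mod r = 0}]\<^bsup>2\<^esup>"
    and deg: "\<And>x. card (nbrs D x) < k" and mat: "\<And>Q. Q \<subseteq> D \<Longrightarrow> disjoint Q \<Longrightarrow> card Q < k"
    and I: "finite I" "card I = k"
    and H: "\<And>i. i \<in> I \<Longrightarrow> simple_graph (H i) \<and> chromatic_number (H i) = r"
    and dis: "disjoint_family_on (\<lambda>i. verts (H i)) I" and v: "v \<notin> (\<Union>i\<in>I. verts (H i))"
  shows "\<not> contains_copy \<lparr>verts = {..<n}, edges = edges (turan_graph r n) \<union> D\<rparr> (suspension H I v)"
proof
  let ?U = "\<Union>i\<in>I. verts (H i)" and ?G = "edges (turan_graph r n) \<union> D"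
  assume "contains_copy \<lparr>verts = {..<n}, edges = ?G\<rparr> (suspension H I v)"
  then obtain f where f: "inj_on f (insert v ?U)"
    "\<And>e. e \<in> edges (suspension H I v) \<Longrightarrow> f ` e \<in> ?G"
    unfolding contains_copy_def embedding_def by (auto simp: suspension_def)
  have T: "x mod r \<noteq> y mod r" if "{x, y} \<in> edges (turan_graph r n)" for x y
    using that by (auto simp: turan_graph_def doubleton_eq_iff)
  have G_D: "{x, y} \<in> D \<and> x mod r = 0" if "{x, y} \<in> ?G" "x mod r = y mod r" for x y
  proof -
    have "{x, y} \<in> D" using that T by blast
    then show ?thesis using edgeD(1)[OF D, of x y] by simp
  qed
  have edge_H: "{f x, f y} \<in> ?G" if "i \<in> I" "{x, y} \<in> edges (H i)" for i x y
    using f(2)[of "{x, y}"] that by (auto simp: suspension_def)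
  have edge_v: "{f v, f u} \<in> ?G" if "u \<in> ?U" for u
    using f(2)[of "{v, u}"] that by (auto simp: suspension_def)
  have sub_H: "x \<in> verts (H i)" "y \<in> verts (H i)" if "i \<in> I" "{x, y} \<in> edges (H i)" for i x y
    using edgeD(1,2)[of "edges (H i)" "verts (H i)" x y] H[OF that(1)] that(2)
    unfolding simple_graph_def by auto
  show False
  proof (cases "f v mod r = 0")
    case True
    have "\<exists>u\<in>verts (H i). f u mod r = 0" if i: "i \<in> I" for i
    proof (rule ccontr)
      assume no: "\<not> ?thesis"
      have "\<exists>x y. {x, y} \<in> edges (H i) \<and> f x mod r = f y mod r"
      proof (rule monochromatic_edge)
        show "simple_graph (H i)" using H[OF i] by simp
        show "(\<lambda>u. f u mod r) ` verts (H i) \<subseteq> {1..<r}" using no r by force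
        show "card {1..<r} < chromatic_number (H i)" using H[OF i] r by simp
      qed simp
      then obtain x y where xy: "{x, y} \<in> edges (H i)" "f x mod r = f y mod r" by blast
      then have "f x mod r = 0" using G_D edge_H[OF i xy(1)] by blast
      then show False using no sub_H(1)[OF i xy(1)] by auto
    qed
    then have "\<forall>i\<in>I. \<exists>u. u \<in> verts (H i) \<and> f u mod r = 0" by (simp add: Bex_def)
    from bchoice[OF this] obtain w where w: "\<forall>i\<in>I. w i \<in> verts (H i) \<and> f (w i) mod r = 0" ..
    have "inj_on (\<lambda>i. f (w i)) I"
    proof (rule inj_onI)
      fix i j assume ij: "i \<in> I" "j \<in> I" "f (w i) = f (w j)"
      have wi: "w i \<in> verts (H i)" "w j \<in> verts (H j)" using w ij by simp_all
      then have "w i \<in> insert v ?U" "w j \<in> insert v ?U" using ij by auto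
      then have "w i = w j" using inj_onD[OF f(1) ij(3)] by simp
      then show "i = j" using wi disjoint_family_onD[OF dis ij(1,2)] by auto
    qed
    moreover have "(\<lambda>i. f (w i)) ` I \<subseteq> nbrs D (f v)"
    proof
      fix z assume "z \<in> (\<lambda>i. f (w i)) ` I"
      then obtain i where i: "i \<in> I" "z = f (w i)" by blast
      then have "w i \<in> ?U" "z mod r = 0" using w by auto
      then have "{f v, z} \<in> ?G" using edge_v[of "w i"] i(2) by simp
      then show "z \<in> nbrs D (f v)" using G_D[of "f v" z] True \<open>z mod r = 0\<close> by simp
    qed
    moreover have "finite (nbrs D (f v))" by (rule finite_nbrs[OF _ D]) simp
    ultimately have "card I \<le> card (nbrs D (f v))" by (rule card_inj_on_le)
    then show False using deg[of "f v"] I(2) by simp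
  next
    case False
    have "\<exists>x y. {x, y} \<in> edges (H i) \<and> {f x, f y} \<in> D" if i: "i \<in> I" for i
    proof -
      have fvu: "f u mod r \<noteq> f v mod r" if "u \<in> verts (H i)" for u
        using G_D[of "f v" "f u"] edge_v[of u] False that i by force
      have "\<exists>x y. {x, y} \<in> edges (H i) \<and> f x mod r = f y mod r"
      proof (rule monochromatic_edge)
        show "simple_graph (H i)" using H[OF i] by simp
        show "(\<lambda>u. f u mod r) ` verts (H i) \<subseteq> {..<r} - {f v mod r}" using fvu r by auto
        show "card ({..<r} - {f v mod r}) < chromatic_number (H i)" using H[OF i] r by simp
      qed simp
      then show ?thesis using G_D edge_H[OF i] by blast
    qed
    then have "\<forall>i\<in>I. \<exists>e. e \<in> edges (H i) \<and> f ` e \<in> D" by fastforce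
    from bchoice[OF this] obtain e where e: "\<forall>i\<in>I. e i \<in> edges (H i) \<and> f ` e i \<in> D" ..
    have e_sub: "e i \<subseteq> verts (H i)" if "i \<in> I" for i
      using e H that unfolding simple_graph_def nsets_def by blast
    have dis_e: "f ` e i \<inter> f ` e j = {}" if "i \<in> I" "j \<in> I" "i \<noteq> j" for i j
    proof -
      have "e i \<inter> e j = {}"
        using e_sub[OF that(1)] e_sub[OF that(2)] dis that unfolding disjoint_family_on_def by blast
      moreover have "f ` (e i \<inter> e j) = f ` e i \<inter> f ` e j"
        by (rule inj_on_image_Int[OF f(1)]) (use e_sub that in blast)+
      ultimately show ?thesis by simp
    qed
    have ne: "f ` e i \<noteq> {}" if "i \<in> I" for i using e that D by (auto simp: nsets_def)
    have inj: "inj_on (\<lambda>i. f ` e i) I"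
    proof (rule inj_onI, rule ccontr)
      fix i j assume "i \<in> I" "j \<in> I" "f ` e i = f ` e j" "i \<noteq> j"
      then show False using dis_e[of i j] ne[of i] by simp
    qed
    have "card ((\<lambda>i. f ` e i) ` I) < k"
    proof (rule mat)
      show "(\<lambda>i. f ` e i) ` I \<subseteq> D" using e by auto
      show "disjoint ((\<lambda>i. f ` e i) ` I)"
        by (rule disjointI) (use dis_e in \<open>auto\<close>)
    qed
    then show False using card_image[OF inj] I(2) by simp
  qed
qed

lemma extremal_construction:
  assumes k: "k \<ge> 1" and r: "r \<ge> 2" and n: "n > 2 * k * r"
  obtains E where "E \<subseteq> [{..<n}]\<^bsup>2\<^esup>" "card E = turan_number r n + excess k" "E \<noteq> [{..<n}]\<^bsup>2\<^esup>"
    "\<And>(H :: nat \<Rightarrow> 'a sgraph) I v. finite I \<Longrightarrow> card I = k \<Longrightarrow>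
      (\<And>i. i \<in> I \<Longrightarrow> simple_graph (H i) \<and> chromatic_number (H i) = r) \<Longrightarrow>
      disjoint_family_on (\<lambda>i. verts (H i)) I \<Longrightarrow> v \<notin> (\<Union>i\<in>I. verts (H i)) \<Longrightarrow>
      \<not> contains_copy \<lparr>verts = {..<n}, edges = E\<rparr> (suspension H I v)"
proof -
  obtain D where D: "D \<subseteq> [{..<2 * k}]\<^bsup>2\<^esup>" "card D = excess k" "\<forall>x. card (nbrs D x) < k"
    "\<forall>Q\<subseteq>D. disjoint Q \<longrightarrow> card Q < k"
    using extremal_inner_graph[OF k] by blast
  \<comment> \<open>Multiplication by \<open>r\<close> carries the extremal graph into the residue
    class 0.\<close>
  define \<tau> where "\<tau> t = r * t" for t
  have inj: "inj \<tau>" using r by (auto simp: inj_def \<tau>_def)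
  define D' where "D' = (`) \<tau> ` D"
  have D'_iff: "{\<tau> x, \<tau> y} \<in> D' \<longleftrightarrow> {x, y} \<in> D" for x y
  proof
    assume "{\<tau> x, \<tau> y} \<in> D'"
    then obtain d where d: "d \<in> D" "\<tau> ` {x, y} = \<tau> ` d" by (auto simp: D'_def)
    then have "{x, y} = d" using inj by (simp only: inj_image_eq_iff)
    then show "{x, y} \<in> D" using d(1) by simp
  next
    assume "{x, y} \<in> D"
    then have "\<tau> ` {x, y} \<in> D'" unfolding D'_def by (rule imageI)
    then show "{\<tau> x, \<tau> y} \<in> D'" by simp
  qed
  have D'_range: "\<exists>x y. e = {\<tau> x, \<tau> y} \<and> {x, y} \<in> D" if e: "e \<in> D'" for e
  proof -
    obtain d where d: "d \<in> D" "e = \<tau> ` d" using e by (auto simp: D'_def)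
    then have "d \<in> [{..<2 * k}]\<^bsup>2\<^esup>" using D(1) by blast
    then obtain x y where "d = {x, y}" by (rule nsets2_E)
    then show ?thesis using d by auto
  qed
  have D'2: "D' \<subseteq> [{x. x < 2 * k * r \<and> x mod r = 0}]\<^bsup>2\<^esup>"
  proof
    fix e assume "e \<in> D'"
    then obtain x y where xy: "e = {\<tau> x, \<tau> y}" "{x, y} \<in> D" using D'_range by blast
    then show "e \<in> [{x. x < 2 * k * r \<and> x mod r = 0}]\<^bsup>2\<^esup>"
      using edgeD[OF D(1) xy(2)] r by (simp add: \<tau>_def mult.commute)
  qed
  have D'n: "D' \<subseteq> [{x. x < n \<and> x mod r = 0}]\<^bsup>2\<^esup>"
    by (rule subset_trans[OF D'2 nsets_mono]) (use n in auto)
  have finD: "finite D" by (rule finite_edges[OF _ D(1)]) simp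
  have deg: "card (nbrs D' x) < k" for x
  proof (cases "\<exists>t. x = \<tau> t")
    case True
    then obtain t where t: "x = \<tau> t" by blast
    have "nbrs D' x \<subseteq> \<tau> ` nbrs D t"
    proof
      fix y assume "y \<in> nbrs D' x"
      then have xy: "{x, y} \<in> D'" by simp
      then obtain a b where "{x, y} = {\<tau> a, \<tau> b}" using D'_range by blast
      then obtain u where "y = \<tau> u" by (auto simp: doubleton_eq_iff)
      then show "y \<in> \<tau> ` nbrs D t" using xy t D'_iff by auto
    qed
    then have "card (nbrs D' x) \<le> card (\<tau> ` nbrs D t)"
      by (rule card_mono[rotated]) (intro finite_imageI finite_nbrs[OF _ D(1)], simp)
    also have "\<dots> \<le> card (nbrs D t)" by (intro card_image_le finite_nbrs[OF _ D(1)]) simp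
    also have "\<dots> < k" using D(3) by blast
    finally show ?thesis .
  next
    case False
    have "nbrs D' x = {}"
    proof (rule equals0I)
      fix y assume "y \<in> nbrs D' x"
      then obtain a b where "{x, y} = {\<tau> a, \<tau> b}" using D'_range[of "{x, y}"] by auto
      then show False using False by (auto simp: doubleton_eq_iff)
    qed
    then show ?thesis using k by simp
  qed
  have mat: "card Q < k" if Q: "Q \<subseteq> D'" "disjoint Q" for Q
  proof -
    define R where "R = {d \<in> D. \<tau> ` d \<in> Q}"
    have RQ: "Q = (`) \<tau> ` R" using Q(1) unfolding R_def D'_def by auto
    have "disjoint R"
    proof (rule disjointI)
      fix a b assume ab: "a \<in> R" "b \<in> R" "a \<noteq> b"
      then have "\<tau> ` a \<noteq> \<tau> ` b" using inj by (simp add: inj_image_eq_iff)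
      then have "\<tau> ` a \<inter> \<tau> ` b = {}" using ab Q(2) by (auto simp: R_def disjoint_def)
      then show "a \<inter> b = {}" by auto
    qed
    then have "card R < k" using D(4) by (auto simp: R_def)
    moreover have "card Q \<le> card R" unfolding RQ
      by (rule card_image_le) (use finD in \<open>simp add: R_def\<close>)
    ultimately show ?thesis by simp
  qed
  let ?E = "edges (turan_graph r n) \<union> D'"
  have sub: "?E \<subseteq> [{..<n}]\<^bsup>2\<^esup>"
    using turan_edges_subset[of r n] D'n nsets_mono[of "{x. x < n \<and> x mod r = 0}" "{..<n}" 2] by auto
  have "edges (turan_graph r n) \<inter> D' = {}"
  proof (rule equals0I)
    fix e assume e: "e \<in> edges (turan_graph r n) \<inter> D'"
    then obtain x y where "e = {\<tau> x, \<tau> y}" using D'_range by blast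
    then show False using e by (auto simp: turan_graph_def \<tau>_def doubleton_eq_iff)
  qed
  moreover have "finite (edges (turan_graph r n))" by (rule finite_edges[OF _ turan_edges_subset]) simp
  ultimately have "card ?E = turan_number r n + card D'"
    unfolding turan_number_def by (intro card_Un_disjoint) (use finD in \<open>auto simp: D'_def\<close>)
  moreover have "card D' = excess k"
    unfolding D'_def D(2)[symmetric]
    by (rule card_image) (use inj in \<open>auto simp: inj_on_def inj_image_eq_iff\<close>)
  ultimately have card: "card ?E = turan_number r n + excess k" by simp
  \<comment> \<open>The vertex \<open>2 * k * r\<close> also has residue 0 but lies beyond the
    inserted graph. This nonedge ensures that a further colour is available for the edges outside
    \<open>?E\<close>.\<close>
  have "{0, 2 * k * r} \<notin> ?E"
  proof
    assume "{0, 2 * k * r} \<in> ?E"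
    then have "{0, 2 * k * r} \<in> D'" by (auto simp: turan_graph_def doubleton_eq_iff)
    then show False using edgeD(2)[OF D'2, of 0 "2 * k * r"] by simp
  qed
  moreover have "{0, 2 * k * r} \<in> [{..<n}]\<^bsup>2\<^esup>" using n k r by simp
  ultimately have "?E \<noteq> [{..<n}]\<^bsup>2\<^esup>" by blast
  with sub card show ?thesis
  proof (rule that)
    fix H :: "nat \<Rightarrow> 'a sgraph" and I v
    assume "finite I" "card I = k" "\<And>i. i \<in> I \<Longrightarrow> simple_graph (H i) \<and> chromatic_number (H i) = r"
      "disjoint_family_on (\<lambda>i. verts (H i)) I" "v \<notin> (\<Union>i\<in>I. verts (H i))"
    then show "\<not> contains_copy \<lparr>verts = {..<n}, edges = ?E\<rparr> (suspension H I v)"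
      by (intro turan_plus_no_copy[OF r D'n deg mat]) auto
  qed
qed

section \<open>Complete multipartite subgraphs\<close>

lemma card_fibers_le:
  assumes "finite X" "finite T" "f ` X \<subseteq> T" "\<And>y. y \<in> T \<Longrightarrow> card {x \<in> X. f x = y} \<le> m"
  shows "card X \<le> card T * m"
proof -
  have "(\<Sum>y\<in>T. sum (\<lambda>_. 1) {x \<in> X. f x = y}) = sum (\<lambda>_. 1 :: nat) X"
    by (rule sum.group[OF assms(1-3)])
  then have "card X = (\<Sum>y\<in>T. card {x \<in> X. f x = y})" by simp
  also have "\<dots> \<le> (\<Sum>y\<in>T. m)" by (rule sum_mono) (rule assms(4))
  finally show ?thesis by simp
qed

lemma sum_card_Int_nbrs:
  assumes "finite V" "E \<subseteq> [V]\<^bsup>2\<^esup>" "U \<subseteq> V"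
  shows "(\<Sum>x\<in>V. card (U \<inter> nbrs E x)) = (\<Sum>a\<in>U. card (nbrs E a))"
proof -
  have finU: "finite U" using assms finite_subset by blast
  have "card (U \<inter> nbrs E x) = (\<Sum>a\<in>U. if {x, a} \<in> E then 1 else 0)" for x
  proof -
    have "U \<inter> nbrs E x = {a \<in> U. {x, a} \<in> E}" by auto
    then show ?thesis using finU by (simp add: sum.If_cases Int_def)
  qed
  moreover have "card (nbrs E a) = (\<Sum>x\<in>V. if {x, a} \<in> E then 1 else 0)" for a
  proof -
    have "nbrs E a = {x \<in> V. {x, a} \<in> E}"
      using nbrs_subset[OF assms(2), of a] by (auto simp: nbrs_def insert_commute)
    then show ?thesis using assms(1) by (simp add: sum.If_cases Int_def)
  qed
  ultimately show ?thesis by (simp only: sum.swap[of _ U V])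
qed

text \<open>Disjointness of the classes need not be required: a common vertex of two classes would
  carry a loop.\<close>

definition multipartite :: "'v set set \<Rightarrow> nat set \<Rightarrow> nat \<Rightarrow> (nat \<Rightarrow> 'v set) \<Rightarrow> bool" where
  "multipartite E J m A \<longleftrightarrow> (\<forall>j\<in>J. finite (A j) \<and> card (A j) = m) \<and>
     (\<forall>j\<in>J. \<forall>l\<in>J. j \<noteq> l \<longrightarrow> (\<forall>a\<in>A j. \<forall>b\<in>A l. {a, b} \<in> E))"

lemma multipartite_disjoint:
  assumes "E \<subseteq> [V]\<^bsup>2\<^esup>" "multipartite E J m A" "j \<in> J" "l \<in> J" "j \<noteq> l"
  shows "A j \<inter> A l = {}"
proof (rule equals0I)
  fix x assume x: "x \<in> A j \<inter> A l"
  then have "{x, x} \<in> E" using assms(2-5) unfolding multipartite_def by blast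
  then show False using edgeD(3)[OF assms(1), of x x] by blast
qed

lemma card_multipartite:
  assumes "E \<subseteq> [V]\<^bsup>2\<^esup>" "multipartite E J m A" "finite J"
  shows "card (\<Union>j\<in>J. A j) = card J * m"
proof -
  have "card (\<Union>j\<in>J. A j) = (\<Sum>j\<in>J. card (A j))"
    by (rule card_UN_disjoint)
      (use assms multipartite_disjoint[OF assms(1,2)] in \<open>auto simp: multipartite_def\<close>)
  also have "\<dots> = (\<Sum>j\<in>J. m)" by (rule sum.cong) (use assms(2) in \<open>auto simp: multipartite_def\<close>)
  finally show ?thesis by simp
qed

text \<open>The bound is the increment of \<open>turan_number\<close> at the last of
  \<open>card V\<close> vertices; deleting a vertex of smaller degree increases the surplus over the
  Turan number.\<close>

definition turan_degree :: "nat \<Rightarrow> 'v set \<Rightarrow> 'v set set \<Rightarrow> bool" where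
  "turan_degree r V E \<longleftrightarrow> (\<forall>x\<in>V. card V - 1 - (card V - 1) div r \<le> card (nbrs E x))"

lemma turan_degree_real:
  assumes "turan_degree r V E" "x \<in> V" "r > 0" "finite V"
  shows "real (card (nbrs E x)) \<ge> real (card V) - real (card V) / r - 1"
proof -
  let ?n = "card V"
  have n1: "?n \<ge> 1" using assms(2,4) by (metis One_nat_def Suc_leI card_gt_0_iff empty_iff)
  have h: "(?n - 1) div r \<le> ?n - 1" by (rule div_le_dividend)
  have "real (?n - 1 - (?n - 1) div r) = real ?n - 1 - real ((?n - 1) div r)"
    by (simp only: of_nat_diff[OF h] of_nat_diff[OF n1] of_nat_1)
  moreover have "real ((?n - 1) div r) \<le> real (?n - 1) / real r" by (rule of_nat_div_le_of_nat)
  moreover have "real (?n - 1) / real r \<le> real ?n / real r" by (intro divide_right_mono) auto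
  moreover have "real (?n - 1 - (?n - 1) div r) \<le> real (card (nbrs E x))"
    using assms(1,2) unfolding turan_degree_def by (intro of_nat_mono) blast
  ultimately show ?thesis by linarith
qed

text \<open>The minimum degree case of the Erdos-Stone theorem: vertices sending many edges to all
  classes of a large complete \<open>s\<close>-partite graph are frequent, so many of them have the same
  neighbourhood there.\<close>

lemma multipartite_exists:
  fixes r :: nat
  assumes r: "r > 0"
  shows "s \<le> r \<Longrightarrow> \<exists>N. \<forall>(V :: 'v set) E. finite V \<longrightarrow> N \<le> card V \<longrightarrow> E \<subseteq> [V]\<^bsup>2\<^esup> \<longrightarrow>
    turan_degree r V E \<longrightarrow> (\<exists>A. multipartite E {..<s} m A \<and> (\<forall>j<s. A j \<subseteq> V))"
proof (induction s arbitrary: m)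
  case 0
  then show ?case by (simp add: multipartite_def)
next
  case (Suc s)
  \<comment> \<open>For \<open>s < r\<close> this leaves \<open>M - s * M / r\<close> at least
    \<open>2 * (m + 1)\<close>, so the average vertex sends clearly more than
    \<open>(s - 1) * M + m\<close> edges to the union of the \<open>s\<close> old classes when
    \<open>s > 0\<close>.\<close>
  define M where "M = 2 * r * (m + 1)"
  obtain N0 where N0: "\<And>(V :: 'v set) E. finite V \<Longrightarrow> N0 \<le> card V \<Longrightarrow> E \<subseteq> [V]\<^bsup>2\<^esup> \<Longrightarrow>
    turan_degree r V E \<Longrightarrow> \<exists>A. multipartite E {..<s} M A \<and> (\<forall>j<s. A j \<subseteq> V)"
    using Suc.IH[of M] Suc.prems by (meson Suc_leD)
  define N where "N = max N0 (s * M + (s * M + 1) * (2 ^ (s * M) * (m + 1) + 1))"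
  have "\<exists>A. multipartite E {..<Suc s} m A \<and> (\<forall>j<Suc s. A j \<subseteq> V)"
    if V: "finite V" "N \<le> card V" "E \<subseteq> [V]\<^bsup>2\<^esup>" "turan_degree r V E" for V :: "'v set" and E
  proof -
    let ?n = "card V"
    obtain A where A: "multipartite E {..<s} M A" "\<And>j. j < s \<Longrightarrow> A j \<subseteq> V"
      using N0[OF V(1) _ V(3,4)] V(2) unfolding N_def by auto
    let ?U = "\<Union>j<s. A j"
    have UV: "?U \<subseteq> V" using A(2) by auto
    have finU: "finite ?U" using UV V(1) by (rule finite_subset)
    have cU: "card ?U = s * M" using card_multipartite[OF V(3) A(1)] by simp
    have cA: "card (A j) = M" "finite (A j)" if "j < s" for j
      using A(1) that by (auto simp: multipartite_def)
    define X where "X = {x \<in> V. \<forall>j<s. m \<le> card (A j \<inter> nbrs E x)}"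
    have X: "X \<subseteq> V" "finite X" using V(1) by (auto simp: X_def)
    \<comment> \<open>A vertex outside \<open>X\<close> has fewer than \<open>m\<close> neighbours
      in some class. Counting the edges at \<open>?U\<close> from both sides shows that such
      vertices cannot dominate.\<close>
    have many: "real ?n - s * M \<le> card X * (real (s * M) + 1)"
    proof (cases "s = 0")
      case True
      then show ?thesis by (simp add: X_def)
    next
      case False
      have up: "real (card (?U \<inter> nbrs E x)) \<le> (if x \<in> X then s * M else real s * M - M + m)" if x: "x \<in> V" for x
      proof (cases "x \<in> X")
        case True
        have "card (?U \<inter> nbrs E x) \<le> card ?U" by (rule card_mono[OF finU]) auto
        then have "real (card (?U \<inter> nbrs E x)) \<le> real (s * M)" unfolding cU by (rule of_nat_mono)
        then show ?thesis using True by simp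
      next
        case notX: False
        then obtain j where j: "j < s" "card (A j \<inter> nbrs E x) < m"
          using x by (auto simp: X_def not_le)
        have "card (?U \<inter> nbrs E x) \<le> card ((?U - A j) \<union> (A j \<inter> nbrs E x))"
          by (rule card_mono) (use finU cA(2)[OF j(1)] in auto)
        also have "\<dots> \<le> card (?U - A j) + card (A j \<inter> nbrs E x)" by (rule card_Un_le)
        also have "card (?U - A j) = s * M - M"
          using cU cA[OF j(1)] j(1) by (subst card_Diff_subset) auto
        also have "s * M - M + card (A j \<inter> nbrs E x) \<le> s * M - M + m" using j(2) by simp
        finally have "real (card (?U \<inter> nbrs E x)) \<le> real (s * M - M + m)" by (rule of_nat_mono)
        also have "\<dots> = real s * M - M + m"
        proof -
          have "M \<le> s * M" using \<open>s \<noteq> 0\<close> by simp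
          then show ?thesis by (simp only: of_nat_add of_nat_diff of_nat_mult)
        qed
        finally show ?thesis using notX by simp
      qed
      have "real (s * M) * (real ?n - real ?n / r - 1) = (\<Sum>a\<in>?U. real ?n - real ?n / r - 1)"
        using cU by simp
      also have "\<dots> \<le> (\<Sum>a\<in>?U. real (card (nbrs E a)))"
        by (rule sum_mono) (use turan_degree_real[OF V(4) _ r V(1)] UV in blast)
      also have "\<dots> = (\<Sum>x\<in>V. real (card (?U \<inter> nbrs E x)))"
        using sum_card_Int_nbrs[OF V(1,3) UV] by (metis of_nat_sum)
      also have "\<dots> \<le> (\<Sum>x\<in>V. if x \<in> X then s * M else real s * M - M + m)"
        by (rule sum_mono) (rule up)
      also have "\<dots> = (\<Sum>x\<in>X. real (s * M)) + (\<Sum>x\<in>V - X. real s * M - M + m)"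
      proof -
        have "V \<inter> {x. x \<in> X} = X" "V \<inter> - {x. x \<in> X} = V - X" using X(1) by auto
        then show ?thesis using V(1) by (simp add: sum.If_cases)
      qed
      also have "\<dots> \<le> card X * real (s * M) + real ?n * (real s * M - M + m)"
      proof -
        have "(1 :: real) * M \<le> real s * M" using \<open>s \<noteq> 0\<close> by (intro mult_right_mono) auto
        then have "(\<Sum>x\<in>V - X. real s * M - M + m) \<le> (\<Sum>x\<in>V. real s * M - M + m)"
          by (intro sum_mono2 V(1)) auto
        then show ?thesis by simp
      qed
      finally have "real ?n * (M - real s * M / r - m) - s * M \<le> card X * real (s * M)"
        by (simp add: algebra_simps)
      moreover have "M - real s * M / r - m \<ge> 1"
      proof -
        have "real s * M / r \<le> (real r - 1) * M / r"
          by (intro divide_right_mono mult_right_mono) (use Suc.prems r in \<open>auto simp: of_nat_diff\<close>)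
        also have "\<dots> = M - 2 * (real m + 1)" using r by (simp add: M_def field_simps)
        finally show ?thesis by simp
      qed
      then have "real ?n * 1 \<le> real ?n * (M - real s * M / r - m)" by (intro mult_left_mono) auto
      ultimately show ?thesis by (simp add: algebra_simps)
    qed
    \<comment> \<open>There are only \<open>card (Pow ?U)\<close> possible neighbourhoods in
      \<open>?U\<close>, so many vertices of \<open>X\<close> share one; \<open>m\<close> of them
      form the new class.\<close>
    have "card X > card (Pow ?U) * (m + 1)"
    proof (rule ccontr)
      assume "\<not> ?thesis"
      then have "card X \<le> 2 ^ (s * M) * (m + 1)" using cU finU by (simp add: card_Pow)
      then have "real (card X) * (real (s * M) + 1) \<le> real (2 ^ (s * M) * (m + 1)) * (real (s * M) + 1)"
        by (intro mult_right_mono of_nat_mono) auto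
      then have "real ?n \<le> real (s * M + (s * M + 1) * (2 ^ (s * M) * (m + 1)))"
        using many by (simp add: algebra_simps)
      then have "?n \<le> s * M + (s * M + 1) * (2 ^ (s * M) * (m + 1))" by (simp only: of_nat_le_iff)
      also have "\<dots> < N" by (simp add: N_def algebra_simps less_max_iff_disj)
      finally show False using V(2) by simp
    qed
    then obtain \<tau> where \<tau>: "m + 1 < card {x \<in> X. ?U \<inter> nbrs E x = \<tau>}"
      using card_fibers_le[OF X(2), of "Pow ?U" "\<lambda>x. ?U \<inter> nbrs E x" "m + 1"] finU
      by (metis (no_types, lifting) Int_lower1 PowI finite_Pow_iff image_subsetI not_le)
    then obtain b where b: "b \<in> X" "?U \<inter> nbrs E b = \<tau>"
      by (metis (mono_tags, lifting) Collect_empty_eq card.empty not_less_zero)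
    obtain B where B: "B \<subseteq> {x \<in> X. ?U \<inter> nbrs E x = \<tau>}" "card B = m" "finite B"
      using obtain_subset_with_card_n[of m "{x \<in> X. ?U \<inter> nbrs E x = \<tau>}"] \<tau> by auto
    have "\<exists>A'. A' \<subseteq> A j \<inter> \<tau> \<and> card A' = m \<and> finite A'" if "j < s" for j
    proof -
      have "A j \<inter> nbrs E b = A j \<inter> \<tau>" using b(2) that by auto
      then have "m \<le> card (A j \<inter> \<tau>)" using b(1) that by (auto simp: X_def)
      then show ?thesis by (meson obtain_subset_with_card_n)
    qed
    then obtain A' where A': "\<And>j. j < s \<Longrightarrow> A' j \<subseteq> A j \<inter> \<tau> \<and> card (A' j) = m \<and> finite (A' j)"
      by metis
    define A2 where "A2 j = (if j = s then B else A' j)" for j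
    have cross: "{x, a} \<in> E" if "x \<in> B" "a \<in> A' j" "j < s" for x a j
    proof -
      have "?U \<inter> nbrs E x = \<tau>" "a \<in> \<tau>" using B(1) A'[OF that(3)] that(1,2) by blast+
      then show ?thesis by auto
    qed
    have "multipartite E {..<Suc s} m A2"
      unfolding multipartite_def
    proof (intro conjI ballI impI)
      fix j assume "j \<in> {..<Suc s}"
      then show "finite (A2 j)" "card (A2 j) = m"
        using A'[of j] B by (auto simp: A2_def less_Suc_eq)
    next
      fix j l a b
      assume jl: "j \<in> {..<Suc s}" "l \<in> {..<Suc s}" "j \<noteq> l" and ab: "a \<in> A2 j" "b \<in> A2 l"
      consider "j = s" "l < s" | "l = s" "j < s" | "j < s" "l < s"
        using jl by (auto simp: less_Suc_eq)
      then show "{a, b} \<in> E"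
      proof cases
        case 1
        then show ?thesis using ab cross by (auto simp: A2_def)
      next
        case 2
        then have "{b, a} \<in> E" using ab cross by (auto simp: A2_def)
        then show ?thesis by (simp add: insert_commute)
      next
        case 3
        then have "a \<in> A j" "b \<in> A l" using ab A'[of j] A'[of l] by (auto simp: A2_def)
        then show ?thesis using A(1) 3 jl(3) by (auto simp: multipartite_def)
      qed
    qed
    moreover have "\<forall>j<Suc s. A2 j \<subseteq> V"
    proof (intro allI impI)
      fix j assume "j < Suc s"
      then consider "j = s" | "j < s" "j \<noteq> s" by linarith
      then show "A2 j \<subseteq> V"
      proof cases
        case 1
        then show ?thesis using B(1) X(1) by (auto simp: A2_def)
      next
        case 2
        then show ?thesis using A(2)[of j] A'[of j] by (auto simp: A2_def)
      qed
    qed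
    ultimately show ?thesis by blast
  qed
  then show ?case by blast
qed

text \<open>When a class is added, at most \<open>c * S\<close> vertices have been chosen, each
  excluding at most \<open>d\<close> candidates, so \<open>S\<close> candidates survive.\<close>

lemma multipartite_greedy:
  assumes "finite J" "card J \<le> c"
    and "\<And>l j x. l \<in> J \<Longrightarrow> j \<in> J \<Longrightarrow> l \<noteq> j \<Longrightarrow> x \<in> X l \<Longrightarrow> card (X j - nbrs E x) \<le> d"
    and "\<And>l. l \<in> J \<Longrightarrow> c * S * d + S \<le> card (X l)" and "\<And>l. l \<in> J \<Longrightarrow> finite (X l)"
  shows "\<exists>P. multipartite E J S P \<and> (\<forall>l\<in>J. P l \<subseteq> X l)"
  using assms
proof (induction J rule: finite_induct)
  case empty
  then show ?case by (simp add: multipartite_def)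
next
  case (insert l J)
  have "card J \<le> c" using insert by simp
  then obtain P where P: "multipartite E J S P" "\<forall>l\<in>J. P l \<subseteq> X l"
    using insert.IH insert.prems by (metis insertCI)
  let ?bad = "\<Union>j\<in>J. \<Union>a\<in>P j. X l - nbrs E a"
  have "card ?bad \<le> (\<Sum>j\<in>J. card (\<Union>a\<in>P j. X l - nbrs E a))"
    by (rule card_UN_le[OF insert.hyps(1)])
  also have "\<dots> \<le> (\<Sum>j\<in>J. S * d)"
  proof (rule sum_mono)
    fix j assume j: "j \<in> J"
    have "card (\<Union>a\<in>P j. X l - nbrs E a) \<le> (\<Sum>a\<in>P j. card (X l - nbrs E a))"
      by (rule card_UN_le) (use P(1) j in \<open>auto simp: multipartite_def\<close>)
    also have "\<dots> \<le> (\<Sum>a\<in>P j. d)"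
    proof (rule sum_mono)
      fix a assume "a \<in> P j"
      then show "card (X l - nbrs E a) \<le> d"
        using insert.prems(2)[of j l a] P(2) j insert.hyps(2) by auto
    qed
    also have "\<dots> = S * d" using P(1) j by (auto simp: multipartite_def)
    finally show "card (\<Union>a\<in>P j. X l - nbrs E a) \<le> S * d" .
  qed
  also have "\<dots> = card J * (S * d)" by simp
  also have "\<dots> \<le> c * (S * d)" using \<open>card J \<le> c\<close> by (rule mult_right_mono) simp
  finally have bad: "card ?bad \<le> c * S * d" by (simp add: mult.assoc)
  have "card (X l) - card ?bad \<le> card (X l - ?bad)"
    by (rule diff_card_le_card_Diff) (use insert.prems(4)[of l] insert.hyps(1) P(1) in \<open>auto simp: multipartite_def\<close>)
  then have "S \<le> card (X l - ?bad)" using insert.prems(3)[of l] bad by simp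
  then obtain B where B: "B \<subseteq> X l - ?bad" "card B = S" "finite B"
    by (meson obtain_subset_with_card_n)
  have BP: "{a, b} \<in> E" if "a \<in> P j" "b \<in> B" "j \<in> J" for a b j
    using B(1) that by auto
  define P2 where "P2 = P(l := B)"
  have "multipartite E (insert l J) S P2"
    unfolding multipartite_def
  proof (intro conjI ballI impI)
    fix j assume "j \<in> insert l J"
    then show "finite (P2 j)" "card (P2 j) = S"
      using P(1) B by (auto simp: P2_def multipartite_def)
  next
    fix j i a b
    assume ji: "j \<in> insert l J" "i \<in> insert l J" "j \<noteq> i" and ab: "a \<in> P2 j" "b \<in> P2 i"
    consider "j = l" "i \<in> J" "i \<noteq> l" | "i = l" "j \<in> J" "j \<noteq> l" | "j \<in> J" "i \<in> J" "j \<noteq> l" "i \<noteq> l"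
      using ji by auto
    then show "{a, b} \<in> E"
    proof cases
      case 1
      then have "{b, a} \<in> E" using ab BP by (auto simp: P2_def)
      then show ?thesis by (simp add: insert_commute)
    next
      case 2
      then show ?thesis using ab BP by (auto simp: P2_def)
    next
      case 3
      then show ?thesis using ab P(1) ji(3) by (auto simp: P2_def multipartite_def)
    qed
  qed
  moreover have "\<forall>j\<in>insert l J. P2 j \<subseteq> X j" using P(2) B(1) by (auto simp: P2_def)
  ultimately show ?case by blast
qed

section \<open>Partitions with many generic vertices\<close>

lemma fan_in_star:
  assumes "p < r" "\<And>j. j < r \<Longrightarrow> j \<noteq> p \<Longrightarrow> finite (P j) \<and> s \<le> card (P j)"
    "\<And>j a. j < r \<Longrightarrow> j \<noteq> p \<Longrightarrow> a \<in> P j \<Longrightarrow> {x, a} \<in> E"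
    "\<And>j y a. j < r \<Longrightarrow> j \<noteq> p \<Longrightarrow> y \<in> Y \<Longrightarrow> a \<in> P j \<Longrightarrow> {y, a} \<in> E"
    "\<And>j l a b. j < r \<Longrightarrow> j \<noteq> p \<Longrightarrow> l < r \<Longrightarrow> l \<noteq> p \<Longrightarrow> l \<noteq> j \<Longrightarrow> a \<in> P j \<Longrightarrow> b \<in> P l \<Longrightarrow> {a, b} \<in> E"
    "finite Y" "\<And>y. y \<in> Y \<Longrightarrow> {x, y} \<in> E" "K \<le> card Y"
  shows "fan_in r s K E"
  unfolding fan_in_def fan_at_def
  by (rule exI[of _ p], rule exI[of _ x], rule exI[of _ P], rule exI[of _ Y], rule exI[of _ "{}"])
    (use assms in simp)

text \<open>\<open>K\<close> is the excluded number of blades and \<open>L\<close> the wanted number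
  of generic vertices per class. \<open>S\<close> is a size from which a complete multipartite graph
  can supply both seeds and fillers; \<open>c\<close> counts a centre with \<open>K\<close> vertex
  seeds. The normalisation of \<open>\<epsilon>\<close> is chosen to make \<open>n / r\<close> equal
  to \<open>40 * w\<close>.\<close>

locale dense_fan_free =
  fixes V :: "'v set" and E :: "'v set set" and r s K L S c :: nat and \<epsilon> :: real
  assumes finV: "finite V" and E2: "E \<subseteq> [V]\<^bsup>2\<^esup>" and r2: "2 \<le> r" and K1: "1 \<le> K"
    and deg: "turan_degree r V E" and no_fan: "\<not> fan_in r s K E"
    and edges: "turan_number r (card V) \<le> card E"
    and S: "S = s + K + 1" and c: "c = K + 1"
    and eps: "\<epsilon> * (40 * real r * real r * real S * real c) = 1"
    and large: "100 * real r * real S * real c * real c + L \<le> \<epsilon> * card V"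
begin

abbreviation n :: real where "n \<equiv> real (card V)"

abbreviation u :: real where "u \<equiv> \<epsilon> * n"

abbreviation w :: real where "w \<equiv> real r * real S * real c * u"

lemma pos: "real r \<ge> 2" "real S \<ge> 2" "real c \<ge> 2" "\<epsilon> > 0" "n > 0" "real K \<le> real c - 1"
proof -
  show r: "real r \<ge> 2" and SS: "real S \<ge> 2" and cc: "real c \<ge> 2" and "real K \<le> real c - 1"
    using r2 K1 S c by simp_all
  show e: "\<epsilon> > 0"
  proof (rule ccontr)
    assume "\<not> \<epsilon> > 0"
    then have "\<epsilon> * (40 * real r * real r * real S * real c) \<le> 0"
      by (intro mult_nonpos_nonneg) auto
    then show False using eps by simp
  qed
  have "0 < 100 * real r * real S * real c * real c" using r SS cc by simp
  then have "0 < u" using large by linarith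
  then show "n > 0" using e by (simp add: zero_less_mult_iff)
qed

text \<open>The hierarchy of scales: fixed constants are dominated by \<open>u\<close>, which is
  small against \<open>w\<close>, and a class of average size is \<open>40 * w\<close>. The later
  estimates are linear in these quantities.\<close>

lemma bounds: "100 * (real r * real c) \<le> u" "100 * (real r * real c * real c) \<le> u" "100 * real S \<le> u"
  "100 * real c \<le> u" "real L + 100 \<le> u" "8 * u \<le> w" "2 * (real r * real S * u) \<le> w" "n / r = 40 * w"
  "4 * u \<le> real r * real S * u"
proof -
  have base: "100 * real r * real S * real c * real c \<le> u" using large by simp
  have one: "1 \<le> real r" "1 \<le> real S" "1 \<le> real c" using pos by auto
  have rcc: "real r * real c * real c * 1 \<le> real r * real c * real c * real S"
    by (rule mult_left_mono) (use one in auto)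
  then show rc2: "100 * (real r * real c * real c) \<le> u" using base by (simp add: algebra_simps)
  have "real r * real c * 1 \<le> real r * real c * real c" by (rule mult_left_mono) (use one in auto)
  then show rc: "100 * (real r * real c) \<le> u" using rc2 by simp
  have "1 * real c \<le> real r * real c" by (rule mult_right_mono) (use one in auto)
  then show "100 * real c \<le> u" using rc by simp
  have h1: "1 \<le> real r * real c" using mult_mono[of 1 "real r" 1 "real c"] one by simp
  have "1 \<le> real r * real c * real c"
    using mult_mono[of 1 "real r * real c" 1 "real c"] one h1 by simp
  then have rcc1: "1 * real S \<le> (real r * real c * real c) * real S" by (intro mult_right_mono) auto
  then show "100 * real S \<le> u" using base by (simp add: algebra_simps)
  have "1 \<le> real r * real c * real c * real S" using rcc1 one by linarith
  then show "real L + 100 \<le> u" using large by (simp add: algebra_simps)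
  have u0: "u \<ge> 0" using pos by simp
  have rS: "2 * 2 \<le> real r * real S" by (rule mult_mono) (use pos in auto)
  then have "2 * 2 * 2 \<le> real r * real S * real c" by (rule mult_mono) (use pos in auto)
  then have "2 * 2 * 2 * u \<le> real r * real S * real c * u" using u0 by (rule mult_right_mono)
  then show "8 * u \<le> w" by simp
  have "(real r * real S * u) * 2 \<le> (real r * real S * u) * real c"
    by (rule mult_left_mono) (use pos u0 in auto)
  then show "2 * (real r * real S * u) \<le> w" by (simp add: algebra_simps)
  have "4 * u \<le> real r * real S * u" using rS u0 by (intro mult_right_mono) auto
  then show "4 * u \<le> real r * real S * u" .
  have "n = n * (\<epsilon> * (40 * real r * real r * real S * real c))" unfolding eps by simp
  then have "n = (40 * w) * real r" by (simp add: algebra_simps)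
  then show "n / r = 40 * w" using pos(1) by (simp add: field_simps)
qed

lemma card_non_nbrs: "x \<in> V \<Longrightarrow> card (V - nbrs E x) \<le> n / r + 1"
proof -
  assume x: "x \<in> V"
  have sub: "nbrs E x \<subseteq> V" using nbrs_subset[OF E2, of x] by blast
  then have "card (V - nbrs E x) = card V - card (nbrs E x)"
    by (intro card_Diff_subset finite_nbrs[OF finV E2])
  moreover have "card (nbrs E x) \<le> card V" by (rule card_mono[OF finV sub])
  ultimately have "real (card (V - nbrs E x)) = n - card (nbrs E x)" by (simp add: of_nat_diff)
  then show ?thesis using turan_degree_real[OF deg x _ finV] r2 by simp
qed

text \<open>A vertex joined to a whole complete \<open>r\<close>-partite graph is the centre of a
  fan: class 0 provides the seeds and the other classes the fillers.\<close>

lemma few_nbrs: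
  assumes P: "multipartite E {..<r} S' P" "S \<le> S'" "\<And>j. j < r \<Longrightarrow> P j \<subseteq> nbrs E x"
  shows False
proof -
  have P0: "finite (P j)" "card (P j) = S'" if "j < r" for j
    using P(1) that by (auto simp: multipartite_def)
  have PP: "{a, b} \<in> E" if "j < r" "l < r" "j \<noteq> l" "a \<in> P j" "b \<in> P l" for j l a b
    using P(1) that by (auto simp: multipartite_def)
  have "K \<le> card (P 0)" using P0[of 0] r2 P(2) S by simp
  then obtain Y where Y: "Y \<subseteq> P 0" "card Y = K" "finite Y" by (meson obtain_subset_with_card_n)
  have "fan_in r s K E"
  proof (rule fan_in_star[where p = 0 and P = P and x = x and Y = Y])
    show "finite (P j) \<and> s \<le> card (P j)" if "j < r" for j using P0[OF that] P(2) S by simp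
    show "{x, a} \<in> E" if "j < r" "a \<in> P j" for j a using P(3)[OF that(1)] that(2) by auto
    show "{y, a} \<in> E" if "j < r" "j \<noteq> 0" "y \<in> Y" "a \<in> P j" for j y a
      using PP[of 0 j y a] that Y(1) r2 by auto
    show "{x, y} \<in> E" if "y \<in> Y" for y using P(3)[of 0] that Y(1) r2 by auto
  qed (use PP Y r2 in auto)
  then show False using no_fan by simp
qed

text \<open>Every vertex has few neighbours in some \<open>A j\<close>, and by the degree condition
  almost every vertex is then joined to nearly all of the others. Vertices are sorted by this class,
  the few exceptions being left out. Any centre and \<open>K\<close> seeds from one
  \<open>V0 j\<close> have enough common neighbours in the other \<open>A l\<close> to make a fan,
  so inner degrees are below \<open>K\<close>.\<close>

lemma approximate_partition:
  assumes A: "multipartite E {..<r} m A" "\<And>j. j < r \<Longrightarrow> A j \<subseteq> V"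
    and m: "m = 160 * r * r * S * S * c * c"
  obtains V0 where "\<And>j. j < r \<Longrightarrow> V0 j \<subseteq> V" "\<And>j l. j < r \<Longrightarrow> l < r \<Longrightarrow> j \<noteq> l \<Longrightarrow> V0 j \<inter> V0 l = {}"
    "\<And>j. j < r \<Longrightarrow> n / r - 2 * u \<le> card (V0 j)"
    "\<And>j x. j < r \<Longrightarrow> x \<in> V0 j \<Longrightarrow> card (V - nbrs E x - V0 j) \<le> 3 * u"
    "\<And>j x. j < r \<Longrightarrow> x \<in> V0 j \<Longrightarrow> card (nbrs E x \<inter> V0 j) < K"
proof -
  let ?U = "\<Union>j<r. A j"
  have UV: "?U \<subseteq> V" using A(2) by auto
  have finU: "finite ?U" using UV finV by (rule finite_subset)
  have cU: "card ?U = r * m" using card_multipartite[OF E2 A(1)] by simp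
  have cA: "card (A j) = m" "finite (A j)" if "j < r" for j
    using A(1) that by (auto simp: multipartite_def)
  have AU: "A j \<subseteq> ?U" if "j < r" for j using that by auto
  have cUA: "real (card (?U - A j)) = real r * m - m" if "j < r" for j
  proof -
    have "card (?U - A j) = card ?U - card (A j)"
      using cA[OF that] AU[OF that] by (intro card_Diff_subset)
    moreover have "m \<le> r * m" using r2 by simp
    ultimately show ?thesis using cU cA[OF that] by (simp only: of_nat_diff of_nat_mult)
  qed
  have m2: "2 * S \<le> m"
  proof -
    have "0 < r * r * S * c * c" using r2 K1 S c by simp
    then have "2 * S * 1 \<le> 2 * S * (80 * (r * r * S * c * c))" by (intro mult_le_mono2) linarith
    also have "\<dots> = m" unfolding m by (simp add: mult.commute mult.left_commute)
    finally show ?thesis by simp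
  qed
  have "\<exists>j<r. card (A j \<inter> nbrs E x) < S" for x
  proof (rule ccontr)
    assume "\<not> ?thesis"
    then have "\<forall>j. \<exists>P. j < r \<longrightarrow> P \<subseteq> A j \<inter> nbrs E x \<and> card P = S \<and> finite P"
      by (metis not_le obtain_subset_with_card_n)
    from choice[OF this] obtain P where P: "\<forall>j. j < r \<longrightarrow> P j \<subseteq> A j \<inter> nbrs E x \<and> card (P j) = S \<and> finite (P j)" ..
    have "multipartite E {..<r} S P"
      unfolding multipartite_def
    proof (intro conjI ballI impI)
      fix j l a b assume "j \<in> {..<r}" "l \<in> {..<r}" "j \<noteq> l" "a \<in> P j" "b \<in> P l"
      moreover from this have "a \<in> A j" "b \<in> A l" using P by auto
      ultimately show "{a, b} \<in> E" using A(1) by (auto simp: multipartite_def)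
    qed (use P in auto)
    then show False using few_nbrs[of S P x] P by auto
  qed
  then have "\<forall>x. \<exists>j. j < r \<and> card (A j \<inter> nbrs E x) < S" by blast
  from choice[OF this] obtain cl where cl: "\<forall>x. cl x < r \<and> card (A (cl x) \<inter> nbrs E x) < S" ..
  define t where "t x = real (card (?U \<inter> nbrs E x))" for x
  \<comment> \<open>The shortfall \<open>m / (2 * real c)\<close> is such that \<open>c\<close>
    vertices without it still share about half of a class.\<close>
  define B where "B = {x \<in> V. t x < real r * m - m + S - m / (2 * real c)}"
  have t_le: "t x \<le> real r * m - m + S" for x
  proof -
    let ?A = "A (cl x)"
    have "card (?U \<inter> nbrs E x) \<le> card ((?U - ?A) \<union> (?A \<inter> nbrs E x))"
      by (rule card_mono) (use finU cA cl in auto)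
    also have "\<dots> \<le> card (?U - ?A) + card (?A \<inter> nbrs E x)" by (rule card_Un_le)
    finally have "t x \<le> real (card (?U - ?A) + card (?A \<inter> nbrs E x))"
      unfolding t_def by (rule of_nat_mono)
    moreover have "real (card (?A \<inter> nbrs E x)) \<le> S" using cl by (simp add: less_imp_le)
    ultimately show ?thesis using cUA[of "cl x"] cl by simp
  qed
  have cB: "card B \<le> u"
  proof -
    have "real (r * m) * (n - n / r - 1) = (\<Sum>a\<in>?U. n - n / r - 1)" by (simp add: cU)
    also have "\<dots> \<le> (\<Sum>a\<in>?U. real (card (nbrs E a)))"
      by (rule sum_mono) (rule turan_degree_real[OF deg subsetD[OF UV] _ finV], use r2 in auto)
    also have "\<dots> = (\<Sum>x\<in>V. t x)"
      unfolding t_def using sum_card_Int_nbrs[OF finV E2 UV] by (metis of_nat_sum)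
    also have "\<dots> \<le> (\<Sum>x\<in>V. real r * m - m + S - (if x \<in> B then m / (2 * real c) else 0))"
      by (rule sum_mono) (use t_le in \<open>auto simp: B_def\<close>)
    also have "\<dots> = n * (real r * m - m + S) - card B * (m / (2 * real c))"
    proof -
      have "V \<inter> {x. x \<in> B} = B" by (auto simp: B_def)
      then show ?thesis using finV by (simp add: sum_subtractf sum.If_cases)
    qed
    finally have "card B * (m / (2 * real c)) \<le> n * (real r * m - m + S) - real (r * m) * (n - n / r - 1)"
      by simp
    also have "\<dots> = n * S + real r * m" using pos(1) by (simp add: field_simps)
    finally have "card B * (m / (2 * real c)) * (2 * real c) \<le> (n * S + real r * m) * (2 * real c)"
      by (intro mult_right_mono) auto
    moreover have "card B * (m / (2 * real c)) * (2 * real c) = card B * real m" using pos(3) by simp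
    ultimately have le: "card B * real m \<le> 2 * (real c * real S * n) + 2 * (real r * real c * real m)"
      by (simp add: algebra_simps)
    \<comment> \<open>The value of \<open>m\<close> makes both error terms of \<open>le\<close> at
      most half of \<open>u * real m\<close>.\<close>
    have "\<epsilon> * real m = 4 * real c * real S * (\<epsilon> * (40 * real r * real r * real S * real c))"
      by (simp add: m)
    then have "\<epsilon> * real m = 4 * real c * real S" unfolding eps by simp
    then have um: "u * real m = 4 * (real c * real S * n)"
      by (metis (no_types, lifting) mult.assoc mult.commute)
    have "0 \<le> real r * real c" by simp
    then have "4 * (real r * real c) \<le> u" using bounds(1) by linarith
    then have "4 * (real r * real c) * real m \<le> u * real m" by (rule mult_right_mono) simp
    then have "4 * (real r * real c * real m) \<le> u * real m" by (simp only: mult.assoc)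
    then have "card B * real m \<le> u * real m" using le um by linarith
    moreover have "real m > 0" using m2 pos(2) S by simp
    ultimately show ?thesis by (simp only: mult_le_cancel_right_pos)
  qed
  define V0 where "V0 j = {x \<in> V - B. cl x = j}" for j
  have V0V: "V0 j \<subseteq> V" for j by (auto simp: V0_def)
  have finV0: "finite (V0 j)" for j using V0V finV by (rule finite_subset)
  have miss: "card (A l - nbrs E x) \<le> m / (2 * real c)" if x: "x \<in> V0 j" and l: "l < r" "l \<noteq> j" for x j l
  proof -
    have j: "j < r" "card (A j \<inter> nbrs E x) < S" using x cl by (auto simp: V0_def)
    have AA: "A l \<subseteq> ?U - A j" using multipartite_disjoint[OF E2 A(1), of l j] l j by auto
    have "card (?U \<inter> nbrs E x) \<le> card (((?U - A j) - A l) \<union> (A j \<inter> nbrs E x) \<union> (A l \<inter> nbrs E x))"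
      by (rule card_mono) (use finU cA l j in auto)
    also have "\<dots> \<le> card ((?U - A j) - A l) + card (A j \<inter> nbrs E x) + card (A l \<inter> nbrs E x)"
      by (meson add_le_mono card_Un_le order_refl order_trans)
    finally have "t x \<le> real (card ((?U - A j) - A l) + card (A j \<inter> nbrs E x) + card (A l \<inter> nbrs E x))"
      unfolding t_def by (rule of_nat_mono)
    moreover have "real (card ((?U - A j) - A l)) = real (card (?U - A j)) - m"
    proof -
      have "card ((?U - A j) - A l) = card (?U - A j) - card (A l)"
        by (rule card_Diff_subset[OF cA(2)[OF l(1)] AA])
      moreover have "card (A l) \<le> card (?U - A j)" by (rule card_mono[OF _ AA]) (use finU in simp)
      ultimately show ?thesis using cA(1)[OF l(1)] by (simp only: of_nat_diff)
    qed
    moreover have "t x \<ge> real r * m - m + S - m / (2 * real c)" using x by (auto simp: V0_def B_def)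
    moreover have "card (A l) = card (A l \<inter> nbrs E x) + card (A l - nbrs E x)"
      using cA(2)[OF l(1)] by (metis card_Int_Diff)
    then have "real m = real (card (A l \<inter> nbrs E x)) + real (card (A l - nbrs E x))"
      using cA(1)[OF l(1)] by simp
    moreover have "real (card (A j \<inter> nbrs E x)) \<le> S" using j by simp
    ultimately show ?thesis using cUA[OF j(1)] by simp
  qed
  have degV0: "card (nbrs E x \<inter> V0 j) < K" if j: "j < r" and x: "x \<in> V0 j" for j x
  proof (rule ccontr)
    assume "\<not> ?thesis"
    then obtain Y where Y: "Y \<subseteq> nbrs E x \<inter> V0 j" "card Y = K" "finite Y"
      by (meson not_le obtain_subset_with_card_n)
    define P where "P l = {a \<in> A l. \<forall>z\<in>insert x Y. {z, a} \<in> E}" for l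
    have cP: "s \<le> card (P l)" if l: "l < r" "l \<noteq> j" for l
    proof -
      have "A l - P l \<subseteq> (\<Union>z\<in>insert x Y. A l - nbrs E z)" by (auto simp: P_def)
      then have "card (A l - P l) \<le> card (\<Union>z\<in>insert x Y. A l - nbrs E z)"
        by (rule card_mono[rotated]) (use Y(3) cA(2)[OF l(1)] in auto)
      also have "\<dots> \<le> (\<Sum>z\<in>insert x Y. card (A l - nbrs E z))"
        by (rule card_UN_le) (use Y(3) in simp)
      finally have "real (card (A l - P l)) \<le> real (\<Sum>z\<in>insert x Y. card (A l - nbrs E z))"
        by (rule of_nat_mono)
      also have "\<dots> = (\<Sum>z\<in>insert x Y. real (card (A l - nbrs E z)))" by (rule of_nat_sum)
      also have "\<dots> \<le> (\<Sum>z\<in>insert x Y. m / (2 * real c))"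
        by (rule sum_mono) (use miss[OF _ l] x Y(1) in blast)
      also have "\<dots> = card (insert x Y) * (m / (2 * real c))" by simp
      also have "\<dots> \<le> real c * (m / (2 * real c))"
      proof (rule mult_right_mono)
        have "card (insert x Y) \<le> Suc K" using Y(2,3) card_insert_le_m1[of "Suc K" Y x] by simp
        then show "real (card (insert x Y)) \<le> real c" using c by simp
      qed simp
      also have "\<dots> = m / 2" using pos(3) by simp
      finally have "real (card (A l - P l)) \<le> m / 2" .
      moreover have "card (A l) = card (P l) + card (A l - P l)"
      proof -
        have "A l \<inter> P l = P l" by (auto simp: P_def)
        then show ?thesis using card_Int_Diff[OF cA(2)[OF l(1)], of "P l"] by simp
      qed
      ultimately have "real m / 2 \<le> card (P l)" using cA(1)[OF l(1)] by simp
      moreover have "real (2 * S) \<le> real m" using m2 by (rule of_nat_mono)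
      ultimately have "real S \<le> real (card (P l))" by simp
      then show ?thesis using S by simp
    qed
    have "fan_in r s K E"
    proof (rule fan_in_star[where p = j and P = P and x = x and Y = Y])
      show "finite (P l) \<and> s \<le> card (P l)" if "l < r" "l \<noteq> j" for l
        using cP[OF that] cA(2)[OF that(1)] by (simp add: P_def)
      show "{a, b} \<in> E" if "i < r" "l < r" "l \<noteq> i" "a \<in> P i" "b \<in> P l" for i l a b
        using A(1) that by (auto simp: P_def multipartite_def)
    qed (use j Y in \<open>auto simp: P_def\<close>)
    then show False using no_fan by simp
  qed
  \<comment> \<open>A vertex of \<open>V0 j\<close> has fewer than \<open>K\<close> neighbours there
    and at most about \<open>n / r\<close> non-neighbours altogether. Since all vertices outside
    \<open>B\<close> are distributed, upper bounds on the other classes yield the lower bound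
    \<open>loV0\<close>.\<close>
  have upV0: "card (V0 j) \<le> n / r + 1 + K" if j: "j < r" for j
  proof (cases "V0 j = {}")
    case False
    then obtain x where x: "x \<in> V0 j" by blast
    have "V0 j \<subseteq> (V - nbrs E x) \<union> (nbrs E x \<inter> V0 j)" using V0V by auto
    then have "card (V0 j) \<le> card ((V - nbrs E x) \<union> (nbrs E x \<inter> V0 j))"
      by (rule card_mono[rotated]) (use finV finV0 in auto)
    also have "\<dots> \<le> card (V - nbrs E x) + card (nbrs E x \<inter> V0 j)" by (rule card_Un_le)
    finally have "real (card (V0 j)) \<le> real (card (V - nbrs E x) + card (nbrs E x \<inter> V0 j))"
      by (rule of_nat_mono)
    moreover have "real (card (nbrs E x \<inter> V0 j)) \<le> K" using degV0[OF j x] by simp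
    moreover have "real (card (V - nbrs E x)) \<le> n / r + 1" using card_non_nbrs x V0V by blast
    ultimately show ?thesis by simp
  next
    case True
    have "0 \<le> n / r" by simp
    then show ?thesis using True by simp
  qed
  have disV0: "V0 j \<inter> V0 l = {}" if "j \<noteq> l" for j l using that by (auto simp: V0_def)
  have loV0: "n / r - 2 * u \<le> card (V0 j)" if j: "j < r" for j
  proof -
    have "V = B \<union> (\<Union>l<r. V0 l)" using cl by (auto simp: V0_def B_def)
    then have "card V \<le> card B + card (\<Union>l<r. V0 l)" by (metis card_Un_le)
    also have "card (\<Union>l<r. V0 l) \<le> (\<Sum>l<r. card (V0 l))" by (rule card_UN_le) simp
    finally have "n \<le> real (card B + (\<Sum>l<r. card (V0 l)))" by (simp only: of_nat_le_iff)
    also have "\<dots> = card B + (\<Sum>l<r. real (card (V0 l)))" by simp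
    also have "(\<Sum>l<r. real (card (V0 l))) = card (V0 j) + (\<Sum>l\<in>{..<r} - {j}. real (card (V0 l)))"
      by (rule sum.remove) (use j in auto)
    also have "(\<Sum>l\<in>{..<r} - {j}. real (card (V0 l))) \<le> (\<Sum>l\<in>{..<r} - {j}. n / r + 1 + K)"
      by (rule sum_mono) (use upV0 in auto)
    also have "\<dots> = real (r - 1) * (n / r + 1 + K)" using j by simp
    also have "\<dots> = n - n / r + (real r - 1) * c"
      using pos(1) r2 c by (simp add: of_nat_diff field_simps)
    finally have "n \<le> card B + (card (V0 j) + (n - n / r + (real r - 1) * c))" by simp
    moreover have "(real r - 1) * c \<le> real r * c" by (simp add: algebra_simps)
    moreover have "real r * real c \<le> u" using bounds(1) pos by (smt (verit) mult_nonneg_nonneg)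
    ultimately show ?thesis using cB by linarith
  qed
  \<comment> \<open>The non-neighbours of \<open>x\<close> inside \<open>V0 j\<close> nearly exhaust
    the number that the degree condition allows.\<close>
  have nnV0: "card (V - nbrs E x - V0 j) \<le> 3 * u" if j: "j < r" and x: "x \<in> V0 j" for j x
  proof -
    have "V0 j \<subseteq> ((V - nbrs E x) \<inter> V0 j) \<union> (nbrs E x \<inter> V0 j)" using V0V by auto
    then have "card (V0 j) \<le> card (((V - nbrs E x) \<inter> V0 j) \<union> (nbrs E x \<inter> V0 j))"
      by (rule card_mono[rotated]) (use finV0 in auto)
    also have "\<dots> \<le> card ((V - nbrs E x) \<inter> V0 j) + card (nbrs E x \<inter> V0 j)" by (rule card_Un_le)
    finally have "real (card (V0 j)) \<le> real (card ((V - nbrs E x) \<inter> V0 j)) + real (card (nbrs E x \<inter> V0 j))"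
      by (simp only: of_nat_add[symmetric] of_nat_le_iff)
    moreover have "real (card (nbrs E x \<inter> V0 j)) \<le> K" using degV0[OF j x] by simp
    moreover have "card (V - nbrs E x) = card ((V - nbrs E x) \<inter> V0 j) + card (V - nbrs E x - V0 j)"
      by (rule card_Int_Diff) (use finV in simp)
    moreover have "real (card (V - nbrs E x)) \<le> n / r + 1" using card_non_nbrs x V0V by blast
    ultimately show ?thesis using loV0[OF j] bounds(4,5) pos(3,6) by linarith
  qed
  show ?thesis
    by (rule that[of V0]) (use V0V disV0 loV0 nnV0 degV0 in auto)
qed

text \<open>The exceptional vertices are assigned to a class where they have few neighbours. Then
  any bounded set of vertices has common fillers, so inner degrees and matchings are below
  \<open>K\<close> and the number of inner edges is bounded. The density of \<open>E\<close> bounds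
  the missing edges as well, and all vertices of \<open>V0 j\<close> off these edges are
  generic.\<close>

lemma generic_partition:
  assumes A: "multipartite E {..<r} m A" "\<And>j. j < r \<Longrightarrow> A j \<subseteq> V"
    and m: "m = 160 * r * r * S * S * c * c"
  obtains part where "part ` V \<subseteq> {..<r}"
    "\<And>j. j < r \<Longrightarrow> L \<le> card {x \<in> V. part x = j \<and> (\<forall>y\<in>V. y \<noteq> x \<longrightarrow> ({x, y} \<in> E \<longleftrightarrow> part y \<noteq> j))}"
proof -
  obtain V0 where V0V: "\<And>j. j < r \<Longrightarrow> V0 j \<subseteq> V"
    and V0dis: "\<And>j l. j < r \<Longrightarrow> l < r \<Longrightarrow> j \<noteq> l \<Longrightarrow> V0 j \<inter> V0 l = {}"
    and V0lo: "\<And>j. j < r \<Longrightarrow> n / r - 2 * u \<le> card (V0 j)"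
    and V0nn: "\<And>j x. j < r \<Longrightarrow> x \<in> V0 j \<Longrightarrow> card (V - nbrs E x - V0 j) \<le> 3 * u"
    and V0deg: "\<And>j x. j < r \<Longrightarrow> x \<in> V0 j \<Longrightarrow> card (nbrs E x \<inter> V0 j) < K"
    using approximate_partition[OF A m] by blast
  define d where "d = nat \<lfloor>3 * u\<rfloor>"
  have u0: "u \<ge> 0" using pos by simp
  have d: "real d \<le> 3 * u" using u0 by (simp add: d_def)
  have d_le: "a \<le> d" if "real a \<le> 3 * u" for a using that by (simp add: d_def le_nat_floor)
  let ?rS = "real r * real S * u"
  have rS0: "?rS \<ge> 0" using u0 by simp
  have greedy_size: "r * S * d + S \<le> a" if "3 * ?rS + S \<le> real a" for a
  proof -
    have "real (r * S * d + S) = real r * real S * real d + S" by simp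
    also have "real r * real S * real d \<le> real r * real S * (3 * u)"
      by (rule mult_left_mono) (use d in auto)
    finally have "real (r * S * d + S) \<le> real a" using that by simp
    then show ?thesis by (simp only: of_nat_le_iff)
  qed
  have nn_other: "card (V0 l - nbrs E x) \<le> d" if "j < r" "l < r" "j \<noteq> l" "x \<in> V0 j" for j l x
  proof (rule d_le)
    have "V0 l - nbrs E x \<subseteq> V - nbrs E x - V0 j" using V0V[OF that(2)] V0dis[OF that(1-3)] by blast
    then have "card (V0 l - nbrs E x) \<le> card (V - nbrs E x - V0 j)"
      by (rule card_mono[rotated]) (use finV in simp)
    then show "real (card (V0 l - nbrs E x)) \<le> 3 * u" using V0nn[OF that(1,4)] by linarith
  qed
  have finV0: "finite (V0 j)" if "j < r" for j using V0V[OF that] finV by (rule finite_subset)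
  have greedy: "\<exists>P. multipartite E {..<r} S P \<and> (\<forall>l<r. P l \<subseteq> X l)"
    if X: "\<And>l. l < r \<Longrightarrow> X l \<subseteq> V0 l" "\<And>l. l < r \<Longrightarrow> 3 * ?rS + S \<le> card (X l)" for X
  proof -
    have "\<exists>P. multipartite E {..<r} S P \<and> (\<forall>l\<in>{..<r}. P l \<subseteq> X l)"
    proof (rule multipartite_greedy[where c = r and d = d])
      fix l j x assume lj: "l \<in> {..<r}" "j \<in> {..<r}" "l \<noteq> j" "x \<in> X l"
      have "card (X j - nbrs E x) \<le> card (V0 j - nbrs E x)"
        by (rule card_mono) (use X(1)[of j] finV0[of j] lj in auto)
      also have "\<dots> \<le> d" by (rule nn_other[of l]) (use lj X(1)[of l] in auto)
      finally show "card (X j - nbrs E x) \<le> d" .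
    next
      fix l assume l: "l \<in> {..<r}"
      then show "r * S * d + S \<le> card (X l)" using greedy_size X(2) by simp
      show "finite (X l)" by (rule finite_subset[OF X(1) finV0]) (use l in auto)
    qed auto
    then show ?thesis by auto
  qed
  have S_u: "real S \<le> ?rS" using bounds(3,9) u0 by linarith
  \<comment> \<open>Otherwise a complete \<open>r\<close>-partite graph could be chosen greedily
    inside the neighbourhood of \<open>x\<close>.\<close>
  have "\<exists>j. j < r \<and> card (nbrs E x \<inter> V0 j) < 4 * ?rS" for x
  proof (rule ccontr)
    assume no: "\<not> ?thesis"
    have "\<exists>P. multipartite E {..<r} S P \<and> (\<forall>l<r. P l \<subseteq> nbrs E x \<inter> V0 l)"
    proof (rule greedy)
      fix l assume "l < r"
      then have "4 * ?rS \<le> card (nbrs E x \<inter> V0 l)" using no by (meson not_le)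
      then show "3 * ?rS + S \<le> card (nbrs E x \<inter> V0 l)" using S_u by linarith
    qed auto
    then obtain P where P: "multipartite E {..<r} S P" "\<forall>l<r. P l \<subseteq> nbrs E x \<inter> V0 l" by blast
    show False by (rule few_nbrs[OF P(1)]) (use P(2) in auto)
  qed
  then have "\<forall>x. \<exists>j. j < r \<and> card (nbrs E x \<inter> V0 j) < 4 * ?rS" by blast
  from choice[OF this] obtain q where q: "\<forall>x. q x < r \<and> card (nbrs E x \<inter> V0 (q x)) < 4 * ?rS" ..
  define part where "part x = (if \<exists>j<r. x \<in> V0 j then (THE j. j < r \<and> x \<in> V0 j) else q x)" for x
  have part_V0: "part x = j" if "j < r" "x \<in> V0 j" for x j
  proof -
    have "(THE j. j < r \<and> x \<in> V0 j) = j"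
      by (rule the_equality) (use that V0dis in blast)+
    then show ?thesis using that by (auto simp: part_def)
  qed
  have K_u: "real K \<le> 4 * ?rS" using bounds(4,9) pos(3,6) u0 by linarith
  have part: "part x < r" "card (nbrs E x \<inter> V0 (part x)) < 4 * ?rS" for x
  proof -
    have "part x < r \<and> card (nbrs E x \<inter> V0 (part x)) < 4 * ?rS"
    proof (cases "\<exists>j<r. x \<in> V0 j")
      case True
      then obtain j where j: "j < r" "x \<in> V0 j" by blast
      then have "real (card (nbrs E x \<inter> V0 j)) < real K" using V0deg by simp
      then show ?thesis using j part_V0[OF j] K_u by simp
    next
      case False
      then have "part x = q x" unfolding part_def by (rule if_not_P)
      then show ?thesis using q by simp
    qed
    then show "part x < r" "card (nbrs E x \<inter> V0 (part x)) < 4 * ?rS" by auto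
  qed
  \<comment> \<open>Having few neighbours in its own class, a vertex spends nearly all permitted
    non-neighbours there.\<close>
  have nn_part: "card (V - nbrs E x - V0 (part x)) \<le> 7 * ?rS" if x: "x \<in> V" for x
  proof -
    let ?W = "V0 (part x)"
    have "?W \<subseteq> ((V - nbrs E x) \<inter> ?W) \<union> (nbrs E x \<inter> ?W)" using V0V[OF part(1)] by auto
    then have "card ?W \<le> card (((V - nbrs E x) \<inter> ?W) \<union> (nbrs E x \<inter> ?W))"
      by (rule card_mono[rotated]) (use finV0[OF part(1)] in auto)
    also have "\<dots> \<le> card ((V - nbrs E x) \<inter> ?W) + card (nbrs E x \<inter> ?W)" by (rule card_Un_le)
    finally have "real (card ?W) \<le> real (card ((V - nbrs E x) \<inter> ?W)) + real (card (nbrs E x \<inter> ?W))"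
      by (simp only: of_nat_add[symmetric] of_nat_le_iff)
    moreover have "card (V - nbrs E x) = card ((V - nbrs E x) \<inter> ?W) + card (V - nbrs E x - ?W)"
      by (rule card_Int_Diff) (use finV in simp)
    ultimately show ?thesis
      using card_non_nbrs[OF x] V0lo[OF part(1), of x] part(2)[of x] bounds(5,9) by linarith
  qed
  \<comment> \<open>Each of the at most \<open>2 * c\<close> vertices of \<open>Z\<close> excludes
    at most \<open>7 * ?rS\<close> candidates of a class. That is \<open>14 * w\<close> in total,
    out of roughly \<open>40 * w\<close>.\<close>
  have supplies: "\<exists>P. multipartite E {..<r} S P \<and>
      (\<forall>l<r. P l \<subseteq> V0 l \<and> P l \<inter> Z = {} \<and> (\<forall>z\<in>Z. part z \<noteq> l \<longrightarrow> (\<forall>a\<in>P l. {z, a} \<in> E)))"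
    if Z: "Z \<subseteq> V" "card Z \<le> 2 * c" for Z
  proof -
    have finZ: "finite Z" using Z(1) finV by (rule finite_subset)
    define X where "X l = {a \<in> V0 l. a \<notin> Z \<and> (\<forall>z\<in>Z. part z \<noteq> l \<longrightarrow> {z, a} \<in> E)}" for l
    have cX: "3 * ?rS + S \<le> card (X l)" if l: "l < r" for l
    proof -
      let ?bad = "\<Union>z\<in>{z \<in> Z. part z \<noteq> l}. V0 l - nbrs E z"
      have sub: "V0 l - X l \<subseteq> Z \<union> ?bad" by (auto simp: X_def)
      have fin: "finite ?bad" using finZ finV0[OF l] by simp
      have "card (V0 l - X l) \<le> card (Z \<union> ?bad)"
        by (rule card_mono[OF _ sub]) (use fin finZ in simp)
      also have "\<dots> \<le> card Z + card ?bad" by (rule card_Un_le)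
      also have "card ?bad \<le> (\<Sum>z\<in>{z \<in> Z. part z \<noteq> l}. card (V0 l - nbrs E z))"
        by (rule card_UN_le) (use finZ in simp)
      finally have "real (card (V0 l - X l)) \<le> real (card Z + (\<Sum>z\<in>{z \<in> Z. part z \<noteq> l}. card (V0 l - nbrs E z)))"
        by (simp only: of_nat_le_iff)
      also have "\<dots> = card Z + (\<Sum>z\<in>{z \<in> Z. part z \<noteq> l}. real (card (V0 l - nbrs E z)))" by simp
      also have "(\<Sum>z\<in>{z \<in> Z. part z \<noteq> l}. real (card (V0 l - nbrs E z))) \<le> (\<Sum>z\<in>{z \<in> Z. part z \<noteq> l}. 7 * ?rS)"
      proof (rule sum_mono)
        fix z assume z: "z \<in> {z \<in> Z. part z \<noteq> l}"
        then have zV: "z \<in> V" "part z \<noteq> l" using Z(1) by auto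
        have "V0 l - nbrs E z \<subseteq> V - nbrs E z - V0 (part z)"
          using V0V[OF l] V0dis[OF l part(1), of z] zV(2) by blast
        then have "card (V0 l - nbrs E z) \<le> card (V - nbrs E z - V0 (part z))"
          by (rule card_mono[rotated]) (use finV in simp)
        then show "real (card (V0 l - nbrs E z)) \<le> 7 * ?rS" using nn_part[OF zV(1)] by linarith
      qed
      also have "\<dots> \<le> (2 * real c) * (7 * ?rS)"
      proof -
        have "card {z \<in> Z. part z \<noteq> l} \<le> card Z" by (rule card_mono[OF finZ]) auto
        then have "real (card {z \<in> Z. part z \<noteq> l}) \<le> real (2 * c)"
          using Z(2) by (simp only: of_nat_le_iff)
        then have "real (card {z \<in> Z. part z \<noteq> l}) * (7 * ?rS) \<le> (2 * real c) * (7 * ?rS)"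
          by (intro mult_right_mono) (use rS0 in simp_all)
        then show ?thesis by simp
      qed
      also have "\<dots> = 14 * w" by (simp add: algebra_simps)
      finally have a: "real (card (V0 l - X l)) \<le> real (card Z) + 14 * w" by simp
      have "X l \<subseteq> V0 l" by (auto simp: X_def)
      then have "card (V0 l) = card (X l) + card (V0 l - X l)"
        using card_Int_Diff[OF finV0[OF l], of "X l"] by (simp add: Int_absorb1)
      moreover have "real (card Z) \<le> 2 * real c" using Z(2) by linarith
      ultimately show ?thesis
        using a V0lo[OF l] bounds(3,4,6,7,8) u0 by linarith
    qed
    have "\<exists>P. multipartite E {..<r} S P \<and> (\<forall>l<r. P l \<subseteq> X l)"
      by (rule greedy) (use cX in \<open>auto simp: X_def\<close>)
    then obtain P where P: "multipartite E {..<r} S P" "\<And>l. l < r \<Longrightarrow> P l \<subseteq> X l" by blast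
    show ?thesis
    proof (intro exI[of _ P] conjI allI impI ballI P(1))
      fix l assume "l < r"
      then show "P l \<subseteq> V0 l" "P l \<inter> Z = {}" using P(2)[of l] by (auto simp: X_def)
      fix z a assume "z \<in> Z" "part z \<noteq> l" "a \<in> P l"
      then show "{z, a} \<in> E" using P(2)[OF \<open>l < r\<close>] by (auto simp: X_def)
    qed
  qed
  let ?I = "inner part E"
  have I2: "?I \<subseteq> [V]\<^bsup>2\<^esup>" using E2 inner_subset by blast
  have deg_inner: "card (nbrs ?I x) < K" if x: "x \<in> V" for x
  proof (rule ccontr)
    assume "\<not> ?thesis"
    then obtain Y where Y: "Y \<subseteq> nbrs ?I x" "card Y = K" "finite Y"
      by (meson not_le obtain_subset_with_card_n)
    have "Y \<subseteq> V" using Y(1) nbrs_subset[OF I2, of x] by blast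
    moreover have "card (insert x Y) \<le> 2 * c"
      using card_insert_le_m1[of "Suc K" Y x] Y(2,3) c by simp
    ultimately have "\<exists>P. multipartite E {..<r} S P \<and>
      (\<forall>l<r. P l \<subseteq> V0 l \<and> P l \<inter> insert x Y = {} \<and> (\<forall>z\<in>insert x Y. part z \<noteq> l \<longrightarrow> (\<forall>a\<in>P l. {z, a} \<in> E)))"
      by (intro supplies) (use x in auto)
    then obtain P where P': "multipartite E {..<r} S P \<and>
      (\<forall>l<r. P l \<subseteq> V0 l \<and> P l \<inter> insert x Y = {} \<and> (\<forall>z\<in>insert x Y. part z \<noteq> l \<longrightarrow> (\<forall>a\<in>P l. {z, a} \<in> E)))" ..
    have P1: "multipartite E {..<r} S P" using P' by (rule conjunct1)
    have P2: "{z, a} \<in> E" if "l < r" "z \<in> insert x Y" "part z \<noteq> l" "a \<in> P l" for l z a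
      using conjunct2[OF P'] that by blast
    have pY: "part y = part x" "{x, y} \<in> E" if "y \<in> Y" for y using Y(1) that by auto
    have "fan_in r s K E"
    proof (rule fan_in_star[where p = "part x" and P = P and x = x and Y = Y])
      show "finite (P j) \<and> s \<le> card (P j)" if "j < r" for j
        using P1 that S by (auto simp: multipartite_def)
      show "{a, b} \<in> E" if "j < r" "l < r" "l \<noteq> j" "a \<in> P j" "b \<in> P l" for j l a b
        using P1 that by (auto simp: multipartite_def)
      show "{y, a} \<in> E" if "j < r" "j \<noteq> part x" "y \<in> Y" "a \<in> P j" for j y a
        using P2[OF that(1) _ _ that(4)] that pY by auto
    qed (use P2 pY Y part(1) in auto)
    then show False using no_fan by simp
  qed
  have matching: "card Q < K" if j: "j < r" and Q: "Q \<subseteq> class_edges part E j" "disjoint Q" for j Q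
  proof (rule ccontr)
    assume "\<not> ?thesis"
    then obtain R where R: "R \<subseteq> Q" "card R = K" "finite R"
      by (meson not_le obtain_subset_with_card_n)
    have RE: "R \<subseteq> E" "disjoint R" and Rj: "\<And>e y. e \<in> R \<Longrightarrow> y \<in> e \<Longrightarrow> part y = j"
      using R(1) Q by (auto simp: class_edges_def intro: pairwise_subset)
    have R2: "R \<subseteq> [V]\<^bsup>2\<^esup>" using RE(1) E2 by blast
    let ?Z = "\<Union>R"
    have ZV: "?Z \<subseteq> V" using R2 by (auto simp: nsets_def)
    have cZ: "card ?Z = 2 * K" using card_Union_matching[OF finV R2 RE(2)] R(2) by simp
    define p where "p = (if j = 0 then 1 else 0 :: nat)"
    have p: "p < r" "p \<noteq> j" using r2 by (auto simp: p_def)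
    \<comment> \<open>Supplies are requested twice: here to find a centre \<open>x\<close> of
      another class joined to all ends of the matching, and below to find fillers that also respect
      \<open>x\<close>.\<close>
    have "\<exists>P. multipartite E {..<r} S P \<and>
      (\<forall>l<r. P l \<subseteq> V0 l \<and> P l \<inter> ?Z = {} \<and> (\<forall>z\<in>?Z. part z \<noteq> l \<longrightarrow> (\<forall>a\<in>P l. {z, a} \<in> E)))"
      by (rule supplies[OF ZV]) (use cZ c in simp)
    then obtain A1 where A1': "multipartite E {..<r} S A1 \<and>
      (\<forall>l<r. A1 l \<subseteq> V0 l \<and> A1 l \<inter> ?Z = {} \<and> (\<forall>z\<in>?Z. part z \<noteq> l \<longrightarrow> (\<forall>a\<in>A1 l. {z, a} \<in> E)))" ..
    have A1: "multipartite E {..<r} S A1" using A1' by (rule conjunct1)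
    have A1V: "A1 p \<subseteq> V0 p" using conjunct2[OF A1'] p(1) by blast
    have A1E: "{z, a} \<in> E" if "z \<in> ?Z" "part z \<noteq> p" "a \<in> A1 p" for z a
      using conjunct2[OF A1'] p(1) that by blast
    have "card (A1 p) = S" using A1 p(1) by (auto simp: multipartite_def)
    then have "A1 p \<noteq> {}" using S by auto
    then obtain x where x: "x \<in> A1 p" by blast
    then have xV: "x \<in> V" "part x = p" using A1V V0V[OF p(1)] part_V0[OF p(1)] by auto
    have xZ: "{x, z} \<in> E" if "z \<in> ?Z" for z
    proof -
      have "part z \<noteq> p" using that Rj p(2) by auto
      then show ?thesis using A1E[OF that _ x] by (simp add: insert_commute)
    qed
    have "card (insert x ?Z) \<le> 2 * c" using card_insert_le_m1[of "2 * K + 1" ?Z x] cZ c by simp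
    then have "\<exists>P. multipartite E {..<r} S P \<and>
      (\<forall>l<r. P l \<subseteq> V0 l \<and> P l \<inter> insert x ?Z = {} \<and> (\<forall>z\<in>insert x ?Z. part z \<noteq> l \<longrightarrow> (\<forall>a\<in>P l. {z, a} \<in> E)))"
      by (intro supplies) (use ZV xV(1) in simp_all)
    then obtain P where P': "multipartite E {..<r} S P \<and>
      (\<forall>l<r. P l \<subseteq> V0 l \<and> P l \<inter> insert x ?Z = {} \<and> (\<forall>z\<in>insert x ?Z. part z \<noteq> l \<longrightarrow> (\<forall>a\<in>P l. {z, a} \<in> E)))" ..
    have P1: "multipartite E {..<r} S P" using P' by (rule conjunct1)
    have PZ: "P l \<inter> insert x ?Z = {}" if "l < r" for l using conjunct2[OF P'] that by blast
    have P2: "{z, a} \<in> E" if "l < r" "z \<in> insert x ?Z" "part z \<noteq> l" "a \<in> P l" for l z a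
      using conjunct2[OF P'] that by blast
    have "fan_at r s K E p x P {} R"
      unfolding fan_at_def
    proof (intro conjI allI impI ballI)
      show "finite (P l)" "s \<le> card (P l)" if "l < r" for l
        using P1 that S by (auto simp: multipartite_def)
      show "{x, a} \<in> E" if "l < r" "l \<noteq> p" "a \<in> P l" for l a
        using P2[OF that(1) _ _ that(3), of x] that(2) xV(2) by auto
      show "{a, b} \<in> E" if "i < r" "l < r" "l \<noteq> i" "a \<in> P i" "b \<in> P l" for i l a b
        using P1 that by (auto simp: multipartite_def)
      fix e assume e: "e \<in> R"
      show "\<exists>l<r. l \<noteq> p \<and> e \<inter> P l = {} \<and>
        (\<forall>y\<in>e. {x, y} \<in> E \<and> (\<forall>i<r. i \<noteq> p \<longrightarrow> i \<noteq> l \<longrightarrow> (\<forall>a\<in>P i. {y, a} \<in> E)))"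
      proof (intro exI[of _ j] conjI ballI allI impI)
        show "e \<inter> P j = {}" using PZ[OF j] e by auto
        fix y assume y: "y \<in> e"
        then show "{x, y} \<in> E" using xZ e by blast
        fix i a assume "i < r" "i \<noteq> p" "i \<noteq> j" "a \<in> P i"
        then show "{y, a} \<in> E" using P2[of i y a] Rj[OF e y] e y by blast
      qed (use j p in auto)
    qed (use p RE R in auto)
    then show False using no_fan unfolding fan_in_def by blast
  qed
  have class_card: "card (class_edges part E j) \<le> K * K" if j: "j < r" for j
  proof -
    have C2: "class_edges part E j \<subseteq> [V]\<^bsup>2\<^esup>" using E2 by (auto simp: class_edges_def)
    have CI: "class_edges part E j \<subseteq> ?I" by (auto simp: class_edges_def inner_def)
    have finC: "finite (class_edges part E j)" by (rule finite_edges[OF finV C2])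
    have "card (class_edges part E j) \<le> excess K"
    proof (rule degree_matching_edge_bound(1)[OF finV C2 K1])
      fix x assume x: "x \<in> V"
      have "card (nbrs (class_edges part E j) x) \<le> card (nbrs ?I x)"
        by (rule card_mono[OF finite_nbrs[OF finV I2]]) (use CI in \<open>auto simp: nbrs_def\<close>)
      then show "card (nbrs (class_edges part E j) x) \<le> K - 1" using deg_inner[OF x] by simp
    next
      obtain M where "M \<subseteq> class_edges part E j" "disjoint M" "card M = matching_number (class_edges part E j)"
        using maximum_matching[OF finC] .
      then show "matching_number (class_edges part E j) \<le> K - 1" using matching[OF j, of M] by simp
    qed
    also have "\<dots> \<le> K * K"
    proof (cases "odd K")
      case False
      then obtain i where "K = 2 * i" by auto
      then show ?thesis by (simp add: excess_def algebra_simps)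
    qed (simp add: excess_def)
    finally show ?thesis .
  qed
  have ne: "e \<noteq> {}" if "e \<in> E" for e using that E2 by (auto simp: nsets_def)
  have inner_card: "card ?I \<le> r * (K * K)"
  proof -
    have "?I \<subseteq> (\<Union>j<r. class_edges part E j)"
    proof
      fix e assume "e \<in> ?I"
      then obtain i where i: "part ` e \<subseteq> {i}" "e \<in> E" by (auto simp: inner_def)
      then obtain x where "x \<in> e" using ne by blast
      then have "i < r" using i part(1)[of x] by blast
      then show "e \<in> (\<Union>j<r. class_edges part E j)" using i by (auto simp: class_edges_def)
    qed
    then have "card ?I \<le> card (\<Union>j<r. class_edges part E j)"
      by (rule card_mono[rotated]) (use finite_edges[OF finV E2] in \<open>auto simp: class_edges_def\<close>)
    also have "\<dots> \<le> (\<Sum>j<r. card (class_edges part E j))" by (rule card_UN_le) simp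
    also have "\<dots> \<le> (\<Sum>j<r. K * K)" by (rule sum_mono) (use class_card in auto)
    finally show ?thesis by simp
  qed
  let ?M = "missing V part E"
  have range: "part ` V \<subseteq> {..<r}" using part(1) by auto
  \<comment> \<open>Otherwise \<open>E\<close> would have fewer edges than the Turan graph.\<close>
  have "card ?M \<le> card ?I"
    using card_inner_missing[OF finV E2, of part] cross_pairs_le_turan[OF _ finV range] r2 edges by linarith
  have fin: "finite ?I" "finite ?M" using finite_edges[OF finV I2] finite_edges[OF finV missing_subset] .
  let ?B = "\<Union>(?I \<union> ?M)"
  have cB: "card ?B \<le> 4 * (r * (K * K))"
  proof -
    have sub: "?I \<union> ?M \<subseteq> [V]\<^bsup>2\<^esup>" using I2 missing_subset by blast
    have "card ?B \<le> (\<Sum>e\<in>?I \<union> ?M. card e)" using card_UN_le[of "?I \<union> ?M" id] fin by simp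
    also have "\<dots> = (\<Sum>e\<in>?I \<union> ?M. 2)" by (rule sum.cong) (use sub in \<open>auto simp: nsets_def\<close>)
    also have "\<dots> \<le> 2 * (card ?I + card ?M)" using card_Un_le[of ?I ?M] by simp
    also have "\<dots> \<le> 4 * (r * (K * K))" using inner_card \<open>card ?M \<le> card ?I\<close> by simp
    finally show ?thesis .
  qed
  have finB: "finite ?B"
    by (rule finite_subset[OF _ finV]) (use I2 missing_subset[of V part E] in \<open>auto simp: nsets_def\<close>)
  show ?thesis
  proof (rule that[OF range])
    fix j assume j: "j < r"
    let ?G = "{x \<in> V. part x = j \<and> (\<forall>y\<in>V. y \<noteq> x \<longrightarrow> ({x, y} \<in> E \<longleftrightarrow> part y \<noteq> j))}"
    \<comment> \<open>\<open>?B\<close> collects the ends of all inner and all missing edges; a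
      vertex outside it has exactly the adjacencies prescribed by the classes.\<close>
    have "V0 j - ?B \<subseteq> ?G"
    proof
      fix x assume x: "x \<in> V0 j - ?B"
      then have xV: "x \<in> V" "part x = j" using V0V[OF j] part_V0[OF j] by auto
      have "{x, y} \<in> E \<longleftrightarrow> part y \<noteq> j" if y: "y \<in> V" "y \<noteq> x" for y
      proof -
        have "{x, y} \<notin> ?I" "{x, y} \<notin> ?M" using x by blast+
        then show ?thesis using xV y by auto
      qed
      then show "x \<in> ?G" using xV by blast
    qed
    then have "card (V0 j - ?B) \<le> card ?G" by (rule card_mono[rotated]) (use finV in simp)
    moreover have "card (V0 j) - card ?B \<le> card (V0 j - ?B)" by (rule diff_card_le_card_Diff[OF finB])
    ultimately have "real (card (V0 j)) - real (4 * (r * (K * K))) \<le> card ?G" using cB by linarith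
    moreover have "real (4 * (r * (K * K))) \<le> 4 * (real r * real c * real c)"
    proof -
      have "r * (K * K) \<le> r * (c * c)" using c by (intro mult_le_mono) auto
      then have "real (r * (K * K)) \<le> real (r * (c * c))" by (rule of_nat_mono)
      then show ?thesis by (simp add: mult.assoc)
    qed
    moreover have "real L \<le> n / r - 2 * u - u" using bounds(5,6,8) u0 by linarith
    moreover have "4 * (real r * real c * real c) \<le> u"
    proof -
      have "0 \<le> real r * real c * real c" by simp
      then show ?thesis using bounds(2) by linarith
    qed
    ultimately have "real L \<le> real (card ?G)" using V0lo[OF j] by linarith
    then show "L \<le> card ?G" by simp
  qed
qed

end

section \<open>Passing to a dense subgraph\<close>

lemma fan_in_mono:
  assumes "fan_in r s K E" "E \<subseteq> F"
  shows "fan_in r s K F"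
proof -
  have EF: "{a, b} \<in> F" if "{a, b} \<in> E" for a b using assms(2) that by blast
  obtain p x P Y Q where *: "fan_at r s K E p x P Y Q" using assms(1) unfolding fan_in_def by blast
  have "fan_at r s K F p x P Y Q"
    unfolding fan_at_def
  proof (intro conjI)
    note D = *[unfolded fan_at_def]
    show "\<forall>e\<in>Q. \<exists>l<r. l \<noteq> p \<and> e \<inter> P l = {} \<and>
        (\<forall>y\<in>e. {x, y} \<in> F \<and> (\<forall>j<r. j \<noteq> p \<longrightarrow> j \<noteq> l \<longrightarrow> (\<forall>a\<in>P j. {y, a} \<in> F)))"
    proof
      fix e assume "e \<in> Q"
      then have "\<exists>l<r. l \<noteq> p \<and> e \<inter> P l = {} \<and>
          (\<forall>y\<in>e. {x, y} \<in> E \<and> (\<forall>j<r. j \<noteq> p \<longrightarrow> j \<noteq> l \<longrightarrow> (\<forall>a\<in>P j. {y, a} \<in> E)))"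
        using D by simp
      then obtain l where "l < r" "l \<noteq> p" "e \<inter> P l = {}"
        "\<forall>y\<in>e. {x, y} \<in> E \<and> (\<forall>j<r. j \<noteq> p \<longrightarrow> j \<noteq> l \<longrightarrow> (\<forall>a\<in>P j. {y, a} \<in> E))"
        by (elim exE conjE) (rule that)
      then show "\<exists>l<r. l \<noteq> p \<and> e \<inter> P l = {} \<and>
          (\<forall>y\<in>e. {x, y} \<in> F \<and> (\<forall>j<r. j \<noteq> p \<longrightarrow> j \<noteq> l \<longrightarrow> (\<forall>a\<in>P j. {y, a} \<in> F)))"
        using EF by (intro exI[of _ l]) simp
    qed
    show "Q \<subseteq> F" using D assms(2) by auto
  qed (use * EF in \<open>simp_all add: fan_at_def\<close>)
  then show ?thesis unfolding fan_in_def by blast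
qed

text \<open>Deleting a vertex of too small degree raises the surplus over the Turan number by at
  least one. A minimal set whose surplus has grown by the number of deleted vertices therefore
  satisfies the degree condition.\<close>

lemma dense_subgraph:
  fixes E :: "'v set set"
  assumes r: "r > 0" and fV: "finite V" and E: "E \<subseteq> [V]\<^bsup>2\<^esup>"
    and e: "turan_number r (card V) + q \<le> card E" and N: "N * N + N < card V"
  obtains W where "W \<subseteq> V" "N \<le> card W" "turan_degree r W {e \<in> E. e \<subseteq> W}"
    "turan_number r (card W) + q \<le> card {e \<in> E. e \<subseteq> W}"
proof -
  let ?E = "\<lambda>W. {e \<in> E. e \<subseteq> W}"
  let ?ok = "\<lambda>W. W \<subseteq> V \<and> N \<le> card W \<and> turan_number r (card W) + q + card V \<le> card (?E W) + card W"
  have "?E V = E" using E by (auto simp: nsets_def)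
  then have "?ok V" using e N by simp
  then obtain W where W: "?ok W" and min: "\<And>W'. ?ok W' \<Longrightarrow> card W \<le> card W'"
    using ex_has_least_nat[of ?ok V card] by blast
  have finW: "finite W" using W fV finite_subset by blast
  have E2: "?E X \<subseteq> [X]\<^bsup>2\<^esup>" for X using E by (auto simp: nsets_def)
  have "card W \<le> card V" using W fV by (intro card_mono) auto
  have "turan_degree r W (?E W)"
  proof (rule ccontr)
    assume "\<not> ?thesis"
    then obtain x where x: "x \<in> W" "card (nbrs (?E W) x) < card W - 1 - (card W - 1) div r"
      unfolding turan_degree_def by (auto simp: not_le)
    let ?W = "W - {x}"
    have eq: "?E ?W = ?E W - {e \<in> ?E W. x \<in> e}" by auto
    have fin: "finite (?E W)" by (rule finite_edges[OF finW E2])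
    have "card (?E ?W) = card (?E W) - card {e \<in> ?E W. x \<in> e}"
      unfolding eq by (rule card_Diff_subset) (auto intro: finite_subset[OF _ fin])
    then have cE: "card (?E W) \<le> card (?E ?W) + card (nbrs (?E W) x)"
      using card_nbrs[OF E2, of W x] by simp
    have cW: "card W = Suc (card ?W)" using x(1) finW by (metis card_Suc_Diff1)
    have t: "turan_number r (card W) = turan_number r (card ?W) + (card ?W - card ?W div r)"
      unfolding cW by (rule turan_number_Suc[OF r])
    \<comment> \<open>Deletion stops before size \<open>N\<close>: a set of \<open>N\<close>
      vertices has at most \<open>N * N\<close> edges, while the accumulated surplus would require
      more.\<close>
    have "N \<le> card ?W"
    proof (rule ccontr)
      assume "\<not> N \<le> card ?W"
      then have "card W = N" using W cW by simp
      have "card (?E W) \<le> card ([W]\<^bsup>2\<^esup>)"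
        by (rule card_mono[OF finite_imp_finite_nsets[OF finW] E2])
      also have "\<dots> \<le> N * N" using card_pairs[OF finW] \<open>card W = N\<close>
        by (simp add: div_le_dividend le_trans[OF div_le_dividend] mult_le_mono2)
      finally show False using W N \<open>card W = N\<close> by linarith
    qed
    moreover have "turan_number r (card ?W) + q + card V \<le> card (?E ?W) + card ?W"
    proof -
      have "card (nbrs (?E W) x) < card ?W - card ?W div r" using x(2) unfolding cW by simp
      then show ?thesis using W t cE cW by linarith
    qed
    ultimately have "?ok ?W" using W by blast
    then have "card W \<le> card ?W" by (rule min)
    then show False using cW by simp
  qed
  then show ?thesis using that W \<open>card W \<le> card V\<close> by auto
qed

text \<open>The excluded number \<open>K\<close> of blades and the surplus \<open>q\<close> are
  independent parameters: for colourings \<open>K = k + 1\<close> is combined with a surplus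
  calibrated for \<open>k\<close>. The surplus survives the passage to \<open>W\<close>.\<close>

lemma generic_structure:
  fixes r s K q L :: nat
  assumes r: "r \<ge> 2" and K: "K \<ge> 1"
  shows "\<exists>N. \<forall>(V :: 'v set) E. finite V \<longrightarrow> N \<le> card V \<longrightarrow> E \<subseteq> [V]\<^bsup>2\<^esup> \<longrightarrow>
    turan_number r (card V) + q \<le> card E \<longrightarrow> \<not> fan_in r s K E \<longrightarrow>
    (\<exists>W part. W \<subseteq> V \<and> part ` W \<subseteq> {..<r} \<and> turan_number r (card W) + q \<le> card {e \<in> E. e \<subseteq> W} \<and>
      (\<forall>j<r. L \<le> card {x \<in> W. part x = j \<and> (\<forall>y\<in>W. y \<noteq> x \<longrightarrow> ({x, y} \<in> E \<longleftrightarrow> part y \<noteq> j))}))"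
proof -
  define S c where "S = s + K + 1" and "c = K + 1"
  define D where "D = 40 * real r * real r * real S * real c"
  have D0: "D > 0" using r by (simp add: D_def S_def c_def)
  define m where "m = 160 * r * r * S * S * c * c"
  have "\<exists>N. \<forall>(V :: 'v set) E. finite V \<longrightarrow> N \<le> card V \<longrightarrow> E \<subseteq> [V]\<^bsup>2\<^esup> \<longrightarrow>
    turan_degree r V E \<longrightarrow> (\<exists>A. multipartite E {..<r} m A \<and> (\<forall>j<r. A j \<subseteq> V))"
    by (rule multipartite_exists) (use r in simp_all)
  then obtain N1 where "\<forall>(V :: 'v set) E. finite V \<longrightarrow> N1 \<le> card V \<longrightarrow> E \<subseteq> [V]\<^bsup>2\<^esup> \<longrightarrow>
    turan_degree r V E \<longrightarrow> (\<exists>A. multipartite E {..<r} m A \<and> (\<forall>j<r. A j \<subseteq> V))" ..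
  note N1 = this[rule_format]
  define N2 where "N2 = nat \<lceil>(100 * real r * real S * real c * real c + L) * D\<rceil>"
  define N where "N = max N1 N2"
  have "\<exists>W part. W \<subseteq> V \<and> part ` W \<subseteq> {..<r} \<and> turan_number r (card W) + q \<le> card {e \<in> E. e \<subseteq> W} \<and>
      (\<forall>j<r. L \<le> card {x \<in> W. part x = j \<and> (\<forall>y\<in>W. y \<noteq> x \<longrightarrow> ({x, y} \<in> E \<longleftrightarrow> part y \<noteq> j))})"
    if V: "finite V" "N * N + N + 1 \<le> card V" "E \<subseteq> [V]\<^bsup>2\<^esup>"
      and e: "turan_number r (card V) + q \<le> card E" and nofan: "\<not> fan_in r s K E" for V :: "'v set" and E
  proof -
    obtain W where W: "W \<subseteq> V" "N \<le> card W" "turan_degree r W {e \<in> E. e \<subseteq> W}"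
      "turan_number r (card W) + q \<le> card {e \<in> E. e \<subseteq> W}"
      using dense_subgraph[OF _ V(1,3) e, of N] V(2) r by auto
    let ?E = "{e \<in> E. e \<subseteq> W}"
    have finW: "finite W" using W(1) V(1) by (rule finite_subset)
    have E2: "?E \<subseteq> [W]\<^bsup>2\<^esup>" using V(3) by (auto simp: nsets_def)
    have nofanW: "\<not> fan_in r s K ?E"
    proof
      assume "fan_in r s K ?E"
      then have "fan_in r s K E" by (rule fan_in_mono) auto
      then show False using nofan by simp
    qed
    have large: "100 * real r * real S * real c * real c + L \<le> 1 / D * card W"
    proof -
      have "(100 * real r * real S * real c * real c + L) * D \<le> real N2"
        unfolding N2_def by (rule real_nat_ceiling_ge)
      also have "\<dots> \<le> real (card W)" using W(2) by (simp add: N_def)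
      finally show ?thesis using D0 by (simp add: field_simps)
    qed
    interpret dense_fan_free W ?E r s K L S c "1 / D"
    proof (unfold_locales)
      show "1 / D * (40 * real r * real r * real S * real c) = 1"
        unfolding D_def[symmetric] using D0 by simp
    qed (use finW E2 r K W nofanW large in \<open>simp_all add: S_def c_def\<close>)
    have "N1 \<le> card W" using W(2) by (simp add: N_def)
    then obtain A where A: "multipartite ?E {..<r} m A" "\<And>j. j < r \<Longrightarrow> A j \<subseteq> W"
      using N1[OF finW _ E2 W(3)] by blast
    obtain part where part: "part ` W \<subseteq> {..<r}"
      "\<And>j. j < r \<Longrightarrow> L \<le> card {x \<in> W. part x = j \<and> (\<forall>y\<in>W. y \<noteq> x \<longrightarrow> ({x, y} \<in> ?E \<longleftrightarrow> part y \<noteq> j))}"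
      using generic_partition[OF A m_def] by blast
    have "{x \<in> W. part x = j \<and> (\<forall>y\<in>W. y \<noteq> x \<longrightarrow> ({x, y} \<in> ?E \<longleftrightarrow> part y \<noteq> j))} =
        {x \<in> W. part x = j \<and> (\<forall>y\<in>W. y \<noteq> x \<longrightarrow> ({x, y} \<in> E \<longleftrightarrow> part y \<noteq> j))}" for j
      by (rule Collect_cong) auto
    then show ?thesis using W(1,4) part by (intro exI[of _ W] exI[of _ part]) simp
  qed
  then show ?thesis by blast
qed

text \<open>Generic vertices can serve as fillers for any centre and seeds, once the at most
  \<open>2 * card Q\<close> ends of the edge seeds are set aside.\<close>

lemma fan_in_generic:
  assumes F: "F \<subseteq> [W]\<^bsup>2\<^esup>" and x: "x \<in> W" "part x < r"
    and Y: "finite Y" "\<And>y. y \<in> Y \<Longrightarrow> y \<in> W \<and> part y = part x \<and> {x, y} \<in> F"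
    and Q: "finite Q" "disjoint Q"
      "\<And>e. e \<in> Q \<Longrightarrow> e \<in> F \<and> e \<subseteq> nbrs F x \<and> (\<exists>l<r. l \<noteq> part x \<and> part ` e \<subseteq> {l})"
    and G: "\<And>j. j < r \<Longrightarrow> finite (G j) \<and> s + 2 * card Q \<le> card (G j)"
      "\<And>j a. j < r \<Longrightarrow> a \<in> G j \<Longrightarrow> a \<in> W \<and> part a = j \<and> (\<forall>y\<in>W. part y \<noteq> j \<longrightarrow> {a, y} \<in> F)"
    and K: "K \<le> card Y + card Q"
  shows "fan_in r s K F"
proof -
  define P where "P j = G j - \<Union>Q" for j
  have QW: "y \<in> W" if "e \<in> Q" "y \<in> e" for e y using Q(3)[OF that(1)] F that(2) by (auto simp: nsets_def)
  have PF: "{y, a} \<in> F" if "j < r" "a \<in> P j" "y \<in> W" "part y \<noteq> j" for j a y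
  proof -
    have "{a, y} \<in> F" using G(2)[OF that(1), of a] that by (simp add: P_def)
    then show ?thesis by (subst insert_commute)
  qed
  have Ppart: "a \<in> W" "part a = j" if "j < r" "a \<in> P j" for j a
    using G(2)[OF that(1), of a] that by (simp_all add: P_def)
  have cP: "s \<le> card (P j)" if "j < r" for j
  proof -
    have "card (\<Union>Q) \<le> (\<Sum>e\<in>Q. card e)" using card_UN_le[OF Q(1), of id] by simp
    also have "\<dots> = (\<Sum>e\<in>Q. 2)" by (rule sum.cong) (use Q(3) F in \<open>auto simp: nsets_def\<close>)
    finally have "card (\<Union>Q) \<le> 2 * card Q" by simp
    moreover have "finite (\<Union>Q)" using Q(1,3) F by (auto simp: nsets_def)
    then have "card (G j) - card (\<Union>Q) \<le> card (P j)" unfolding P_def by (rule diff_card_le_card_Diff)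
    ultimately show ?thesis using G(1)[OF that] by linarith
  qed
  have "fan_at r s K F (part x) x P Y Q"
    unfolding fan_at_def
  proof (intro conjI allI impI ballI)
    show "finite (P j)" "s \<le> card (P j)" if "j < r" for j using G(1)[OF that] cP[OF that] by (auto simp: P_def)
    show "{x, a} \<in> F" if "j < r" "j \<noteq> part x" "a \<in> P j" for j a
      using PF[OF that(1,3) x(1)] that(2) by simp
    show "{y, a} \<in> F" if "j < r" "j \<noteq> part x" "y \<in> Y" "a \<in> P j" for j y a
      using PF[OF that(1,4)] Y(2)[OF that(3)] that(2) by simp
    show "{a, b} \<in> F" if "j < r" "l < r" "l \<noteq> j" "a \<in> P j" "b \<in> P l" for j l a b
      using PF[OF that(2,5) Ppart(1)[OF that(1,4)]] Ppart(2)[OF that(1,4)] that(3) by simp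
    show "Y \<inter> \<Union>Q = {}"
    proof (rule equals0I)
      fix y assume "y \<in> Y \<inter> \<Union>Q"
      then obtain e where e: "y \<in> Y" "e \<in> Q" "y \<in> e" by auto
      then show False using Q(3)[OF e(2)] Y(2)[OF e(1)] by auto
    qed
    fix e assume e: "e \<in> Q"
    then obtain l where l: "l < r" "l \<noteq> part x" "part ` e \<subseteq> {l}" using Q(3) by blast
    show "\<exists>l<r. l \<noteq> part x \<and> e \<inter> P l = {} \<and>
        (\<forall>y\<in>e. {x, y} \<in> F \<and> (\<forall>j<r. j \<noteq> part x \<longrightarrow> j \<noteq> l \<longrightarrow> (\<forall>a\<in>P j. {y, a} \<in> F)))"
    proof (intro exI[of _ l] conjI ballI allI impI)
      show "e \<inter> P l = {}" using e by (auto simp: P_def)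
      fix y assume y: "y \<in> e"
      then show "{x, y} \<in> F" using Q(3)[OF e] by auto
      fix j a assume ja: "j < r" "j \<noteq> part x" "j \<noteq> l" "a \<in> P j"
      have "part y = l" using l(3) y by auto
      then show "{y, a} \<in> F" using PF[OF ja(1,4) QW[OF e y]] ja(3) by simp
    qed (use l in auto)
  qed (use x Y Q K in auto)
  then show ?thesis unfolding fan_in_def by blast
qed

lemma has_genericI:
  assumes "\<And>j. j < r \<Longrightarrow> G j \<noteq> {}"
    "\<And>j a. j < r \<Longrightarrow> a \<in> G j \<Longrightarrow> a \<in> W \<and> part a = j \<and> (\<forall>y\<in>W. part y \<noteq> j \<longrightarrow> {a, y} \<in> F)"
  shows "has_generic W part F r"
  unfolding has_generic_def
proof (intro allI impI)
  fix i assume i: "i < r"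
  then obtain a where "a \<in> G i" using assms(1) by blast
  then show "\<exists>x\<in>W. part x = i \<and> (\<forall>y\<in>W. part y \<noteq> i \<longrightarrow> {x, y} \<in> F)"
    using assms(2)[OF i] by blast
qed

lemma inner_edgeE:
  assumes "F \<subseteq> [W]\<^bsup>2\<^esup>" "e \<in> inner part F" "part ` W \<subseteq> {..<r}" "i \<notin> part ` e"
  shows "\<exists>l<r. l \<noteq> i \<and> part ` e \<subseteq> {l}"
proof -
  obtain l where l: "part ` e \<subseteq> {l}" "e \<in> F" using assms(2) by (auto simp: inner_def)
  then have "e \<in> [W]\<^bsup>2\<^esup>" using assms(1) by blast
  then obtain a b where ab: "e = {a, b}" "a \<in> W" "b \<in> W" "a \<noteq> b" by (elim nsets2_E)
  then have "part a = l" using l by auto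
  then show ?thesis using l ab assms(3,4) by auto
qed

lemma not_fan_boundedE:
  assumes "\<not> fan_bounded W part F k"
  obtains x Y Q where "x \<in> W" "Y \<subseteq> nbrs (inner part F) x" "disjoint Q" "k \<le> card Y + card Q"
    "\<And>e. e \<in> Q \<Longrightarrow> e \<in> inner part F \<and> part x \<notin> part ` e \<and> e \<subseteq> nbrs F x"
proof -
  obtain x Y Q where *: "x \<in> W" "Y \<subseteq> nbrs (inner part F) x"
    "Q \<subseteq> {e \<in> inner part F. part x \<notin> part ` e \<and> e \<subseteq> nbrs F x}" "disjoint Q" "\<not> card Y + card Q < k"
    using assms unfolding fan_bounded_def by blast
  show ?thesis
    by (rule that[OF *(1,2,4)]) (use *(3,5) in auto)
qed

text \<open>Extracting exactly \<open>k\<close> petals keeps the number of occupied vertices bounded.\<close>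

lemma not_fan_bounded_exact:
  assumes "\<not> fan_bounded W part F k" "finite W" "F \<subseteq> [W]\<^bsup>2\<^esup>"
  obtains x Y Q where "x \<in> W" "Y \<subseteq> nbrs (inner part F) x" "finite Y" "disjoint Q" "finite Q"
    "card Y + card Q = k"
    "\<forall>e\<in>Q. e \<in> inner part F \<and> part x \<notin> part ` e \<and> e \<subseteq> nbrs F x"
proof -
  obtain x Y Q where *: "x \<in> W" "Y \<subseteq> nbrs (inner part F) x" "disjoint Q" "k \<le> card Y + card Q"
    "\<And>e. e \<in> Q \<Longrightarrow> e \<in> inner part F \<and> part x \<notin> part ` e \<and> e \<subseteq> nbrs F x"
    using not_fan_boundedE[OF assms(1)] by metis
  have I2: "inner part F \<subseteq> [W]\<^bsup>2\<^esup>" using assms(3) inner_subset by blast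
  have finY: "finite Y" using *(2) finite_nbrs[OF assms(2) I2] by (rule finite_subset)
  have "Q \<subseteq> inner part F" using *(5) by blast
  then have finQ: "finite Q" using finite_edges[OF assms(2) I2] by (rule finite_subset)
  obtain Y' where Y': "Y' \<subseteq> Y" "card Y' = min k (card Y)" "finite Y'"
    using obtain_subset_with_card_n[of "min k (card Y)" Y] by auto
  have "k - card Y' \<le> card Q" using *(4) Y'(2) by linarith
  then obtain Q' where Q': "Q' \<subseteq> Q" "card Q' = k - card Y'" "finite Q'"
    by (meson obtain_subset_with_card_n)
  show ?thesis
  proof (rule that[of x Y' Q'])
    show "disjoint Q'" using *(3) Q'(1) by (rule pairwise_subset)
    show "card Y' + card Q' = k" using Y'(2) Q'(2) by simp
  qed (use * Y' Q' in auto)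
qed

section \<open>Dense graphs and dense rainbow graphs contain fans\<close>

lemma inner_excess:
  assumes "finite W" "F \<subseteq> [W]\<^bsup>2\<^esup>" "part ` W \<subseteq> {..<r}" "r \<ge> 2" "turan_number r (card W) + q \<le> card F"
  shows "q + card (missing W part F) \<le> card (inner part F)"
  using card_inner_missing[OF assms(1,2), of part] cross_pairs_le_turan[OF _ assms(1,3)] assms(4,5)
  by linarith

text \<open>A surplus of \<open>excess k + 1\<close> contradicts \<open>inner_edges_bound\<close>,
  so its hypothesis \<open>fan_bounded\<close> must fail, and the configuration witnessing this is
  completed to a fan by generic vertices.\<close>

theorem fan_if_dense:
  fixes r s k :: nat
  assumes r: "r \<ge> 2" and k: "k \<ge> 1"
  shows "\<exists>N. \<forall>(V :: 'v set) E. finite V \<longrightarrow> N \<le> card V \<longrightarrow> E \<subseteq> [V]\<^bsup>2\<^esup> \<longrightarrow>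
    turan_number r (card V) + (excess k + 1) \<le> card E \<longrightarrow> fan_in r s k E"
proof -
  from generic_structure[OF r k, where q = "excess k + 1" and s = s and L = "s + 2 * k + 1"]
  obtain N where N: "\<forall>(V :: 'v set) E. finite V \<longrightarrow> N \<le> card V \<longrightarrow> E \<subseteq> [V]\<^bsup>2\<^esup> \<longrightarrow>
    turan_number r (card V) + (excess k + 1) \<le> card E \<longrightarrow> \<not> fan_in r s k E \<longrightarrow>
    (\<exists>W part. W \<subseteq> V \<and> part ` W \<subseteq> {..<r} \<and>
      turan_number r (card W) + (excess k + 1) \<le> card {e \<in> E. e \<subseteq> W} \<and>
      (\<forall>j<r. s + 2 * k + 1 \<le> card {x \<in> W. part x = j \<and> (\<forall>y\<in>W. y \<noteq> x \<longrightarrow> ({x, y} \<in> E \<longleftrightarrow> part y \<noteq> j))}))" ..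
  show ?thesis
  proof (intro exI[of _ N] allI impI, rule ccontr)
    fix V :: "'v set" and E
    assume V: "finite V" "N \<le> card V" "E \<subseteq> [V]\<^bsup>2\<^esup>"
      and e: "turan_number r (card V) + (excess k + 1) \<le> card E" and nofan: "\<not> fan_in r s k E"
    obtain W part where W: "W \<subseteq> V" "part ` W \<subseteq> {..<r}"
      "turan_number r (card W) + (excess k + 1) \<le> card {e \<in> E. e \<subseteq> W}"
      "\<forall>j<r. s + 2 * k + 1 \<le> card {x \<in> W. part x = j \<and> (\<forall>y\<in>W. y \<noteq> x \<longrightarrow> ({x, y} \<in> E \<longleftrightarrow> part y \<noteq> j))}"
      using N[rule_format, OF V e nofan] by blast
    let ?F = "{e \<in> E. e \<subseteq> W}"
    define G where "G j = {x \<in> W. part x = j \<and> (\<forall>y\<in>W. y \<noteq> x \<longrightarrow> ({x, y} \<in> E \<longleftrightarrow> part y \<noteq> j))}" for j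
    have finW: "finite W" using W(1) V(1) by (rule finite_subset)
    have F2: "?F \<subseteq> [W]\<^bsup>2\<^esup>" using V(3) by (auto simp: nsets_def)
    have GL: "s + 2 * k + 1 \<le> card (G j)" if "j < r" for j using W(4) that by (simp add: G_def)
    have G: "a \<in> W \<and> part a = j \<and> (\<forall>y\<in>W. part y \<noteq> j \<longrightarrow> {a, y} \<in> ?F)" if "a \<in> G j" for j a
      using that by (auto simp: G_def)
    have gen: "has_generic W part ?F r"
    proof (rule has_genericI[of r G])
      show "G j \<noteq> {}" if "j < r" for j using GL[OF that] by auto
    qed (use G in blast)
    have "\<not> fan_bounded W part ?F k"
      using inner_edges_bound[OF finW k r W(2) F2 gen] inner_excess[OF finW F2 W(2) r W(3)] by linarith
    then obtain x Y Q where x: "x \<in> W" and Y: "Y \<subseteq> nbrs (inner part ?F) x" "finite Y"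
      and Q: "disjoint Q" "finite Q" and card: "card Y + card Q = k"
      and Qe: "\<forall>e\<in>Q. e \<in> inner part ?F \<and> part x \<notin> part ` e \<and> e \<subseteq> nbrs ?F x"
      by (elim not_fan_bounded_exact[OF _ finW F2])
    have "fan_in r s k ?F"
    proof (rule fan_in_generic[OF F2 x _ Y(2) _ Q(2,1), where G = G])
      show "part x < r" using W(2) x by auto
      show "y \<in> W \<and> part y = part x \<and> {x, y} \<in> ?F" if "y \<in> Y" for y
        using Y(1) that edgeD(2)[OF F2, of x y] by auto
      show "e \<in> ?F \<and> e \<subseteq> nbrs ?F x \<and> (\<exists>l<r. l \<noteq> part x \<and> part ` e \<subseteq> {l})" if "e \<in> Q" for e
        using bspec[OF Qe that] inner_edgeE[OF F2 _ W(2), of e "part x"] inner_subset[of part ?F] by blast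
      show "finite (G j) \<and> s + 2 * card Q \<le> card (G j)" if "j < r" for j
        using GL[OF that] card finW by (auto simp: G_def)
    qed (use G card in auto)
    then have "fan_in r s k E" by (rule fan_in_mono) auto
    then show False using nofan by simp
  qed
qed

text \<open>Inside a class, edges of the complete graph between generic vertices may be added to a
  rainbow graph after removing the edge of their colour. Unless that edge avoids their ends, it
  joins one end to a vertex of another class, and \<open>k + 1\<close> disjoint pairs of this kind can be
  swapped in simultaneously.\<close>

lemma good_pair:
  fixes col :: "'v set \<Rightarrow> nat"
  assumes F: "F \<subseteq> [W]\<^bsup>2\<^esup>" and finW: "finite W" and r: "r \<ge> 2"
    and inj: "inj_on col F"
    and U: "\<And>j a. j < r \<Longrightarrow> a \<in> U j \<Longrightarrow> a \<in> W \<and> part a = j \<and>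
        (\<forall>y\<in>W. y \<noteq> a \<longrightarrow> ({a, y} \<in> F \<longleftrightarrow> part y \<noteq> j))"
    and UL: "\<And>j. j < r \<Longrightarrow> card Z + s + 5 * k \<le> card (U j)" and k: "k \<ge> 1"
    and no_fan: "\<And>D. D \<subseteq> [W]\<^bsup>2\<^esup> \<Longrightarrow> inj_on col D \<Longrightarrow> \<not> fan_in r s k D"
    and j: "j < r" and Z: "finite Z"
  shows "\<exists>a b. a \<in> U j \<and> b \<in> U j \<and> a \<noteq> b \<and> a \<notin> Z \<and> b \<notin> Z \<and>
    (\<forall>e\<in>F. col e = col {a, b} \<longrightarrow> e \<inter> {a, b} = {})"
proof (rule ccontr)
  assume contra: "\<not> ?thesis"
  then have bad: "\<exists>e\<in>F. col e = col {a, b} \<and> e \<inter> {a, b} \<noteq> {}"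
    if "a \<in> U j" "b \<in> U j" "a \<noteq> b" "a \<notin> Z" "b \<notin> Z" for a b
    using contra that by blast
  have UW: "U i \<subseteq> W" if "i < r" for i using U[OF that] by blast
  have finU: "finite (U i)" if "i < r" for i using UW[OF that] finW by (rule finite_subset)
  have "card (U j) - card Z \<le> card (U j - Z)" by (rule diff_card_le_card_Diff[OF Z])
  \<comment> \<open>Room for \<open>k\<close> disjoint pairs, enumerated as consecutive values of
    \<open>h\<close>.\<close>
  then have "2 * k \<le> card (U j - Z)" using UL[OF j] by linarith
  then obtain T where T: "T \<subseteq> U j - Z" "card T = 2 * k" "finite T"
    by (meson obtain_subset_with_card_n)
  obtain h where h: "bij_betw h {0..<2 * k} T" using ex_bij_betw_nat_finite[OF T(3)] T(2) by auto
  have hT: "h t \<in> T" if "t < 2 * k" for t using bij_betwE[OF h] that by auto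
  have h_inj: "h t = h t' \<longleftrightarrow> t = t'" if "t < 2 * k" "t' < 2 * k" for t t'
    using inj_on_eq_iff[OF bij_betw_imp_inj_on[OF h], of t t'] that by simp
  define P where "P t = {h (2 * t), h (2 * t + 1)}" for t
  have hU: "h t \<in> U j" "h t \<notin> Z" "h t \<in> W" "part (h t) = j" if "t < 2 * k" for t
    using hT[OF that] T(1) U[OF j, of "h t"] by auto
  have P_dis: "P t \<inter> P t' = {}" if "t < k" "t' < k" "t \<noteq> t'" for t t'
    using that by (auto simp: P_def h_inj)
  have "\<exists>b z. b \<in> P t \<and> z \<in> W \<and> part z \<noteq> j \<and> {b, z} \<in> F \<and> col {b, z} = col (P t)" if t: "t < k" for t
  proof -
    have lt: "2 * t < 2 * k" "2 * t + 1 < 2 * k" using t by auto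
    obtain e where e: "e \<in> F" "col e = col (P t)" "e \<inter> P t \<noteq> {}"
      using bad[OF hU(1)[OF lt(1)] hU(1)[OF lt(2)] _ hU(2)[OF lt(1)] hU(2)[OF lt(2)]] h_inj[OF lt]
      unfolding P_def by auto
    then obtain b where b: "b \<in> e" "b \<in> P t" by blast
    have "e \<in> [W]\<^bsup>2\<^esup>" using e(1) F by blast
    then obtain z where z: "e = {b, z}" "z \<in> W" "z \<noteq> b" using b(1) by (elim nsets2_E) auto
    have "b \<in> U j" using b(2) hU(1)[OF lt(1)] hU(1)[OF lt(2)] by (auto simp: P_def)
    then have "part z \<noteq> j" using U[OF j, of b] e(1) z by auto
    then show ?thesis using b(2) z e by blast
  qed
  then have "\<forall>t. \<exists>b z. t < k \<longrightarrow> b \<in> P t \<and> z \<in> W \<and> part z \<noteq> j \<and> {b, z} \<in> F \<and> col {b, z} = col (P t)"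
    by blast
  then obtain b z where bz: "\<And>t. t < k \<Longrightarrow> b t \<in> P t \<and> z t \<in> W \<and> part (z t) \<noteq> j \<and>
      {b t, z t} \<in> F \<and> col {b t, z t} = col (P t)"
    by metis
  have PU: "a \<in> U j \<and> a \<in> T" if "t < k" "a \<in> P t" for t a
    using that hU(1)[of "2 * t"] hU(1)[of "2 * t + 1"] hT[of "2 * t"] hT[of "2 * t + 1"] by (auto simp: P_def)
  have P2: "P t \<in> [W]\<^bsup>2\<^esup>" if "t < k" for t
    using that hU(3)[of "2 * t"] hU(3)[of "2 * t + 1"] h_inj[of "2 * t" "2 * t + 1"] by (simp add: P_def)
  \<comment> \<open>The edges to be given up. Since \<open>b t\<close> lies in class
    \<open>j\<close> and \<open>z t\<close> does not, each determines its pair, so distinct pairs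
    have distinct edges and colours.\<close>
  define g where "g t = {b t, z t}" for t
  have g_inj: "t = t'" if "t < k" "t' < k" "g t = g t'" for t t'
  proof -
    have "part (b t) = j" "part (b t') = j" using PU bz that(1,2) U[OF j] by blast+
    then have "b t = b t'" using that(3) bz[OF that(1)] bz[OF that(2)] by (auto simp: g_def doubleton_eq_iff)
    then show ?thesis using P_dis[OF that(1,2)] bz[OF that(1)] bz[OF that(2)] by auto
  qed
  define D where "D = (F - g ` {..<k}) \<union> P ` {..<k}"
  have D2: "D \<subseteq> [W]\<^bsup>2\<^esup>" using F P2 by (auto simp: D_def)
  have col_g: "g t \<in> F" "col (g t) = col (P t)" if "t < k" for t using bz[OF that] by (simp_all add: g_def)
  have P_notF: "t = t'" if "t < k" "t' < k" "col (P t) = col (P t')" for t t'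
    using that col_g g_inj inj by (metis inj_onD)
  have "inj_on col D"
  proof (rule inj_onI)
    have mixed: "col d \<noteq> col (P t)" if "d \<in> F - g ` {..<k}" "t < k" for d t
      using that col_g[OF that(2)] inj by (metis DiffE imageI inj_onD lessThan_iff)
    fix d e assume de: "d \<in> D" "e \<in> D" "col d = col e"
    then consider "d \<in> F" "e \<in> F" | t where "t < k" "d = P t" "e \<in> F - g ` {..<k}"
      | t where "t < k" "e = P t" "d \<in> F - g ` {..<k}" | t t' where "t < k" "t' < k" "d = P t" "e = P t'"
      unfolding D_def by blast
    then show "d = e"
    proof cases
      case 1
      then show ?thesis using inj de(3) by (auto dest: inj_onD)
    next
      case 2
      then show ?thesis using mixed de(3) by metis
    next
      case 3
      then show ?thesis using mixed de(3) by metis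
    next
      case 4
      then show ?thesis using P_notF de(3) by metis
    qed
  qed
  moreover have "fan_in r s k D"
  proof -
    \<comment> \<open>All ends of removed edges lie in this set of at most \<open>3 * k\<close>
      vertices, so generic vertices outside it keep their adjacencies; the \<open>5 * k\<close> in
      the hypothesis leaves \<open>2 * k\<close> for the ends of the seeds.\<close>
    let ?X = "z ` {..<k} \<union> T"
    define G where "G i = U i - ?X" for i
    have cX: "card ?X \<le> 3 * k"
    proof -
      have "card ?X \<le> card (z ` {..<k}) + card T" by (rule card_Un_le)
      also have "card (z ` {..<k}) \<le> card {..<k}" by (rule card_image_le) simp
      finally show ?thesis using T(2) by simp
    qed
    have cG: "s + 2 * k \<le> card (G i)" if "i < r" for i
    proof -
      have "card (U i) - card ?X \<le> card (G i)"
        unfolding G_def by (rule diff_card_le_card_Diff) (use T(3) in simp)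
      then show ?thesis using UL[OF that] cX by linarith
    qed
    have G: "a \<in> W \<and> part a = i \<and> (\<forall>y\<in>W. part y \<noteq> i \<longrightarrow> {a, y} \<in> D)" if i: "i < r" and a: "a \<in> G i" for i a
    proof (intro conjI ballI impI)
      have aU: "a \<in> U i" using a by (simp add: G_def)
      then show "a \<in> W" "part a = i" using U[OF i] by blast+
      fix y assume y: "y \<in> W" "part y \<noteq> i"
      then have "{a, y} \<in> F" using U[OF i aU] by auto
      moreover have "{a, y} \<noteq> g t" if "t < k" for t
        using a bz[OF that] PU[OF that, of "b t"] that by (auto simp: G_def g_def doubleton_eq_iff)
      ultimately show "{a, y} \<in> D" by (auto simp: D_def)
    qed
    define i where "i = (if j = 0 then 1 else 0 :: nat)"
    have i: "i < r" "i \<noteq> j" using r by (auto simp: i_def)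
    have "G i \<noteq> {}" using cG[OF i(1)] k by auto
    then obtain w where w: "w \<in> G i" by blast
    have inj_P: "inj_on P {..<k}" using P_notF by (auto simp: inj_on_def)
    have cP: "card (P ` {..<k}) = k" using card_image[OF inj_P] by simp
    show ?thesis
    proof (rule fan_in_generic[OF D2, where x = w and Y = "{}" and Q = "P ` {..<k}" and G = G and part = part])
      show "w \<in> W" "part w < r" using G[OF i(1) w] i(1) by auto
      show "disjoint (P ` {..<k})" by (rule disjointI) (use P_dis in auto)
      fix e assume "e \<in> P ` {..<k}"
      then obtain t where t: "t < k" "e = P t" by auto
      have "part ` e \<subseteq> {j}" using PU[OF t(1)] U[OF j] t(2) by blast
      moreover have "e \<subseteq> nbrs D w"
      proof
        fix y assume "y \<in> e"
        then have "y \<in> W" "part y = j" using PU[OF t(1)] U[OF j] t(2) by blast+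
        then show "y \<in> nbrs D w" using G[OF i(1) w] i(2) by auto
      qed
      moreover have "e \<in> D" using t by (auto simp: D_def)
      ultimately show "e \<in> D \<and> e \<subseteq> nbrs D w \<and> (\<exists>l<r. l \<noteq> part w \<and> part ` e \<subseteq> {l})"
        using G[OF i(1) w] i(2) j by auto
    next
      show "finite (G i) \<and> s + 2 * card (P ` {..<k}) \<le> card (G i)" if "i < r" for i
        using cG[OF that] cP finU[OF that] by (simp add: G_def)
    qed (use G cP in auto)
  qed
  ultimately show False using no_fan[OF D2] by blast
qed

theorem rainbow_fan_if_dense:
  fixes r s k :: nat
  assumes r: "r \<ge> 2" and k: "k \<ge> 1"
  shows "\<exists>N. \<forall>(V :: 'v set) E (col :: 'v set \<Rightarrow> nat). finite V \<longrightarrow> N \<le> card V \<longrightarrow> E \<subseteq> [V]\<^bsup>2\<^esup> \<longrightarrow>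
    inj_on col E \<longrightarrow> turan_number r (card V) + (excess k + 2) \<le> card E \<longrightarrow>
    (\<exists>D\<subseteq>[V]\<^bsup>2\<^esup>. inj_on col D \<and> fan_in r s (k + 1) D)"
proof -
  \<comment> \<open>\<open>5 * (k + 1)\<close> is the demand of \<open>good_pair\<close> for
    \<open>k + 1\<close> blades; 20 is a generous allowance for the vertices to be avoided.\<close>
  define L where "L = s + 5 * (k + 1) + 20"
  have k1: "k + 1 \<ge> 1" by simp
  from generic_structure[OF r k1, where q = "excess k + 2" and s = s and L = L]
  obtain N where N: "\<forall>(V :: 'v set) E. finite V \<longrightarrow> N \<le> card V \<longrightarrow> E \<subseteq> [V]\<^bsup>2\<^esup> \<longrightarrow>
    turan_number r (card V) + (excess k + 2) \<le> card E \<longrightarrow> \<not> fan_in r s (k + 1) E \<longrightarrow>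
    (\<exists>W part. W \<subseteq> V \<and> part ` W \<subseteq> {..<r} \<and>
      turan_number r (card W) + (excess k + 2) \<le> card {e \<in> E. e \<subseteq> W} \<and>
      (\<forall>j<r. L \<le> card {x \<in> W. part x = j \<and> (\<forall>y\<in>W. y \<noteq> x \<longrightarrow> ({x, y} \<in> E \<longleftrightarrow> part y \<noteq> j))}))" ..
  show ?thesis
  proof (intro exI[of _ N] allI impI, rule ccontr)
    fix V :: "'v set" and E and col :: "'v set \<Rightarrow> nat"
    assume V: "finite V" "N \<le> card V" "E \<subseteq> [V]\<^bsup>2\<^esup>" and injE: "inj_on col E"
      and e: "turan_number r (card V) + (excess k + 2) \<le> card E"
      and contra: "\<not> (\<exists>D\<subseteq>[V]\<^bsup>2\<^esup>. inj_on col D \<and> fan_in r s (k + 1) D)"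
    then have nofan: "\<not> fan_in r s (k + 1) E" by blast
    obtain W part where W: "W \<subseteq> V" "part ` W \<subseteq> {..<r}"
      "turan_number r (card W) + (excess k + 2) \<le> card {e \<in> E. e \<subseteq> W}"
      "\<forall>j<r. L \<le> card {x \<in> W. part x = j \<and> (\<forall>y\<in>W. y \<noteq> x \<longrightarrow> ({x, y} \<in> E \<longleftrightarrow> part y \<noteq> j))}"
      using N[rule_format, OF V e nofan] by blast
    define F where "F = {e \<in> E. e \<subseteq> W}"
    define U where "U j = {x \<in> W. part x = j \<and> (\<forall>y\<in>W. y \<noteq> x \<longrightarrow> ({x, y} \<in> E \<longleftrightarrow> part y \<noteq> j))}" for j
    have finW: "finite W" using W(1) V(1) by (rule finite_subset)
    have F2: "F \<subseteq> [W]\<^bsup>2\<^esup>" using V(3) by (auto simp: nsets_def F_def)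
    have injF: "inj_on col F" using injE by (rule inj_on_subset) (auto simp: F_def)
    have UL: "L \<le> card (U j)" if "j < r" for j using W(4) that by (simp add: U_def)
    have U: "a \<in> W \<and> part a = j \<and> (\<forall>y\<in>W. y \<noteq> a \<longrightarrow> ({a, y} \<in> F \<longleftrightarrow> part y \<noteq> j))" if "a \<in> U j" for j a
      using that by (auto simp: U_def F_def)
    have no_fan: "\<not> fan_in r s (k + 1) D" if "D \<subseteq> [W]\<^bsup>2\<^esup>" "inj_on col D" for D
      using contra that nsets_mono[OF W(1), of 2] by blast
    have pair: "\<exists>a b. a \<in> U j \<and> b \<in> U j \<and> a \<noteq> b \<and> a \<notin> Z \<and> b \<notin> Z \<and>
        (\<forall>e\<in>F. col e = col {a, b} \<longrightarrow> e \<inter> {a, b} = {})"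
      if "j < r" "finite Z" "card Z \<le> 20" for j Z
    proof (rule good_pair[OF F2 finW r injF, where s = s and k = "k + 1"])
      show "card Z + s + 5 * (k + 1) \<le> card (U i)" if "i < r" for i
        using UL[OF that] \<open>card Z \<le> 20\<close> by (simp add: L_def)
    qed (use U no_fan that in auto)
    have one_edge: "card (\<Union>{e \<in> F. col e = \<alpha>}) \<le> 2 \<and> finite (\<Union>{e \<in> F. col e = \<alpha>}) \<and>
        card {e \<in> F. col e = \<alpha>} \<le> 1" for \<alpha>
    proof (cases "\<exists>e\<in>F. col e = \<alpha>")
      case True
      then obtain d where d: "d \<in> F" "col d = \<alpha>" by blast
      then have "{e \<in> F. col e = \<alpha>} = {d}" using injF by (auto dest: inj_onD)
      moreover have "d \<in> [W]\<^bsup>2\<^esup>" using d(1) F2 by blast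
      ultimately show ?thesis by (auto simp: nsets_def)
    next
      case False
      then have none: "{e \<in> F. col e = \<alpha>} = {}" by blast
      show ?thesis unfolding none by simp
    qed
    let ?D = "\<lambda>\<alpha>. \<Union>{e \<in> F. col e = \<alpha>}"
    have r01: "0 < r" "1 < r" using r by auto
    \<comment> \<open>Two disjoint candidate pairs are prepared in class 0, so that one remains
      whichever of them is hit by the edge of the colour chosen later in class 1.\<close>
    obtain a1 b1 where ab1: "a1 \<in> U 0" "b1 \<in> U 0" "a1 \<noteq> b1"
      "\<forall>e\<in>F. col e = col {a1, b1} \<longrightarrow> e \<inter> {a1, b1} = {}"
      using pair[OF r01(1), of "{}"] by auto
    obtain a2 b2 where ab2: "a2 \<in> U 0" "b2 \<in> U 0" "a2 \<noteq> b2" "a2 \<notin> {a1, b1}" "b2 \<notin> {a1, b1}"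
      "\<forall>e\<in>F. col e = col {a2, b2} \<longrightarrow> e \<inter> {a2, b2} = {}"
    proof -
      have "card {a1, b1} \<le> 20" using ab1(3) by simp
      then show ?thesis using that pair[OF r01(1), of "{a1, b1}"] by auto
    qed
    \<comment> \<open>The pair in class 1 has to avoid the edges carrying the colours of both
      candidates.\<close>
    define Z where "Z = ?D (col {a1, b1}) \<union> ?D (col {a2, b2})"
    have Z: "finite Z" "card Z \<le> 20"
    proof -
      show "finite Z" using one_edge by (auto simp: Z_def)
      have "card Z \<le> card (?D (col {a1, b1})) + card (?D (col {a2, b2}))"
        unfolding Z_def by (rule card_Un_le)
      then show "card Z \<le> 20" using one_edge[of "col {a1, b1}"] one_edge[of "col {a2, b2}"] by linarith
    qed
    obtain p q where pq: "p \<in> U 1" "q \<in> U 1" "p \<noteq> q" "p \<notin> Z" "q \<notin> Z"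
      "\<forall>e\<in>F. col e = col {p, q} \<longrightarrow> e \<inter> {p, q} = {}"
      using pair[OF r01(2) Z] by blast
    define \<beta> where "\<beta> = col {p, q}"
    text \<open>The edge of colour \<open>\<beta>\<close> cannot meet both pairs, since it has at most one end among the
      generic vertices of a class.\<close>
    have "\<exists>a b. a \<in> U 0 \<and> b \<in> U 0 \<and> a \<noteq> b \<and> (\<forall>e\<in>F. col e = col {a, b} \<longrightarrow> e \<inter> {a, b} = {}) \<and>
        ?D (col {a, b}) \<subseteq> Z \<and> (\<forall>e\<in>F. col e = \<beta> \<longrightarrow> e \<inter> {a, b} = {})"
    proof (cases "\<forall>e\<in>F. col e = \<beta> \<longrightarrow> e \<inter> {a1, b1} = {}")
      case True
      then show ?thesis using ab1 by (intro exI[of _ a1] exI[of _ b1]) (simp add: Z_def)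
    next
      case False
      then obtain d x where d: "d \<in> F" "col d = \<beta>" "x \<in> d" "x \<in> {a1, b1}" by blast
      have "e \<inter> {a2, b2} = {}" if "e \<in> F" "col e = \<beta>" for e
      proof (rule ccontr)
        assume "e \<inter> {a2, b2} \<noteq> {}"
        moreover have "e = d" using injF d(1,2) that by (auto dest: inj_onD)
        ultimately obtain y where y: "y \<in> d" "y \<in> {a2, b2}" by blast
        then have "x \<noteq> y" using d(4) ab2(4,5) by auto
        moreover have "d \<in> [W]\<^bsup>2\<^esup>" using d(1) F2 by blast
        ultimately have "d = {x, y}" using d(3) y(1) by (elim nsets2_E) auto
        moreover have "x \<in> U 0" "y \<in> U 0" using d(4) y(2) ab1 ab2 by auto
        ultimately show False using U[of x 0] U[of y 0] d(1) \<open>x \<noteq> y\<close> by auto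
      qed
      then show ?thesis using ab2 by (intro exI[of _ a2] exI[of _ b2]) (simp add: Z_def)
    qed
    then obtain a b where ab: "a \<in> U 0" "b \<in> U 0" "a \<noteq> b"
      "\<forall>e\<in>F. col e = col {a, b} \<longrightarrow> e \<inter> {a, b} = {}" "?D (col {a, b}) \<subseteq> Z"
      "\<forall>e\<in>F. col e = \<beta> \<longrightarrow> e \<inter> {a, b} = {}" by blast
    define \<alpha> where "\<alpha> = col {a, b}"
    define X where "X = {a, b, p, q}"
    define F1 where "F1 = {e \<in> F. col e \<noteq> \<alpha> \<and> col e \<noteq> \<beta>}"
    have avoid: "e \<inter> X = {}" if "e \<in> F" "col e = \<alpha> \<or> col e = \<beta>" for e
    proof -
      have "e \<inter> {a, b} = {}" using ab(4,6) that by (auto simp: \<alpha>_def)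
      moreover have "e \<inter> {p, q} = {}"
      proof (cases "col e = \<beta>")
        case True
        then show ?thesis using pq(6) that by (simp add: \<beta>_def)
      next
        case False
        then have "e \<subseteq> Z" using that ab(5) by (auto simp: \<alpha>_def)
        then show ?thesis using pq(4,5) by auto
      qed
      ultimately show ?thesis by (auto simp: X_def)
    qed
    have F1F: "F1 \<subseteq> F" by (auto simp: F1_def)
    have F12: "F1 \<subseteq> [W]\<^bsup>2\<^esup>" using F1F F2 by (rule subset_trans)
    \<comment> \<open>The deleted edges avoid \<open>X\<close>, so the ends of the two pairs remain
      generic in \<open>F1\<close>.\<close>
    have XF1: "{x, y} \<in> F1 \<longleftrightarrow> part y \<noteq> part x" if "x \<in> X" "y \<in> W" "y \<noteq> x" for x y
    proof -
      have "x \<in> U (part x)" using that(1) ab pq U by (auto simp: X_def)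
      then have "{x, y} \<in> F \<longleftrightarrow> part y \<noteq> part x" using U that by blast
      then show ?thesis using avoid[of "{x, y}"] that(1) by (auto simp: F1_def)
    qed
    have parts: "part a = 0" "part b = 0" "part p = 1" "part q = 1" and XW: "X \<subseteq> W"
      using ab pq U by (auto simp: X_def)
    have inner_X: "e \<inter> X = {}" if "e \<in> inner part F1" for e
    proof (rule ccontr)
      assume "e \<inter> X \<noteq> {}"
      then obtain x where x: "x \<in> e" "x \<in> X" by blast
      have "e \<in> [W]\<^bsup>2\<^esup>" using that F12 inner_subset by blast
      then obtain y where "e = {x, y}" "y \<in> W" "y \<noteq> x" using x(1) by (elim nsets2_E) auto
      then show False using XF1[OF x(2)] that by auto
    qed
    define Dd where "Dd = ?D \<alpha> \<union> ?D \<beta> \<union> X"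
    have Dd: "finite Dd" "card Dd \<le> 8"
    proof -
      show "finite Dd" using one_edge by (auto simp: Dd_def X_def)
      have "card Dd \<le> card (?D \<alpha> \<union> ?D \<beta>) + card X" unfolding Dd_def by (rule card_Un_le)
      moreover have "card (?D \<alpha> \<union> ?D \<beta>) \<le> card (?D \<alpha>) + card (?D \<beta>)" by (rule card_Un_le)
      moreover have "card X \<le> 4" unfolding X_def by (simp add: card_insert_if)
      ultimately show "card Dd \<le> 8" using one_edge[of \<alpha>] one_edge[of \<beta>] by linarith
    qed
    define G where "G j = U j - Dd" for j
    have GL: "s + 2 * (k + 1) + 1 \<le> card (G j) \<and> finite (G j)" if "j < r" for j
    proof -
      have "card (U j) - card Dd \<le> card (G j)" unfolding G_def by (rule diff_card_le_card_Diff[OF Dd(1)])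
      then show ?thesis using UL[OF that] Dd(2) finW by (simp add: L_def G_def U_def)
    qed
    have G: "x \<in> W \<and> part x = j \<and> (\<forall>y\<in>W. part y \<noteq> j \<longrightarrow> {x, y} \<in> F1)" if x: "x \<in> G j" for x j
    proof (intro conjI ballI impI)
      show "x \<in> W" "part x = j" using x U by (auto simp: G_def)
      fix y assume y: "y \<in> W" "part y \<noteq> j"
      then have "{x, y} \<in> F" using x U[of x j] by (auto simp: G_def)
      moreover have "x \<notin> ?D \<alpha>" "x \<notin> ?D \<beta>" using x by (auto simp: G_def Dd_def)
      ultimately show "{x, y} \<in> F1" by (auto simp: F1_def)
    qed
    have gen: "has_generic W part F1 r"
    proof (rule has_genericI[of r G])
      show "G j \<noteq> {}" if "j < r" for j using GL[OF that] by auto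
    qed (use G in blast)
    have cardF1: "card F \<le> card F1 + (if \<alpha> = \<beta> then 1 else 2)"
    proof -
      have "F = F1 \<union> ({e \<in> F. col e = \<alpha>} \<union> {e \<in> F. col e = \<beta>})" by (auto simp: F1_def)
      then have "card F \<le> card F1 + card ({e \<in> F. col e = \<alpha>} \<union> {e \<in> F. col e = \<beta>})"
        by (metis card_Un_le)
      moreover have "card ({e \<in> F. col e = \<alpha>} \<union> {e \<in> F. col e = \<beta>}) \<le> (if \<alpha> = \<beta> then 1 else 2)"
      proof (cases "\<alpha> = \<beta>")
        case True
        then show ?thesis using one_edge[of \<beta>] by simp
      next
        case False
        have "card ({e \<in> F. col e = \<alpha>} \<union> {e \<in> F. col e = \<beta>})
            \<le> card {e \<in> F. col e = \<alpha>} + card {e \<in> F. col e = \<beta>}" by (rule card_Un_le)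
        then show ?thesis using False one_edge[of \<alpha>] one_edge[of \<beta>] by simp
      qed
      ultimately show ?thesis by linarith
    qed
    have extend: False
      if D: "D \<subseteq> [W]\<^bsup>2\<^esup>" "inj_on col D" "F1 \<subseteq> D" and x: "x \<in> W"
        and Y: "finite Y" "\<And>y. y \<in> Y \<Longrightarrow> y \<in> W \<and> part y = part x \<and> {x, y} \<in> D"
        and Q: "finite Q" "disjoint Q"
          "\<And>e. e \<in> Q \<Longrightarrow> e \<in> D \<and> e \<subseteq> nbrs D x \<and> (\<exists>l<r. l \<noteq> part x \<and> part ` e \<subseteq> {l})"
        and c: "card Y + card Q = k + 1" for D x Y Q
    proof -
      have "fan_in r s (k + 1) D"
      proof (rule fan_in_generic[OF D(1) x _ Y Q, where G = G])
        show "part x < r" using x W(2) by auto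
        show "finite (G j) \<and> s + 2 * card Q \<le> card (G j)" if "j < r" for j
          using GL[OF that] c by auto
        show "y \<in> W \<and> part y = j \<and> (\<forall>z\<in>W. part z \<noteq> j \<longrightarrow> {y, z} \<in> D)" if "y \<in> G j" for j y
          using G[OF that] D(3) by blast
      qed (use c in auto)
      then show False using no_fan[OF D(1,2)] by blast
    qed
    have A2: "{a, b} \<in> [W]\<^bsup>2\<^esup>" "{p, q} \<in> [W]\<^bsup>2\<^esup>" using ab(3) pq(3) XW by (auto simp: X_def)
    have injF1: "inj_on col F1" using injF F1F by (rule inj_on_subset)
    have \<alpha>F1: "\<alpha> \<notin> col ` F1" "\<beta> \<notin> col ` F1" by (auto simp: F1_def)
    have inner1: "e \<in> F1 \<and> (\<exists>l<r. l \<noteq> part x \<and> part ` e \<subseteq> {l})"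
      if "e \<in> inner part F1" "part x \<notin> part ` e" for e x
      using inner_edgeE[OF F12 that(1) W(2) that(2)] that(1) inner_subset by blast
    have petal: False
      if x: "x \<in> W" and Y: "Y \<subseteq> nbrs (inner part F1) x" "finite Y" and Q: "disjoint Q" "finite Q"
        "\<And>e. e \<in> Q \<Longrightarrow> e \<in> inner part F1 \<and> part x \<notin> part ` e \<and> e \<subseteq> nbrs F1 x"
        and c: "card Y + card Q = k"
        and uv: "u \<in> X" "v \<in> X" "u \<noteq> v" "part u = part v" "part u \<noteq> part x" "col {u, v} \<notin> col ` F1"
      for x Y Q u v
    proof (rule extend[where D = "insert {u, v} F1" and x = x and Y = Y and Q = "insert {u, v} Q"])
      have uvW: "u \<in> W" "v \<in> W" using uv(1,2) XW by auto
      show "insert {u, v} F1 \<subseteq> [W]\<^bsup>2\<^esup>" using F12 uvW uv(3) by simp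
      show "inj_on col (insert {u, v} F1)" using injF1 uv(6) by (auto simp: inj_on_insert)
      show "y \<in> W \<and> part y = part x \<and> {x, y} \<in> insert {u, v} F1" if "y \<in> Y" for y
        using Y(1) that edgeD(2)[OF F12, of x y] by auto
      have notQ: "{u, v} \<inter> e = {}" if "e \<in> Q" for e using inner_X[of e] Q(3)[OF that] uv(1,2) by blast
      then have "{u, v} \<notin> Q" by blast
      then show "card Y + card (insert {u, v} Q) = k + 1" using c Q(2) by simp
      show "disjoint (insert {u, v} Q)"
        using Q(1) notQ by (auto simp: pairwise_insert disjnt_def Int_commute)
      have ux: "{x, u} \<in> F1" "{x, v} \<in> F1"
      proof -
        have "x \<noteq> u" "x \<noteq> v" using uv(4,5) by auto
        then have "{u, x} \<in> F1" "{v, x} \<in> F1" using XF1[OF uv(1) x] XF1[OF uv(2) x] uv(4,5) by simp_all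
        then show "{x, u} \<in> F1" "{x, v} \<in> F1" by (simp_all add: insert_commute)
      qed
      fix e assume "e \<in> insert {u, v} Q"
      then show "e \<in> insert {u, v} F1 \<and> e \<subseteq> nbrs (insert {u, v} F1) x \<and> (\<exists>l<r. l \<noteq> part x \<and> part ` e \<subseteq> {l})"
      proof
        assume "e = {u, v}"
        moreover have "part u < r" using uvW W(2) by auto
        ultimately show ?thesis using ux uv(4,5) by auto
      next
        assume "e \<in> Q"
        then show ?thesis using Q(3) inner1 by fastforce
      qed
    qed (use x Y(2) Q(2) in auto)
    show False
    proof (cases "fan_bounded W part F1 k")
      case False
      obtain x Y Q where xYQ: "x \<in> W" "Y \<subseteq> nbrs (inner part F1) x" "finite Y" "disjoint Q" "finite Q"
        "card Y + card Q = k"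
        "\<forall>e\<in>Q. e \<in> inner part F1 \<and> part x \<notin> part ` e \<and> e \<subseteq> nbrs F1 x"
        using not_fan_bounded_exact[OF False finW F12] .
      note xYQ7 = xYQ(7)[rule_format]
      show False
      \<comment> \<open>The inserted pair must lie outside the class of the centre, and the pairs
        lie in classes 0 and 1.\<close>
      proof (cases "part x = 0")
        case True
        then show False
          using petal[OF xYQ(1-5) xYQ7 xYQ(6), of p q] parts pq(3) \<alpha>F1 by (simp add: X_def \<beta>_def)
      next
        case False
        then show False
          using petal[OF xYQ(1-5) xYQ7 xYQ(6), of a b] parts ab(3) \<alpha>F1 by (simp add: X_def \<alpha>_def)
      qed
    next
      case True
      have bound: "card (inner part F1) \<le> excess k + card (missing W part F1)"
        "card (inner part F1) = excess k + card (missing W part F1) \<Longrightarrow>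
          \<exists>i<r. matching_number (class_edges part F1 i) \<ge> k - 1"
        using inner_edges_bound[OF finW k r W(2) F12 gen True] by auto
      have F_card: "turan_number r (card W) + (excess k + 2) \<le> card F" using W(3) by (simp add: F_def)
      \<comment> \<open>With equal colours only one edge would have been given up, and the remaining
        surplus \<open>excess k + 1\<close> would violate the bound. Distinct colours are needed to
        insert both pairs at once.\<close>
      have ne: "\<alpha> \<noteq> \<beta>"
      proof
        assume "\<alpha> = \<beta>"
        then have "turan_number r (card W) + (excess k + 1) \<le> card F1" using cardF1 F_card by simp
        from inner_excess[OF finW F12 W(2) r this] show False using bound(1) by simp
      qed
      then have "turan_number r (card W) + excess k \<le> card F1" using cardF1 F_card by simp
      from inner_excess[OF finW F12 W(2) r this]
      obtain i where i: "i < r" "matching_number (class_edges part F1 i) \<ge> k - 1"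
        using bound by auto
      have CF: "class_edges part F1 i \<subseteq> F1" by (auto simp: class_edges_def)
      have finC: "finite (class_edges part F1 i)"
        by (rule finite_subset[OF CF finite_edges[OF finW F12]])
      obtain M where M: "M \<subseteq> class_edges part F1 i" "disjoint M"
        "card M = matching_number (class_edges part F1 i)" using maximum_matching[OF finC] .
      obtain Q where Q: "Q \<subseteq> M" "card Q = k - 1" "finite Q"
        using obtain_subset_with_card_n[of "k - 1" M] i(2) M(3) by auto
      have disQ: "disjoint Q" using M(2) Q(1) by (rule pairwise_subset)
      have Qi: "e \<in> inner part F1 \<and> e \<in> F1 \<and> part ` e \<subseteq> {i}" if "e \<in> Q" for e
      proof -
        have "e \<in> class_edges part F1 i" using that Q(1) M(1) by blast
        then show ?thesis by (auto simp: class_edges_def inner_def)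
      qed
      define D where "D = insert {a, b} (insert {p, q} F1)"
      have D2: "D \<subseteq> [W]\<^bsup>2\<^esup>" using F12 A2 by (simp add: D_def)
      have injD: "inj_on col D"
        using injF1 \<alpha>F1 ne by (auto simp: D_def inj_on_insert \<alpha>_def \<beta>_def)
      \<comment> \<open>The centre \<open>x\<close> is an end of the pair outside class
        \<open>i\<close>; its partner \<open>y\<close> is a seed inside its class, and the other
        pair joins the \<open>k - 1\<close> disjoint edges of class \<open>i\<close>, in total
        \<open>1 + 1 + (k - 1)\<close> blades.\<close>
      have final: False
        if xy: "{x, y} = {a, b} \<and> {u, v} = {p, q} \<or> {x, y} = {p, q} \<and> {u, v} = {a, b}"
          and ix: "i \<noteq> part x" for x y u v
      proof (rule extend[where D = D and x = x and Y = "{y}" and Q = "insert {u, v} Q"])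
        have X: "x \<in> X" "y \<in> X" "u \<in> X" "v \<in> X" using xy by (auto simp: X_def)
        show "D \<subseteq> [W]\<^bsup>2\<^esup>" "inj_on col D" "F1 \<subseteq> D" using D2 injD by (auto simp: D_def)
        show "x \<in> W" using X(1) XW by blast
        have pxy: "part x = part y" "part u = part v" "part u \<noteq> part x"
          using xy parts by (auto simp: doubleton_eq_iff)
        show "z \<in> W \<and> part z = part x \<and> {x, z} \<in> D" if "z \<in> {y}" for z
          using that X XW pxy xy by (auto simp: D_def)
        have notQ: "{u, v} \<inter> e = {}" if "e \<in> Q" for e using inner_X[of e] Qi[OF that] X(3,4) by blast
        then have "{u, v} \<notin> Q" by blast
        then show "card {y} + card (insert {u, v} Q) = k + 1" using Q k by simp
        show "disjoint (insert {u, v} Q)"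
          using disQ notQ by (auto simp: pairwise_insert disjnt_def Int_commute)
        fix e assume "e \<in> insert {u, v} Q"
        then have e: "e \<in> D" "\<exists>l<r. l \<noteq> part x \<and> part ` e \<subseteq> {l}"
        proof -
          have "part u < r" using X(3) XW W(2) by auto
          then show "\<exists>l<r. l \<noteq> part x \<and> part ` e \<subseteq> {l}"
            using \<open>e \<in> insert {u, v} Q\<close> Qi i(1) ix pxy by auto
          show "e \<in> D" using \<open>e \<in> insert {u, v} Q\<close> Qi xy by (auto simp: D_def)
        qed
        moreover have "e \<subseteq> nbrs D x"
        proof
          fix z assume z: "z \<in> e"
          then have "part z \<noteq> part x" using e(2) by auto
          moreover have "z \<in> W" using e(1) D2 z by (auto simp: nsets_def)
          ultimately have "{x, z} \<in> F1" using XF1[OF X(1), of z] by auto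
          then show "z \<in> nbrs D x" by (simp add: D_def)
        qed
        ultimately show "e \<in> D \<and> e \<subseteq> nbrs D x \<and> (\<exists>l<r. l \<noteq> part x \<and> part ` e \<subseteq> {l})" by blast
      qed (use Q in auto)
      show False
      proof (cases "i = 0")
        case True
        then show False using final[of p q a b] parts by simp
      next
        case False
        then show False using final[of a b p q] parts by simp
      qed
    qed
  qed
qed

section \<open>Extremal and anti-Ramsey numbers\<close>

lemma ex_number_eqI:
  assumes "\<And>E. E \<subseteq> [{..<n}]\<^bsup>2\<^esup> \<Longrightarrow> t < card E \<Longrightarrow> contains_copy \<lparr>verts = {..<n}, edges = E\<rparr> F"
    and "E0 \<subseteq> [{..<n}]\<^bsup>2\<^esup>" "card E0 = t" "\<not> contains_copy \<lparr>verts = {..<n}, edges = E0\<rparr> F"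
  shows "ex_number n F = t"
proof -
  let ?A = "{card (edges G) | G :: nat sgraph. simple_graph G \<and> verts G = {..<n} \<and> \<not> contains_copy G F}"
  have le: "y \<le> t" if y: "y \<in> ?A" for y
  proof -
    obtain G :: "nat sgraph" where G: "y = card (edges G)" "simple_graph G" "verts G = {..<n}" "\<not> contains_copy G F"
      using y by blast
    have "\<not> contains_copy \<lparr>verts = {..<n}, edges = edges G\<rparr> F"
      using G(3,4) by (simp add: contains_copy_def embedding_def)
    then show ?thesis using assms(1)[of "edges G"] G(1-3) by (force simp: simple_graph_def not_le)
  qed
  have "t \<in> ?A"
    using assms(2-4) by (intro CollectI exI[of _ "\<lparr>verts = {..<n}, edges = E0\<rparr>"]) (simp add: simple_graph_def)
  moreover have "finite ?A" by (rule finite_subset[of _ "{..t}"]) (use le in auto)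
  ultimately show ?thesis unfolding ex_number_def by (intro Max_eqI le)
qed

lemma ar_number_eqI:
  assumes "\<And>c. \<not> has_rainbow_copy c (complete_graph n) F \<Longrightarrow> card (c ` edges (complete_graph n)) \<le> t"
    and "\<not> has_rainbow_copy c0 (complete_graph n) F" "card (c0 ` edges (complete_graph n)) = t"
  shows "ar_number n F = t"
proof -
  let ?A = "{card (c ` edges (complete_graph n)) | c. \<not> has_rainbow_copy c (complete_graph n) F}"
  have le: "y \<le> t" if "y \<in> ?A" for y using that assms(1) by auto
  have "t \<in> ?A" using assms(2,3) by auto
  moreover have "finite ?A" by (rule finite_subset[of _ "{..t}"]) (use le in auto)
  ultimately show ?thesis unfolding ar_number_def by (intro Max_eqI le)
qed

lemma edge_critical_nonempty:
  assumes "simple_graph G" "edge_critical G"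
  shows "verts G \<noteq> {}"
proof -
  obtain e where "e \<in> edges G" using assms(2) by (auto simp: edge_critical_def)
  then have "e \<in> [verts G]\<^bsup>2\<^esup>" using assms(1) by (auto simp: simple_graph_def)
  then show ?thesis by (auto simp: nsets_def)
qed

text \<open>\<open>fan_embedding\<close> controls only edges. As every blade is nonempty and joined
  to the centre, every vertex lies on an edge, so the image of the vertices is contained in
  \<open>V\<close>.\<close>

lemma embedding_if_fan:
  fixes H :: "'i \<Rightarrow> 'a sgraph" and E :: "'v set set"
  assumes r: "r \<ge> 2" and I: "finite I" "I \<noteq> {}"
    and H: "\<And>i. i \<in> I \<Longrightarrow> simple_graph (H i) \<and> edge_critical (H i) \<and> chromatic_number (H i) = r"
    and dis: "disjoint_family_on (\<lambda>i. verts (H i)) I" and v: "v \<notin> (\<Union>i\<in>I. verts (H i))"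
    and s: "card (\<Union>i\<in>I. verts (H i)) \<le> s"
    and E: "E \<subseteq> [V]\<^bsup>2\<^esup>" and fan: "fan_in r s (card I) E"
  obtains f where "embedding f (suspension H I v) \<lparr>verts = V, edges = E\<rparr>"
proof -
  obtain f where f: "inj_on f (verts (suspension H I v))" "\<forall>e\<in>edges (suspension H I v). f ` e \<in> E"
    using fan_embedding[OF r I(1) H dis v s E fan] by blast
  have *: "f v \<in> V \<and> f x \<in> V" if "i \<in> I" "x \<in> verts (H i)" for i x
  proof -
    have "{v, x} \<in> edges (suspension H I v)" using that by (auto simp: suspension_def)
    then have "f ` {v, x} \<in> E" using f(2) by blast
    then have "{f v, f x} \<in> E" by simp
    then show ?thesis using edgeD(1,2)[OF E] by blast
  qed
  obtain i where i: "i \<in> I" using I(2) by blast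
  then obtain x where "x \<in> verts (H i)" using edge_critical_nonempty H by blast
  then have "f v \<in> V" using * i by blast
  then have "f ` verts (suspension H I v) \<subseteq> V" using * by (auto simp: suspension_def)
  then show ?thesis using f by (intro that[of f]) (simp add: embedding_def)
qed

text \<open>Without the centre, an edge is a nonempty subset of a blade. Nonemptiness together with
  disjointness of the blades makes that blade unique.\<close>

lemma suspension_edge_blade:
  assumes "e \<in> edges (suspension H I v)" "\<And>i. i \<in> I \<Longrightarrow> simple_graph (H i)" "v \<notin> (\<Union>i\<in>I. verts (H i))"
  shows "\<exists>i\<in>I. e - {v} \<subseteq> verts (H i) \<and> e - {v} \<noteq> {}"
proof -
  consider i where "i \<in> I" "e \<in> edges (H i)" | i x where "i \<in> I" "x \<in> verts (H i)" "e = {v, x}"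
    using assms(1) by (auto simp: suspension_def)
  then show ?thesis
  proof cases
    case 1
    then have "e \<in> [verts (H i)]\<^bsup>2\<^esup>" using assms(2) by (auto simp: simple_graph_def)
    then have "e \<subseteq> verts (H i)" "e \<noteq> {}" by (auto simp: nsets_def)
    moreover have "v \<notin> e" using calculation(1) assms(3) 1 by blast
    ultimately show ?thesis using 1 by blast
  next
    case 2
    then have "x \<noteq> v" using assms(3) by blast
    then show ?thesis using 2 by blast
  qed
qed

lemma suspension_mono:
  assumes "J \<subseteq> I"
  shows "verts (suspension H J v) \<subseteq> verts (suspension H I v)" "edges (suspension H J v) \<subseteq> edges (suspension H I v)"
  using assms by (auto simp: suspension_def)

text \<open>A rainbow copy uses at most one edge outside \<open>E\<close>; dropping the blade containing it leaves
  a copy inside \<open>E\<close>.\<close>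

lemma rainbow_coloring:
  fixes H :: "nat \<Rightarrow> 'a sgraph" and E :: "nat set set"
  assumes E: "E \<subseteq> [{..<n}]\<^bsup>2\<^esup>" "E \<noteq> [{..<n}]\<^bsup>2\<^esup>"
    and I: "finite I" "I \<noteq> {}" and H: "\<And>i. i \<in> I \<Longrightarrow> simple_graph (H i)"
    and dis: "disjoint_family_on (\<lambda>i. verts (H i)) I" and v: "v \<notin> (\<Union>i\<in>I. verts (H i))"
    and no: "\<And>i. i \<in> I \<Longrightarrow> \<not> contains_copy \<lparr>verts = {..<n}, edges = E\<rparr> (suspension H (I - {i}) v)"
  obtains c where "\<not> has_rainbow_copy c (complete_graph n) (suspension H I v)"
    "card (c ` edges (complete_graph n)) = card E + 1"
proof -
  have finE: "finite E" by (rule finite_edges[OF _ E(1)]) simp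
  obtain h where h: "bij_betw h E {0..<card E}" using ex_bij_betw_finite_nat[OF finE] by blast
  \<comment> \<open>Positive colours, all different, on \<open>E\<close>, and the common colour 0
    outside.\<close>
  define c where "c e = (if e \<in> E then Suc (h e) else 0)" for e
  have hE: "h ` E = {0..<card E}" using h by (simp add: bij_betw_def)
  have "c ` [{..<n}]\<^bsup>2\<^esup> = insert 0 (Suc ` h ` E)"
  proof (intro equalityI subsetI)
    fix y assume "y \<in> insert 0 (Suc ` h ` E)"
    then show "y \<in> c ` [{..<n}]\<^bsup>2\<^esup>"
    proof
      assume "y = 0"
      obtain e where "e \<in> [{..<n}]\<^bsup>2\<^esup>" "e \<notin> E" using E by blast
      then show ?thesis using \<open>y = 0\<close> by (intro image_eqI[of _ _ e]) (auto simp: c_def)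
    next
      assume "y \<in> Suc ` h ` E"
      then obtain e where "e \<in> E" "y = Suc (h e)" by blast
      then show ?thesis using E(1) by (intro image_eqI[of _ _ e]) (auto simp: c_def)
    qed
  qed (auto simp: c_def)
  then have "card (c ` [{..<n}]\<^bsup>2\<^esup>) = card E + 1"
    unfolding hE by (simp add: card_image)
  moreover have "\<not> has_rainbow_copy c (complete_graph n) (suspension H I v)"
  proof
    let ?F = "suspension H I v"
    assume "has_rainbow_copy c (complete_graph n) ?F"
    then obtain f where f: "embedding f ?F (complete_graph n)" "inj_on c ((`) f ` edges ?F)"
      unfolding has_rainbow_copy_def rainbow_def by blast
    have inj: "inj_on f (verts ?F)" and range: "f ` verts ?F \<subseteq> {..<n}"
      using f(1) by (auto simp: embedding_def complete_graph_def)
    have sub: "e \<subseteq> verts ?F" if "e \<in> edges ?F" for e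
      using suspension_edge_blade[OF that H v] by (auto simp: suspension_def)
    have uniq: "d = e" if de: "d \<in> edges ?F" "e \<in> edges ?F" "f ` d \<notin> E" "f ` e \<notin> E" for d e
    proof -
      have "c (f ` d) = c (f ` e)" using de by (simp add: c_def)
      then have "f ` d = f ` e" using de by (intro inj_onD[OF f(2)]) auto
      then show ?thesis using inj_on_image_eq_iff[OF inj sub sub] de by blast
    qed
    have "\<exists>i\<in>I. \<forall>e\<in>edges ?F. f ` e \<notin> E \<longrightarrow> e - {v} \<subseteq> verts (H i) \<and> e - {v} \<noteq> {}"
    proof (cases "\<exists>d\<in>edges ?F. f ` d \<notin> E")
      case True
      then obtain d where d: "d \<in> edges ?F" "f ` d \<notin> E" by blast
      obtain i where "i \<in> I" "d - {v} \<subseteq> verts (H i) \<and> d - {v} \<noteq> {}"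
        using suspension_edge_blade[OF d(1) H v] by blast
      then show ?thesis using uniq[OF d(1) _ d(2)] by blast
    next
      case False
      then show ?thesis using I(2) by blast
    qed
    then obtain i where i: "i \<in> I"
      "\<And>e. e \<in> edges ?F \<Longrightarrow> f ` e \<notin> E \<Longrightarrow> e - {v} \<subseteq> verts (H i) \<and> e - {v} \<noteq> {}"
      by blast
    let ?F' = "suspension H (I - {i}) v"
    have "f ` e \<in> E" if e: "e \<in> edges ?F'" for e
    proof (rule ccontr)
      assume "f ` e \<notin> E"
      then have ei: "e - {v} \<subseteq> verts (H i)" "e - {v} \<noteq> {}"
        using i(2) suspension_mono(2)[of "I - {i}" I H v] e by blast+
      have "\<exists>l\<in>I - {i}. e - {v} \<subseteq> verts (H l) \<and> e - {v} \<noteq> {}"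
        by (rule suspension_edge_blade[OF e]) (use H v in auto)
      then obtain l where l: "l \<in> I" "l \<noteq> i" "e - {v} \<subseteq> verts (H l)" by blast
      have "verts (H l) \<inter> verts (H i) = {}" by (rule disjoint_family_onD[OF dis l(1) i(1) l(2)])
      then show False using ei l(3) by blast
    qed
    moreover have "verts ?F' \<subseteq> verts ?F" by (rule suspension_mono) auto
    ultimately have "embedding f ?F' \<lparr>verts = {..<n}, edges = E\<rparr>"
      using inj range by (auto simp: embedding_def intro: inj_on_subset)
    then show False using no[OF i(1)] unfolding contains_copy_def by blast
  qed
  ultimately show ?thesis by (intro that[of c]) (simp_all add: complete_graph_def)
qed

theorem theorem1p1:
  fixes k r :: nat
  assumes "k \<ge> 1" and "r \<ge> 2"
  shows "\<exists>\<phi> :: nat \<Rightarrow> nat list \<Rightarrow> nat.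
    \<forall>(H :: nat \<Rightarrow> 'a sgraph) (v :: 'a) (n :: nat).
      (\<forall>i\<in>{1..k+1}. simple_graph (H i) \<and> edge_critical (H i) \<and> chromatic_number (H i) = r) \<and>
      disjoint_family_on (\<lambda>i. verts (H i)) {1..k+1} \<and>
      v \<notin> (\<Union>i\<in>{1..k+1}. verts (H i)) \<and>
      n \<ge> \<phi> r (map (\<lambda>i. card (verts (H i))) [1..<k+2]) \<longrightarrow>
      (\<forall>j\<in>{1..k+1}.
        ar_number n (suspension H {1..k+1} v)
          = ex_number n (suspension H ({1..k+1} - {j}) v) + 1 \<and>
        real (ex_number n (suspension H ({1..k+1} - {j}) v) + 1)
          = real (turan_number r n) + 1 +
            (if odd k then (real k)\<^sup>2 - real k else (real k)\<^sup>2 - 3 / 2 * real k))"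
proof -
  have "\<forall>s. \<exists>N. \<forall>(V :: nat set) E. finite V \<longrightarrow> N \<le> card V \<longrightarrow> E \<subseteq> [V]\<^bsup>2\<^esup> \<longrightarrow>
    turan_number r (card V) + (excess k + 1) \<le> card E \<longrightarrow> fan_in r s k E"
    using fan_if_dense[OF assms(2,1)] by blast
  from choice[OF this] obtain N1 where N1: "\<forall>s. \<forall>(V :: nat set) E. finite V \<longrightarrow> N1 s \<le> card V \<longrightarrow>
    E \<subseteq> [V]\<^bsup>2\<^esup> \<longrightarrow> turan_number r (card V) + (excess k + 1) \<le> card E \<longrightarrow> fan_in r s k E" ..
  have "\<forall>s. \<exists>N. \<forall>(V :: nat set) E (col :: nat set \<Rightarrow> nat). finite V \<longrightarrow> N \<le> card V \<longrightarrow> E \<subseteq> [V]\<^bsup>2\<^esup> \<longrightarrow>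
    inj_on col E \<longrightarrow> turan_number r (card V) + (excess k + 2) \<le> card E \<longrightarrow>
    (\<exists>D\<subseteq>[V]\<^bsup>2\<^esup>. inj_on col D \<and> fan_in r s (k + 1) D)"
    using rainbow_fan_if_dense[OF assms(2,1)] by blast
  from choice[OF this] obtain N2 where N2: "\<forall>s. \<forall>(V :: nat set) E (col :: nat set \<Rightarrow> nat). finite V \<longrightarrow>
    N2 s \<le> card V \<longrightarrow> E \<subseteq> [V]\<^bsup>2\<^esup> \<longrightarrow>
    inj_on col E \<longrightarrow> turan_number r (card V) + (excess k + 2) \<le> card E \<longrightarrow>
    (\<exists>D\<subseteq>[V]\<^bsup>2\<^esup>. inj_on col D \<and> fan_in r s (k + 1) D)" ..
  \<comment> \<open>The list of sizes enters only through its sum, which bounds the fillers needed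
    per class. The term \<open>2 * k * r + 1\<close> makes room for the extremal
    construction.\<close>
  define \<phi> :: "nat \<Rightarrow> nat list \<Rightarrow> nat" where
    "\<phi> = (\<lambda>_ l. N1 (sum_list l) + N2 (sum_list l) + 2 * k * r + 1)"
  show ?thesis
  proof (intro exI[of _ \<phi>] allI impI, elim conjE, intro ballI)
    fix H :: "nat \<Rightarrow> 'a sgraph" and v :: 'a and n j :: nat
    let ?I = "{1..k+1}"
    define s where "s = sum_list (map (\<lambda>i. card (verts (H i))) [1..<k+2])"
    assume H: "\<forall>i\<in>?I. simple_graph (H i) \<and> edge_critical (H i) \<and> chromatic_number (H i) = r"
      and dis: "disjoint_family_on (\<lambda>i. verts (H i)) ?I" and v: "v \<notin> (\<Union>i\<in>?I. verts (H i))"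
      and n: "n \<ge> \<phi> r (map (\<lambda>i. card (verts (H i))) [1..<k+2])" and j: "j \<in> ?I"
    have nN: "N1 s \<le> card {..<n}" "N2 s \<le> card {..<n}" "n > 2 * k * r"
      using n by (auto simp: \<phi>_def s_def)
    have cI: "card (?I - {i}) = k" if "i \<in> ?I" for i using that by simp
    have disI: "disjoint_family_on (\<lambda>i. verts (H i)) J" if "J \<subseteq> ?I" for J
      using disjoint_family_on_mono[OF that dis] .
    have sI: "card (\<Union>i\<in>J. verts (H i)) \<le> s" if J: "J \<subseteq> ?I" for J
    proof -
      have "card (\<Union>i\<in>J. verts (H i)) \<le> (\<Sum>i\<in>J. card (verts (H i)))"
        by (rule card_UN_le) (rule finite_subset[OF J], simp)
      also have "\<dots> \<le> (\<Sum>i\<in>?I. card (verts (H i)))" by (rule sum_mono2) (use J in auto)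
      also have "\<dots> = s"
      proof -
        have "set [1..<k+2] = ?I" by auto
        then show ?thesis unfolding s_def by (simp only: interv_sum_list_conv_sum_set_nat)
      qed
      finally show ?thesis .
    qed
    obtain E0 where E0: "E0 \<subseteq> [{..<n}]\<^bsup>2\<^esup>" "card E0 = turan_number r n + excess k" "E0 \<noteq> [{..<n}]\<^bsup>2\<^esup>"
      and E0_free: "\<And>(H :: nat \<Rightarrow> 'a sgraph) I v. finite I \<Longrightarrow> card I = k \<Longrightarrow>
      (\<And>i. i \<in> I \<Longrightarrow> simple_graph (H i) \<and> chromatic_number (H i) = r) \<Longrightarrow>
      disjoint_family_on (\<lambda>i. verts (H i)) I \<Longrightarrow> v \<notin> (\<Union>i\<in>I. verts (H i)) \<Longrightarrow>
      \<not> contains_copy \<lparr>verts = {..<n}, edges = E0\<rparr> (suspension H I v)"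
      using extremal_construction[OF assms nN(3)] by metis
    have free: "\<not> contains_copy \<lparr>verts = {..<n}, edges = E0\<rparr> (suspension H (?I - {i}) v)" if i: "i \<in> ?I" for i
      by (rule E0_free) (use cI[OF i] H disI[of "?I - {i}"] v in auto)
    have ex: "ex_number n (suspension H (?I - {j}) v) = turan_number r n + excess k"
    proof (rule ex_number_eqI[OF _ E0(1,2) free[OF j]])
      fix E assume E: "E \<subseteq> [{..<n}]\<^bsup>2\<^esup>" "turan_number r n + excess k < card E"
      have "fan_in r s k E"
        using N1[rule_format, of "{..<n}" s E] nN(1) E by simp
      then have fan: "fan_in r s (card (?I - {j})) E" using cI[OF j] by simp
      have ne: "?I - {j} \<noteq> {}"
        using cI[OF j] assms(1) by (metis card.empty not_one_le_zero)
      obtain f where "embedding f (suspension H (?I - {j}) v) \<lparr>verts = {..<n}, edges = E\<rparr>"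
      proof (rule embedding_if_fan[OF assms(2) _ ne _ disI _ sI E(1) fan])
        show "v \<notin> (\<Union>i\<in>?I - {j}. verts (H i))" using v by blast
      qed (use H in auto)
      then show "contains_copy \<lparr>verts = {..<n}, edges = E\<rparr> (suspension H (?I - {j}) v)"
        unfolding contains_copy_def by blast
    qed
    have ar: "ar_number n (suspension H ?I v) = turan_number r n + excess k + 1"
    proof -
      obtain c0 where c0: "\<not> has_rainbow_copy c0 (complete_graph n) (suspension H ?I v)"
        "card (c0 ` edges (complete_graph n)) = card E0 + 1"
      proof (rule rainbow_coloring[OF E0(1,3) _ _ _ dis v free])
        show "?I \<noteq> {}" by simp
      qed (use H in auto)
      show ?thesis
      proof (rule ar_number_eqI[OF _ c0(1)])
        show "card (c0 ` edges (complete_graph n)) = turan_number r n + excess k + 1"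
          using c0(2) E0(2) by simp
        fix c assume no: "\<not> has_rainbow_copy c (complete_graph n) (suspension H ?I v)"
        show "card (c ` edges (complete_graph n)) \<le> turan_number r n + excess k + 1"
        proof (rule ccontr)
          assume big: "\<not> ?thesis"
          \<comment> \<open>\<open>subset_image_inj\<close> is applied to the full image in order to
            choose one edge of each colour.\<close>
          have "c ` [{..<n}]\<^bsup>2\<^esup> \<subseteq> c ` [{..<n}]\<^bsup>2\<^esup>" by simp
          then obtain E where E: "E \<subseteq> [{..<n}]\<^bsup>2\<^esup>" "inj_on c E" "c ` [{..<n}]\<^bsup>2\<^esup> = c ` E"
            unfolding subset_image_inj by blast
          have "card E = card (c ` [{..<n}]\<^bsup>2\<^esup>)" using E(2,3) by (simp add: card_image)
          then have "turan_number r n + (excess k + 2) \<le> card E"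
            using big by (simp add: complete_graph_def)
          then obtain D where D: "D \<subseteq> [{..<n}]\<^bsup>2\<^esup>" "inj_on c D" "fan_in r s (k + 1) D"
            using N2[rule_format, of "{..<n}" s E c] nN(2) E(1,2) by auto
          have fan: "fan_in r s (card ?I) D" using D(3) by simp
          obtain f where f: "embedding f (suspension H ?I v) \<lparr>verts = {..<n}, edges = D\<rparr>"
          proof (rule embedding_if_fan[OF assms(2) _ _ _ dis v sI D(1) fan])
            show "?I \<noteq> {}" by simp
          qed (use H in auto)
          then have "embedding f (suspension H ?I v) (complete_graph n)"
            using D(1) by (auto simp: embedding_def complete_graph_def)
          moreover have "inj_on c ((`) f ` edges (suspension H ?I v))"
            by (rule inj_on_subset[OF D(2)]) (use f in \<open>auto simp: embedding_def\<close>)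
          ultimately show False using no unfolding has_rainbow_copy_def rainbow_def by blast
        qed
      qed
    qed
    show "ar_number n (suspension H ?I v) = ex_number n (suspension H (?I - {j}) v) + 1 \<and>
        real (ex_number n (suspension H (?I - {j}) v) + 1) = real (turan_number r n) + 1 +
          (if odd k then (real k)\<^sup>2 - real k else (real k)\<^sup>2 - 3 / 2 * real k)"
      using ex ar real_excess[OF assms(1)] by simp
  qed
qed

end
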